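(* Let $m,n\in\mathbb N$ with $m\equiv n\pmod 2$, and let $\sigma\in\mathcal B_{nm}$ with $r=\operatorname{rank}(\sigma)$. If $m\geq n$, and if $r=m=n$ does not hold, then the rank of the regular semigroup $P^\sigma=\operatorname{Reg}(\mathcal B_{mn}^\sigma)$ is $$\operatorname{rank}(P^\sigma)=\frac{(m+r-1)!!}{(2r-1)!!}+\begin{cases}1&\text{if }r\geq2\\0&\text{if }r\leq1.\end{cases}$$
   Context: $\mathbb N=\{0,1,2,\ldots\}$, $[n]=\{1,\ldots,n\}$ (with $[0]=\emptyset$), and $A'=\{a':a\in A\}$, $A''=\{a'':a\in A\}$ for $A\subseteq\mathbb N$. For $m,n\in\mathbb N$, $\mathcal B_{mn}$ is the set of all Brauer partitions, i.e. set partitions of $[m]\cup[n]'$ into blocks of size $2$. For $\alpha\in\mathcal B_{mn}$ and $\beta\in\mathcal B_{nk}$, the product $\alpha\beta\in\mathcal B_{mk}$ is formed as follows: view partitions as graphs whose connected components are the blocks; let $\alpha_\downarrow$ be the graph on $[m]\cup[n]''$ obtained from $\alpha$ by renaming each $x'$ to $x''$, let $\beta^\uparrow$ be the graph on $[n]''\cup[k]'$ obtained from $\beta$ by renaming each $x\in[n]$ to $x''$, and let $\Pi(\alpha,\beta)$ be the union of these graphs on $[m]\cup[n]''\cup[k]'$; two elements of $[m]\cup[k]'$ lie in the same block of $\alpha\beta$ iff they lie in the same connected component of $\Pi(\alpha,\beta)$. The rank of a partition $\alpha\in\mathcal B_{mn}$ is the number of blocks of $\alpha$ meeting both $[m]$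 and $[n]'$. For $\sigma\in\mathcal B_{nm}$, the sandwich semigroup $\mathcal B_{mn}^\sigma$ is the set $\mathcal B_{mn}$ with the associative operation $\alpha\star_\sigma\beta=\alpha\sigma\beta$. $\operatorname{Reg}(T)$ denotes the set of (von Neumann) regular elements of a semigroup $T$; $\operatorname{Reg}(\mathcal B_{mn}^\sigma)$ is a subsemigroup of $\mathcal B_{mn}^\sigma$. The rank of a semigroup $T$, $\operatorname{rank}(T)$, is the minimum size of a generating set for $T$ (as a semigroup). For odd $k\ge1$, $k!!=k(k-2)\cdots3\cdot1$, and $(-1)!!=1$. *)

theory Defs
  imports Complex_Main "HOL-Library.Disjoint_Sets"
begin

text \<open>
  The vertices \<open>Upper i\<close>, \<open>Lower i\<close> and \<open>Mid i\<close> stand for \<open>i\<close>, \<open>i'\<close> and \<open>i''\<close>.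
\<close>

datatype vertex = Upper nat | Mid nat | Lower nat

definition vertices :: "nat \<Rightarrow> nat \<Rightarrow> vertex set" where
  "vertices m n = Upper ` {1..m} \<union> Lower ` {1..n}"

definition brauer :: "nat \<Rightarrow> nat \<Rightarrow> vertex set set set" where
  "brauer m n = {\<alpha>. partition_on (vertices m n) \<alpha> \<and> (\<forall>B\<in>\<alpha>. card B = 2)}"

definition prank :: "vertex set set \<Rightarrow> nat" where
  "prank \<alpha> = card {B \<in> \<alpha>. B \<inter> range Upper \<noteq> {} \<and> B \<inter> range Lower \<noteq> {}}"

fun lower_to_mid :: "vertex \<Rightarrow> vertex" where
  "lower_to_mid (Lower i) = Mid i"
| "lower_to_mid v = v"

fun upper_to_mid :: "vertex \<Rightarrow> vertex" where
  "upper_to_mid (Upper i) = Mid i"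
| "upper_to_mid v = v"

text \<open>
  Among the graphs whose connected components are the blocks of a partition, we use
  the one joining any two vertices of a common block.
\<close>

definition block_graph :: "vertex set set \<Rightarrow> (vertex \<times> vertex) set" where
  "block_graph \<alpha> = {(x, y). \<exists>B\<in>\<alpha>. x \<in> B \<and> y \<in> B}"

definition product_graph ::
    "vertex set set \<Rightarrow> vertex set set \<Rightarrow> (vertex \<times> vertex) set" where
  "product_graph \<alpha> \<beta> =
     block_graph ((`) lower_to_mid ` \<alpha>) \<union> block_graph ((`) upper_to_mid ` \<beta>)"

text \<open>
  \<open>pprod m k \<alpha> \<beta>\<close> is the product of \<open>\<alpha> \<in> brauer m n\<close> and \<open>\<beta> \<in> brauer n k\<close>; the
  edge relation of \<open>product_graph\<close> is symmetric, so reachability is connectedness.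
\<close>

definition pprod ::
    "nat \<Rightarrow> nat \<Rightarrow> vertex set set \<Rightarrow> vertex set set \<Rightarrow> vertex set set" where
  "pprod m k \<alpha> \<beta> =
     vertices m k //
       {(x, y). x \<in> vertices m k \<and> y \<in> vertices m k \<and> (x, y) \<in> (product_graph \<alpha> \<beta>)\<^sup>*}"

definition sandwich ::
    "nat \<Rightarrow> nat \<Rightarrow> vertex set set \<Rightarrow> vertex set set \<Rightarrow> vertex set set \<Rightarrow> vertex set set" where
  "sandwich m n \<sigma> \<alpha> \<beta> = pprod m n (pprod m m \<alpha> \<sigma>) \<beta>"

definition regular_elements :: "'a set \<Rightarrow> ('a \<Rightarrow> 'a \<Rightarrow> 'a) \<Rightarrow> 'a set" where
  "regular_elements T f = {x \<in> T. \<exists>y\<in>T. f (f x y) x = x}"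

inductive_set generated :: "('a \<Rightarrow> 'a \<Rightarrow> 'a) \<Rightarrow> 'a set \<Rightarrow> 'a set"
  for f :: "'a \<Rightarrow> 'a \<Rightarrow> 'a" and A :: "'a set" where
  base: "x \<in> A \<Longrightarrow> x \<in> generated f A"
| mult: "x \<in> generated f A \<Longrightarrow> y \<in> generated f A \<Longrightarrow> f x y \<in> generated f A"

text \<open>
  The rank of the semigroup with carrier \<open>T\<close> and operation \<open>f\<close>. It is a natural number,
  hence meaningful only if \<open>T\<close> is finitely generated (in particular if \<open>T\<close> is finite).
\<close>

definition semigroup_rank :: "'a set \<Rightarrow> ('a \<Rightarrow> 'a \<Rightarrow> 'a) \<Rightarrow> nat" where
  "semigroup_rank T f = (LEAST k. \<exists>A\<subseteq>T. finite A \<and> card A = k \<and> generated f A = T)"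

text \<open>Defined on integers in order to have \<open>(-1)!! = 1\<close>.\<close>

definition double_factorial :: "int \<Rightarrow> int" where
  "double_factorial k = (\<Prod>i\<in>{i\<in>{1..k}. even (k - i)}. i)"

end

theory Submission
  imports Defs "HOL-Combinatorics.Permutations"
begin

text \<open>
  Factor \<open>\<sigma> = \<sigma>1 \<bullet> \<sigma>2\<close> through \<open>r = rank \<sigma>\<close> points \<open>R\<close>. Let \<open>A\<close> be the set of diagrams \<open>a\<close> with
  \<open>\<sigma>2 \<bullet> a = 1\<close> and \<open>B\<close> the set of diagrams \<open>b\<close> with \<open>b \<bullet> \<sigma>1 = 1\<close>. The regular elements of the sandwich
  semigroup are exactly the products \<open>a \<bullet> x \<bullet> b\<close> with \<open>x\<close> in the Brauer monoid on \<open>R\<close>, they multiply as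
  \<open>(a \<bullet> x \<bullet> b)(a' \<bullet> y \<bullet> b') = a \<bullet> (x \<bullet> y) \<bullet> b'\<close>, and \<open>a\<close>, \<open>x\<close>, \<open>b\<close> are determined by the product if \<open>x\<close> is
  a permutation.

  Hence every generating set contains, for each \<open>a \<in> A\<close>, an element \<open>a \<bullet> x \<bullet> b\<close> with \<open>x\<close> a permutation, and one
  further element if \<open>r \<ge> 2\<close>. Since \<open>card B \<le> card A\<close> and \<open>card A \<ge> 2 * r + 1\<close>, as many elements suffice: let
  their third entries run through \<open>B\<close> and their middle entries through a star of transpositions, and add
  one element whose middle entry is a hook.

  The set \<open>A\<close> is counted by contracting the arcs of \<open>\<sigma>2\<close> one at a time: a matching of \<open>N\<close> points arises from
  \<open>N + 1\<close> matchings of \<open>N + 2\<close> points, because the two new points are either joined to each other or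
  inserted, in one of two orders, into one of the \<open>N / 2\<close> edges.
\<close>

section \<open>Gluing set partitions\<close>

text \<open>The obstacle is to show that a regular element has the form
  \<open>a \<bullet> x \<bullet> b\<close>: with \<open>u = \<alpha> \<bullet> \<sigma>1\<close> and
  \<open>x = \<sigma>2 \<bullet> u\<close>, one diagram \<open>a\<close> has to satisfy both
  \<open>\<sigma>2 \<bullet> a = id_diagram R\<close> and \<open>a \<bullet> x = u\<close>. Since
  \<open>a \<bullet> x\<close> keeps the lower arcs of \<open>x\<close>, these must occur in
  \<open>u\<close>; regularity ensures this, and it suffices. The lifting and the count of
  \<open>A\<close> proceed edge by edge. For this, products are instances of an operation
  \<open>\<odot>\<close> on arbitrary matchings, whose result lives on the symmetric difference of
  the vertex sets. It is commutative, and associative if no vertex is common to all three operands,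
  so a matching can be cut into edges that are glued on one after another. Closed loops vanish
  without special treatment. With \<open>m = r + 2 * k\<close> and \<open>n = r + 2 * l\<close>, the
  sizes of \<open>A\<close> and \<open>B\<close> are the products of the first \<open>k\<close> and
  the first \<open>l\<close> of the numbers \<open>2 * r + 1\<close>, \<open>2 * r + 3\<close>, and
  so on. Hence \<open>n \<le> m\<close> makes \<open>A\<close> at least as large as
  \<open>B\<close>, and excluding \<open>r = m = n\<close> leaves the factor
  \<open>2 * r + 1\<close>, which suffices for the at most \<open>r + 1\<close> permutations
  needed.\<close>

definition same_block :: "'a set set \<Rightarrow> ('a \<times> 'a) set" where
  "same_block M = {(x, y). \<exists>B\<in>M. x \<in> B \<and> y \<in> B}"

definition components :: "'a set \<Rightarrow> ('a \<times> 'a) set \<Rightarrow> 'a set set" where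
  "components Z E = Z // {(x, y). x \<in> Z \<and> y \<in> Z \<and> (x, y) \<in> E\<^sup>*}"

text \<open>
  The vertices common to \<open>M\<close> and \<open>N\<close> play the role of the middle row of a product: they
  only serve to connect and do not belong to the result.
\<close>

definition glue :: "'a set set \<Rightarrow> 'a set set \<Rightarrow> 'a set set"  (infixl "\<odot>" 70) where
  "M \<odot> N = components (sym_diff (\<Union>M) (\<Union>N)) (same_block M \<union> same_block N)"

abbreviation relabel :: "('a \<Rightarrow> 'b) \<Rightarrow> 'a set set \<Rightarrow> 'b set set" where
  "relabel f M \<equiv> (`) f ` M"

lemma sym_same_block: "sym (same_block M)"
  by (auto simp: same_block_def sym_def)

lemma same_block_Un: "same_block (M \<union> N) = same_block M \<union> same_block N"
  by (auto simp: same_block_def)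

lemma same_block_subset: "same_block M \<subseteq> \<Union>M \<times> \<Union>M"
  by (auto simp: same_block_def)

lemma equiv_connected:
  assumes "sym E"
  shows "equiv Z {(x, y). x \<in> Z \<and> y \<in> Z \<and> (x, y) \<in> E\<^sup>*}"
  using symD[OF sym_rtrancl[OF assms]]
  by (intro equivI) (auto simp: refl_on_def sym_def trans_def)

lemma components_cong:
  assumes "\<And>x y. x \<in> Z \<Longrightarrow> y \<in> Z \<Longrightarrow> (x, y) \<in> E\<^sup>* \<longleftrightarrow> (x, y) \<in> F\<^sup>*"
  shows "components Z E = components Z F"
proof -
  have "{(x, y). x \<in> Z \<and> y \<in> Z \<and> (x, y) \<in> E\<^sup>*} = {(x, y). x \<in> Z \<and> y \<in> Z \<and> (x, y) \<in> F\<^sup>*}"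
    using assms by auto
  then show ?thesis by (simp add: components_def)
qed

lemma partition_on_components: "sym E \<Longrightarrow> partition_on Z (components Z E)"
  unfolding components_def by (rule partition_on_quotient[OF equiv_connected])

lemma Union_components: "sym E \<Longrightarrow> \<Union>(components Z E) = Z"
  using partition_on_components partition_onD1 by metis

lemma same_block_components:
  assumes "sym E"
  shows "same_block (components Z E) = {(x, y). x \<in> Z \<and> y \<in> Z \<and> (x, y) \<in> E\<^sup>*}" (is "_ = ?R")
proof -
  have eq: "equiv Z ?R" using equiv_connected[OF assms] .
  show ?thesis
  proof (intro set_eqI iffI; clarify)
    fix x y assume "(x, y) \<in> same_block (components Z E)"
    then obtain B where "B \<in> Z // ?R" "x \<in> B" "y \<in> B"
      by (auto simp: same_block_def components_def)
    then have "(x, y) \<in> ?R" using quotient_eq_iff[OF eq] by blast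
    then show "x \<in> Z \<and> y \<in> Z \<and> (x, y) \<in> E\<^sup>*" by simp
  next
    fix x y assume xy: "x \<in> Z" "y \<in> Z" "(x, y) \<in> E\<^sup>*"
    have "?R `` {x} \<in> components Z E" unfolding components_def using xy(1) by (rule quotientI)
    moreover have "x \<in> ?R `` {x}" "y \<in> ?R `` {x}" using xy by simp_all
    ultimately show "(x, y) \<in> same_block (components Z E)"
      unfolding same_block_def by (intro CollectI case_prodI bexI conjI)
  qed
qed

lemma sym_glue_edges: "sym (same_block M \<union> same_block N)"
  by (simp add: sym_Un sym_same_block)

lemma partition_on_glue: "partition_on (sym_diff (\<Union>M) (\<Union>N)) (M \<odot> N)"
  unfolding glue_def by (rule partition_on_components[OF sym_glue_edges])

lemma Union_glue: "\<Union>(M \<odot> N) = sym_diff (\<Union>M) (\<Union>N)"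
  unfolding glue_def by (rule Union_components[OF sym_glue_edges])

lemma glue_commute: "M \<odot> N = N \<odot> M"
  by (simp add: glue_def Un_commute)

lemma restrict_rel_eq:
  assumes "S \<subseteq> Z \<times> Z" "\<And>x y. x \<in> Z \<Longrightarrow> y \<in> Z \<Longrightarrow> (x, y) \<in> R \<longleftrightarrow> (x, y) \<in> S"
  shows "{(x, y). x \<in> Z \<and> y \<in> Z \<and> (x, y) \<in> R} = S"
  using assms by blast

text \<open>A partition is the quotient by its own \<open>same_block\<close> relation, so a gluing
  is identified by connectivity between the surviving vertices alone.\<close>

lemma glue_eqI:
  assumes K: "partition_on (sym_diff (\<Union>M) (\<Union>N)) K"
    and iff: "\<And>x y. x \<in> sym_diff (\<Union>M) (\<Union>N) \<Longrightarrow> y \<in> sym_diff (\<Union>M) (\<Union>N) \<Longrightarrow>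
      (x, y) \<in> (same_block M \<union> same_block N)\<^sup>* \<longleftrightarrow> (x, y) \<in> same_block K"
  shows "M \<odot> N = K"
proof -
  let ?Z = "sym_diff (\<Union>M) (\<Union>N)"
  have "same_block K \<subseteq> ?Z \<times> ?Z"
    using same_block_subset[of K] partition_onD1[OF K] by simp
  then have "{(x, y). x \<in> ?Z \<and> y \<in> ?Z \<and> (x, y) \<in> (same_block M \<union> same_block N)\<^sup>*} = same_block K"
    by (rule restrict_rel_eq) (rule iff)
  then have "M \<odot> N = ?Z // same_block K"
    unfolding glue_def components_def by simp
  also have "\<dots> = K"
    using partition_on_eq_quotient[OF K] by (simp add: same_block_def)
  finally show ?thesis .
qed

text \<open>
  Only the vertices of \<open>Z\<close> can be shared with \<open>B\<close>, so a path splits into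
  \<open>A\<close>-segments between vertices of \<open>Z\<close> and \<open>B\<close>-steps.
\<close>

lemma rtrancl_Un_restrict:
  fixes A B :: "('a \<times> 'a) set"
  assumes A: "A \<subseteq> V \<times> V" and B: "B \<subseteq> W \<times> W" and VW: "V \<inter> W \<subseteq> Z"
    and x: "x \<in> Z \<union> (W - V)" and y: "y \<in> Z \<union> (W - V)"
  shows "(x, y) \<in> (A \<union> B)\<^sup>* \<longleftrightarrow> (x, y) \<in> ({(u, v). u \<in> Z \<and> v \<in> Z \<and> (u, v) \<in> A\<^sup>*} \<union> B)\<^sup>*"
    (is "_ \<longleftrightarrow> _ \<in> ?R\<^sup>*")
proof
  assume "(x, y) \<in> (A \<union> B)\<^sup>*"
  \<comment> \<open>The vertex \<open>w\<close> is where the pending \<open>A\<close>-segment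
    begins. An \<open>A\<close>-step extends the segment; a \<open>B\<close>-step forces it, unless
    it is empty, to run between two vertices of \<open>Z\<close>, so that it becomes one edge of
    \<open>?R\<close>.\<close>
  then have "\<exists>w. (x, w) \<in> ?R\<^sup>* \<and> (w, y) \<in> A\<^sup>* \<and> w \<in> Z \<union> (W - V)"
  proof (induction rule: rtrancl_induct)
    case base
    then show ?case using x by blast
  next
    case (step y z)
    then obtain w where w: "(x, w) \<in> ?R\<^sup>*" "(w, y) \<in> A\<^sup>*" "w \<in> Z \<union> (W - V)" by blast
    show ?case
    proof (cases "(y, z) \<in> A")
      case True
      then show ?thesis using w by (meson rtrancl.rtrancl_into_rtrancl)
    next
      case False
      then have yz: "(y, z) \<in> B" using step by blast
      have "(x, y) \<in> ?R\<^sup>*"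
      proof (cases "w = y")
        case True
        then show ?thesis using w by simp
      next
        case False
        then have "w \<in> V" "y \<in> V"
          using w(2) A by (meson converse_rtranclE mem_Sigma_iff subsetD, meson rtranclE mem_Sigma_iff subsetD)
        then have "w \<in> Z" "y \<in> Z" using w(3) yz B VW by auto
        then have "(w, y) \<in> ?R" using w(2) by blast
        then show ?thesis using w(1) by (rule rtrancl_into_rtrancl[rotated])
      qed
      then have "(x, z) \<in> ?R\<^sup>*" using yz by (meson UnI2 rtrancl.rtrancl_into_rtrancl)
      moreover have "z \<in> Z \<union> (W - V)" using yz B VW by blast
      ultimately show ?thesis by blast
    qed
  qed
  then obtain w where w: "(x, w) \<in> ?R\<^sup>*" "(w, y) \<in> A\<^sup>*" "w \<in> Z \<union> (W - V)" by blast
  show "(x, y) \<in> ?R\<^sup>*"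
  proof (cases "w = y")
    case True
    then show ?thesis using w by simp
  next
    case False
    then have "w \<in> V" "y \<in> V"
      using w(2) A by (meson converse_rtranclE mem_Sigma_iff subsetD, meson rtranclE mem_Sigma_iff subsetD)
    then have "(w, y) \<in> ?R" using w y by auto
    then show ?thesis using w(1) by (rule rtrancl_into_rtrancl[rotated])
  qed
next
  have "?R \<subseteq> (A \<union> B)\<^sup>*"
    using rtrancl_mono[of A "A \<union> B"] by auto
  then show "(x, y) \<in> ?R\<^sup>* \<Longrightarrow> (x, y) \<in> (A \<union> B)\<^sup>*"
    using rtrancl_subset_rtrancl by blast
qed

text \<open>The result is symmetric in the three operands, which together with commutativity yields
  associativity. A vertex common to all three would be deleted by the first gluing and return with
  \<open>N\<close>, cut off from its edges in \<open>L\<close> and \<open>M\<close>.\<close>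

lemma glue_glue:
  assumes "\<Union>L \<inter> \<Union>M \<inter> \<Union>N = {}"
  shows "(L \<odot> M) \<odot> N = components (sym_diff (sym_diff (\<Union>L) (\<Union>M)) (\<Union>N))
    (same_block L \<union> same_block M \<union> same_block N)"
proof -
  let ?A = "same_block L \<union> same_block M"
  let ?Z = "sym_diff (\<Union>L) (\<Union>M)"
  have "(L \<odot> M) \<odot> N = components (sym_diff ?Z (\<Union>N)) ({(x, y). x \<in> ?Z \<and> y \<in> ?Z \<and> (x, y) \<in> ?A\<^sup>*} \<union> same_block N)"
    unfolding glue_def[of "L \<odot> M" N] Union_glue
    by (simp add: glue_def same_block_components[OF sym_glue_edges])
  also have "\<dots> = components (sym_diff ?Z (\<Union>N)) (?A \<union> same_block N)"
  proof (rule components_cong)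
    fix x y assume xy: "x \<in> sym_diff ?Z (\<Union>N)" "y \<in> sym_diff ?Z (\<Union>N)"
    show "(x, y) \<in> ({(x, y). x \<in> ?Z \<and> y \<in> ?Z \<and> (x, y) \<in> ?A\<^sup>*} \<union> same_block N)\<^sup>* \<longleftrightarrow>
        (x, y) \<in> (?A \<union> same_block N)\<^sup>*"
    proof (rule rtrancl_Un_restrict[symmetric, where V = "\<Union>L \<union> \<Union>M" and W = "\<Union>N"])
      show "?A \<subseteq> (\<Union>L \<union> \<Union>M) \<times> (\<Union>L \<union> \<Union>M)"
        using same_block_subset[of L] same_block_subset[of M] by blast
      show "same_block N \<subseteq> \<Union>N \<times> \<Union>N" by (rule same_block_subset)
    qed (use xy assms in blast)+
  qed
  finally show ?thesis .
qed

lemma glue_assoc: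
  assumes "\<Union>L \<inter> \<Union>M \<inter> \<Union>N = {}"
  shows "(L \<odot> M) \<odot> N = L \<odot> (M \<odot> N)"
proof -
  have "L \<odot> (M \<odot> N) = (M \<odot> N) \<odot> L" by (rule glue_commute)
  also have "\<dots> = components (sym_diff (sym_diff (\<Union>M) (\<Union>N)) (\<Union>L))
    (same_block M \<union> same_block N \<union> same_block L)"
    by (rule glue_glue) (use assms in blast)
  also have "sym_diff (sym_diff (\<Union>M) (\<Union>N)) (\<Union>L) = sym_diff (sym_diff (\<Union>L) (\<Union>M)) (\<Union>N)"
    by blast
  also have "same_block M \<union> same_block N \<union> same_block L = same_block L \<union> same_block M \<union> same_block N"
    by blast
  also have "components (sym_diff (sym_diff (\<Union>L) (\<Union>M)) (\<Union>N)) \<dots> = (L \<odot> M) \<odot> N"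
    by (rule glue_glue[OF assms, symmetric])
  finally show ?thesis ..
qed

lemma glue_disjoint:
  assumes "partition_on X M" "partition_on Y N" "X \<inter> Y = {}"
  shows "M \<odot> N = M \<union> N"
proof (rule glue_eqI)
  have X: "\<Union>M = X" and Y: "\<Union>N = Y" using assms partition_onD1 by metis+
  have Z: "sym_diff (\<Union>M) (\<Union>N) = X \<union> Y" using X Y assms(3) by blast
  show P: "partition_on (sym_diff (\<Union>M) (\<Union>N)) (M \<union> N)"
    unfolding partition_on_def
    using assms X Y Z disjoint_union[of M N] by (auto simp: partition_on_def)
  fix x y assume xy: "x \<in> sym_diff (\<Union>M) (\<Union>N)" "y \<in> sym_diff (\<Union>M) (\<Union>N)"
  have eq: "equiv (X \<union> Y) (same_block (M \<union> N))"
    using equiv_partition_on[OF P[unfolded Z]] by (simp add: same_block_def)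
  have "(x, y) \<in> (same_block (M \<union> N))\<^sup>* \<longleftrightarrow> x = y \<or> (x, y) \<in> same_block (M \<union> N)"
    using eq by (metis equivE rtrancl_eq_or_trancl trancl_id)
  moreover have "(x, x) \<in> same_block (M \<union> N)" using xy by (auto simp: same_block_def)
  ultimately show "(x, y) \<in> (same_block M \<union> same_block N)\<^sup>* \<longleftrightarrow> (x, y) \<in> same_block (M \<union> N)"
    by (auto simp: same_block_Un)
qed

lemma glue_self: "M \<odot> M = {}"
  by (simp add: glue_def components_def)

lemma partition_on_relabel:
  assumes "partition_on X M" "inj_on f X"
  shows "partition_on (f ` X) (relabel f M)"
proof -
  have "{} \<notin> relabel f M" using partition_onD3[OF assms(1)] by auto
  then show ?thesis using partition_on_inj_image[OF assms] by simp
qed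

text \<open>Injectivity has to cover the shared vertices as well, since identifying two of them
  could merge components.\<close>

lemma glue_relabel:
  assumes "inj_on f (\<Union>M \<union> \<Union>N)"
  shows "relabel f M \<odot> relabel f N = relabel f (M \<odot> N)"
proof (rule glue_eqI)
  let ?E = "same_block M \<union> same_block N" and ?X = "\<Union>M \<union> \<Union>N"
  let ?F = "same_block (relabel f M) \<union> same_block (relabel f N)"
  have Z: "sym_diff (\<Union>(relabel f M)) (\<Union>(relabel f N)) = f ` sym_diff (\<Union>M) (\<Union>N)"
    unfolding image_Union[symmetric] image_Un
    by (subst (1 2) inj_on_image_set_diff[OF assms]) auto
  show "partition_on (sym_diff (\<Union>(relabel f M)) (\<Union>(relabel f N))) (relabel f (M \<odot> N))"
    unfolding Z
    by (rule partition_on_relabel[OF partition_on_glue inj_on_subset[OF assms]]) blast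
  have F: "?F = {(f x, f y) | x y. (x, y) \<in> ?E}"
    by (auto simp: same_block_def)
  have fwd: "(f x, v) \<in> ?F\<^sup>* \<Longrightarrow> \<exists>y\<in>?X. v = f y \<and> (x, y) \<in> ?E\<^sup>*" if "x \<in> ?X" for x v
  proof (induction rule: rtrancl_induct)
    case base
    then show ?case using that by blast
  next
    case (step v w)
    then obtain y where y: "y \<in> ?X" "v = f y" "(x, y) \<in> ?E\<^sup>*" by blast
    obtain y' z where z: "v = f y'" "w = f z" "(y', z) \<in> ?E" using step.hyps(2) unfolding F by blast
    have "y' \<in> ?X" "z \<in> ?X" using z(3) by (auto simp: same_block_def)
    then have "y' = y" using y z assms by (metis inj_onD)
    then have "(x, z) \<in> ?E\<^sup>*" using y z by (meson rtrancl.rtrancl_into_rtrancl)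
    then show ?case using z \<open>z \<in> ?X\<close> by blast
  qed
  have bwd: "(x, y) \<in> ?E\<^sup>* \<Longrightarrow> (f x, f y) \<in> ?F\<^sup>*" for x y
  proof (induction rule: rtrancl_induct)
    case (step y z)
    then have "(f y, f z) \<in> ?F" unfolding F by blast
    with step show ?case by (meson rtrancl.rtrancl_into_rtrancl)
  qed simp
  fix u v
  assume "u \<in> sym_diff (\<Union>(relabel f M)) (\<Union>(relabel f N))" "v \<in> sym_diff (\<Union>(relabel f M)) (\<Union>(relabel f N))"
  then obtain x y where xy: "u = f x" "v = f y" "x \<in> sym_diff (\<Union>M) (\<Union>N)" "y \<in> sym_diff (\<Union>M) (\<Union>N)"
    unfolding Z by blast
  have "(u, v) \<in> ?F\<^sup>* \<longleftrightarrow> (x, y) \<in> ?E\<^sup>*"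
    using fwd[of x v] bwd[of x y] xy inj_onD[OF assms] by blast
  also have "\<dots> \<longleftrightarrow> (x, y) \<in> same_block (M \<odot> N)"
    unfolding glue_def same_block_components[OF sym_glue_edges] using xy by blast
  also have "\<dots> \<longleftrightarrow> (u, v) \<in> same_block (relabel f (M \<odot> N))"
  proof
    assume "(u, v) \<in> same_block (relabel f (M \<odot> N))"
    then obtain B where B: "B \<in> M \<odot> N" "u \<in> f ` B" "v \<in> f ` B" by (auto simp: same_block_def)
    have "B \<subseteq> sym_diff (\<Union>M) (\<Union>N)" using B(1) Union_glue[of M N] by blast
    then have "x \<in> B" "y \<in> B" using B xy inj_onD[OF assms] by blast+
    then show "(x, y) \<in> same_block (M \<odot> N)" using B by (auto simp: same_block_def)
  qed (use xy in \<open>auto simp: same_block_def\<close>)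
  finally show "(u, v) \<in> ?F\<^sup>* \<longleftrightarrow> (u, v) \<in> same_block (relabel f (M \<odot> N))" .
qed

section \<open>Gluing perfect matchings\<close>

definition matching_on :: "'a set \<Rightarrow> 'a set set \<Rightarrow> bool" where
  "matching_on X M \<longleftrightarrow> partition_on X M \<and> (\<forall>B\<in>M. card B = 2)"

lemma matching_on_partition: "matching_on X M \<Longrightarrow> partition_on X M"
  by (simp add: matching_on_def)

lemma matching_on_Union: "matching_on X M \<Longrightarrow> \<Union>M = X"
  by (simp add: matching_on_def partition_on_def)

lemma matching_on_empty [simp]: "matching_on {} M \<longleftrightarrow> M = {}"
  by (auto simp: matching_on_def partition_on_empty)

lemma matching_on_blockE:
  assumes "matching_on X M" "B \<in> M"
  obtains a b where "B = {a, b}" "a \<noteq> b" "a \<in> X" "b \<in> X"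
proof -
  have "card B = 2" "B \<subseteq> X" using assms by (auto simp: matching_on_def partition_on_def)
  then show thesis using that by (auto simp: card_2_iff)
qed

lemma matching_on_block_unique:
  assumes "matching_on X M" "B \<in> M" "C \<in> M" "x \<in> B" "x \<in> C"
  shows "B = C"
  using assms by (auto simp: matching_on_def partition_on_def disjoint_def)

lemma matching_on_edge:
  assumes "matching_on X M" "{a, b} \<in> M"
  shows "a \<noteq> b" "a \<in> X" "b \<in> X"
  using matching_on_blockE[OF assms] by (metis doubleton_eq_iff)+

lemma matching_on_partner_unique:
  assumes "matching_on X M" "{a, b} \<in> M" "{a, c} \<in> M"
  shows "b = c"
proof -
  have "{a, b} = {a, c}" using matching_on_block_unique[OF assms] by blast
  then show ?thesis by (metis doubleton_eq_iff)
qed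

lemma matching_on_partner:
  assumes "matching_on X M" "a \<in> X"
  obtains b where "{a, b} \<in> M" "a \<noteq> b" "b \<in> X"
proof -
  obtain B where B: "B \<in> M" "a \<in> B" using assms matching_on_Union by blast
  obtain c d where "B = {c, d}" "c \<noteq> d" "c \<in> X" "d \<in> X" by (rule matching_on_blockE[OF assms(1) B(1)])
  then show thesis using that B by (metis insertE insert_commute singletonD)
qed

lemma matching_on_doubleton: "a \<noteq> b \<Longrightarrow> matching_on {a, b} {{a, b}}"
  by (simp add: matching_on_def partition_on_space)

lemma matching_on_Un:
  assumes "matching_on X M" "matching_on Y N" "X \<inter> Y = {}"
  shows "matching_on (X \<union> Y) (M \<union> N)"
  using assms disjoint_union[of M N] by (auto simp: matching_on_def partition_on_def)

lemma matching_on_insert: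
  assumes "matching_on X M" "a \<noteq> b" "a \<notin> X" "b \<notin> X"
  shows "matching_on (insert a (insert b X)) (insert {a, b} M)"
  using matching_on_Un[OF matching_on_doubleton[OF assms(2)] assms(1)] assms by simp

lemma matching_on_subset:
  assumes "matching_on X M" "N \<subseteq> M"
  shows "matching_on (\<Union>N) N"
  using assms by (auto simp: matching_on_def partition_on_def disjoint_def)

lemma matching_on_Diff:
  assumes M: "matching_on X M" and N: "N \<subseteq> M"
  shows "matching_on (X - \<Union>N) (M - N)"
proof -
  have "\<Union>(M - N) = X - \<Union>N"
    using matching_on_Union[OF M] matching_on_block_unique[OF M] N by blast
  then show ?thesis using matching_on_subset[OF M Diff_subset[of M N]] by simp
qed

lemma matching_on_remove:
  assumes "matching_on X M" "{a, b} \<in> M"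
  shows "matching_on (X - {a, b}) (M - {{a, b}})"
  using matching_on_Diff[OF assms(1), of "{{a, b}}"] assms(2) by simp

lemma matching_on_relabel:
  assumes "matching_on X M" "inj_on f X"
  shows "matching_on (f ` X) (relabel f M)"
  unfolding matching_on_def
proof
  show "partition_on (f ` X) (relabel f M)"
    using partition_on_relabel assms by (auto simp: matching_on_def)
  show "\<forall>B\<in>relabel f M. card B = 2"
  proof clarify
    fix B assume "B \<in> M"
    then have "inj_on f B" "card B = 2" using assms by (auto simp: matching_on_def partition_on_def inj_on_def)
    then show "card (f ` B) = 2" by (simp add: card_image)
  qed
qed

lemma finite_matching_on: "matching_on X M \<Longrightarrow> finite X \<Longrightarrow> finite M"
  using finite_elements by (auto simp: matching_on_def)

lemma finite_matchings: "finite X \<Longrightarrow> finite {M. matching_on X M}"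
  using finitely_many_partition_on[of X] by (rule finite_subset[rotated]) (auto simp: matching_on_def)

text \<open>Adding one edge at a time suits gluing: an edge on fresh vertices is added by gluing it
  on, and associativity then moves it to the other operand.\<close>

lemma matching_on_induct [consumes 2, case_names empty insert]:
  assumes "finite X" "matching_on X M"
    and "P {} {}"
    and "\<And>X M a b. finite X \<Longrightarrow> matching_on X M \<Longrightarrow> a \<noteq> b \<Longrightarrow> a \<notin> X \<Longrightarrow> b \<notin> X \<Longrightarrow> P X M \<Longrightarrow>
      P (insert a (insert b X)) (insert {a, b} M)"
  shows "P X M"
  using assms(1,2)
proof (induction "card X" arbitrary: X M rule: less_induct)
  case less
  show ?case
  proof (cases "X = {}")
    case True
    then show ?thesis using less.prems assms(3) by simp
  next
    case False
    then obtain a where "a \<in> X" by blast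
    then obtain b where ab: "{a, b} \<in> M" "a \<noteq> b" "a \<in> X" "b \<in> X" using matching_on_partner less.prems by metis
    let ?X = "X - {a, b}" and ?M = "M - {{a, b}}"
    have M: "matching_on ?X ?M" using matching_on_remove less.prems ab by metis
    have "card ?X < card X" using less.prems ab by (intro psubset_card_mono) auto
    then have "P ?X ?M" using less.prems M by (intro less.hyps) auto
    then have "P (insert a (insert b ?X)) (insert {a, b} ?M)"
      using ab M less.prems by (intro assms(4)) auto
    moreover have "insert a (insert b ?X) = X" "insert {a, b} ?M = M" using ab by auto
    ultimately show ?thesis by simp
  qed
qed

lemma glue_matching_disjoint:
  assumes "matching_on X M" "matching_on Y N" "X \<inter> Y = {}"
  shows "M \<odot> N = M \<union> N"
  using assms by (intro glue_disjoint) (auto dest: matching_on_partition)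

lemma glue_empty [simp]:
  assumes "matching_on X M"
  shows "{} \<odot> M = M" "M \<odot> {} = M"
  using glue_matching_disjoint[of "{}" "{}" X M] assms by (simp_all add: glue_commute)

lemma glue_matching_assoc:
  assumes "matching_on X L" "matching_on Y M" "matching_on Z N" "X \<inter> Y \<inter> Z = {}"
  shows "(L \<odot> M) \<odot> N = L \<odot> (M \<odot> N)"
  using assms by (intro glue_assoc) (simp add: matching_on_Union)

section \<open>Gluing a single edge to a matching\<close>

lemma glue_edge_fresh:
  assumes "matching_on X M" "p \<noteq> q" "p \<notin> X" "q \<notin> X"
  shows "{{p, q}} \<odot> M = insert {p, q} M"
  using glue_matching_disjoint[OF matching_on_doubleton[OF assms(2)] assms(1)] assms by simp

lemma glue_two_edges:
  assumes "a \<noteq> b" "b \<noteq> c" "a \<noteq> c"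
  shows "{{a, b}} \<odot> {{b, c}} = {{a, c}}"
proof (rule glue_eqI)
  have Z: "sym_diff (\<Union>{{a, b}}) (\<Union>{{b, c}}) = {a, c}" using assms by auto
  show "partition_on (sym_diff (\<Union>{{a, b}}) (\<Union>{{b, c}})) {{a, c}}"
    unfolding Z by (rule partition_on_space) simp
  let ?E = "same_block {{a, b}} \<union> same_block {{b, c}}"
  have E: "?E = {a, b} \<times> {a, b} \<union> {b, c} \<times> {b, c}" by (auto simp: same_block_def)
  have "(a, b) \<in> ?E" "(b, c) \<in> ?E" "(c, b) \<in> ?E" "(b, a) \<in> ?E" unfolding E by simp_all
  then have "(a, c) \<in> ?E\<^sup>*" "(c, a) \<in> ?E\<^sup>*"
    by (meson r_into_rtrancl rtrancl_trans)+
  then show "(x, y) \<in> ?E\<^sup>* \<longleftrightarrow> (x, y) \<in> same_block {{a, c}}"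
    if "x \<in> sym_diff (\<Union>{{a, b}}) (\<Union>{{b, c}})" "y \<in> sym_diff (\<Union>{{a, b}}) (\<Union>{{b, c}})" for x y
    using that unfolding Z by (auto simp: same_block_def)
qed

text \<open>Here the edge extends a path; in the next two lemmas it closes a loop, which vanishes,
  or joins two edges of \<open>M\<close>. Each time the edge of \<open>M\<close> at \<open>p\<close>
  is split off as an operand of its own, and associativity leaves two single edges to be glued
  first.\<close>

lemma glue_edge_end:
  assumes M: "matching_on X M" and pp: "{p, p'} \<in> M" and q: "q \<notin> X"
  shows "{{p, q}} \<odot> M = insert {q, p'} (M - {{p, p'}})"
proof -
  let ?N = "M - {{p, p'}}"
  have p: "p \<noteq> p'" "p \<in> X" "p' \<in> X" using matching_on_edge[OF M pp] by auto
  have N: "matching_on (X - {p, p'}) ?N" using matching_on_remove[OF M pp] .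
  have M': "M = {{p, p'}} \<odot> ?N" using glue_edge_fresh[OF N p(1)] pp by auto
  have d: "matching_on {p, q} {{p, q}}" "matching_on {p, p'} {{p, p'}}"
    using p q by (auto intro!: matching_on_doubleton)
  have "{{p, q}} \<odot> M = ({{p, q}} \<odot> {{p, p'}}) \<odot> ?N"
    by (subst M', rule glue_matching_assoc[symmetric, OF d N]) auto
  also have "{{p, q}} \<odot> {{p, p'}} = {{q, p'}}"
    using glue_two_edges[of q p p'] p q by (auto simp: insert_commute)
  also have "{{q, p'}} \<odot> ?N = insert {q, p'} ?N"
    using p q by (intro glue_edge_fresh[OF N]) auto
  finally show ?thesis .
qed

lemma glue_edge_mem:
  assumes M: "matching_on X M" and pq: "{p, q} \<in> M"
  shows "{{p, q}} \<odot> M = M - {{p, q}}"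
proof -
  let ?N = "M - {{p, q}}"
  have p: "p \<noteq> q" using matching_on_edge[OF M pq] by auto
  have N: "matching_on (X - {p, q}) ?N" using matching_on_remove[OF M pq] .
  have M': "M = {{p, q}} \<odot> ?N" using glue_edge_fresh[OF N p] pq by auto
  have d: "matching_on {p, q} {{p, q}}" using p by (rule matching_on_doubleton)
  have "{{p, q}} \<odot> M = ({{p, q}} \<odot> {{p, q}}) \<odot> ?N"
    by (subst M', rule glue_matching_assoc[symmetric, OF d d N]) auto
  also have "\<dots> = ?N" using N by (simp add: glue_self)
  finally show ?thesis .
qed

lemma glue_edge_join:
  assumes M: "matching_on X M" and pp: "{p, p'} \<in> M" and qq: "{q, q'} \<in> M" and ne: "p \<noteq> q" "p' \<noteq> q"
  shows "{{p, q}} \<odot> M = insert {p', q'} (M - {{p, p'}, {q, q'}})"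
proof -
  let ?N = "M - {{p, p'}}"
  have p: "p \<noteq> p'" "p \<in> X" "p' \<in> X" using matching_on_edge[OF M pp] by auto
  have N: "matching_on (X - {p, p'}) ?N" using matching_on_remove[OF M pp] .
  have M': "M = {{p, p'}} \<odot> ?N" using glue_edge_fresh[OF N p(1)] pp by auto
  have d: "matching_on {p, q} {{p, q}}" "matching_on {p, p'} {{p, p'}}"
    using p ne by (auto intro!: matching_on_doubleton)
  have "{{p, q}} \<odot> M = ({{p, q}} \<odot> {{p, p'}}) \<odot> ?N"
    by (subst M', rule glue_matching_assoc[symmetric, OF d N]) auto
  also have "{{p, q}} \<odot> {{p, p'}} = {{q, p'}}"
    using glue_two_edges[of q p p'] p ne by (auto simp: insert_commute)
  also have "{{q, p'}} \<odot> ?N = insert {p', q'} (?N - {{q, q'}})"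
    using p qq ne by (intro glue_edge_end[OF N]) (auto simp: doubleton_eq_iff)
  also have "?N - {{q, q'}} = M - {{p, p'}, {q, q'}}" by blast
  finally show ?thesis .
qed

lemma matching_on_glue_edge:
  assumes M: "matching_on X M" and pq: "p \<noteq> q"
  shows "matching_on (sym_diff {p, q} X) ({{p, q}} \<odot> M)"
proof -
  have *: "matching_on (sym_diff {p, q} X) ({{p, q}} \<odot> M)" if p: "p \<in> X" and "q \<notin> X" "p \<noteq> q" for p q
  proof -
    obtain p' where p': "{p, p'} \<in> M" "p \<noteq> p'" "p' \<in> X" using matching_on_partner[OF M p] .
    have "matching_on (insert q (insert p' (X - {p, p'}))) (insert {q, p'} (M - {{p, p'}}))"
      using that p' by (intro matching_on_insert matching_on_remove[OF M]) auto
    moreover have "insert q (insert p' (X - {p, p'})) = sym_diff {p, q} X" using that p' by auto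
    ultimately show ?thesis using glue_edge_end[OF M p'(1) \<open>q \<notin> X\<close>] by simp
  qed
  consider "p \<in> X" "q \<notin> X" | "p \<notin> X" "q \<in> X" | "p \<notin> X" "q \<notin> X" | "p \<in> X" "q \<in> X" by blast
  then show ?thesis
  proof cases
    case 1
    then show ?thesis using * pq by blast
  next
    case 2
    then show ?thesis using *[of q p] pq by (simp add: insert_commute)
  next
    case 3
    have "sym_diff {p, q} X = insert p (insert q X)" using 3 by blast
    then show ?thesis using matching_on_insert[OF M pq 3] glue_edge_fresh[OF M pq 3] by simp
  next
    case 4
    have Z: "sym_diff {p, q} X = X - {p, q}" using 4 by blast
    obtain p' where p': "{p, p'} \<in> M" "p \<noteq> p'" "p' \<in> X" using matching_on_partner[OF M 4(1)] .
    obtain q' where q': "{q, q'} \<in> M" "q \<noteq> q'" "q' \<in> X" using matching_on_partner[OF M 4(2)] .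
    show ?thesis
    proof (cases "p' = q")
      case True
      then show ?thesis using matching_on_remove[OF M] glue_edge_mem[OF M] p' Z by auto
    next
      case False
      have ne: "p' \<noteq> q'" "p \<noteq> q'" using p' q' pq False matching_on_partner_unique[OF M] by (metis insert_commute)+
      have "matching_on (X - \<Union>{{p, p'}, {q, q'}}) (M - {{p, p'}, {q, q'}})"
        using p' q' by (intro matching_on_Diff[OF M]) auto
      then have "matching_on (insert p' (insert q' (X - {p, p', q, q'}))) (insert {p', q'} (M - {{p, p'}, {q, q'}}))"
        using ne by (intro matching_on_insert) (auto simp: insert_commute Un_commute)
      moreover have "insert p' (insert q' (X - {p, p', q, q'})) = X - {p, q}" using p' q' ne False by auto
      ultimately show ?thesis using glue_edge_join[OF M p'(1) q'(1) pq False] Z by simp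
    qed
  qed
qed

lemma insert_edge_eq_glue:
  assumes "matching_on X M" "p \<noteq> q" "p \<notin> X" "q \<notin> X"
  shows "insert {p, q} M = {{p, q}} \<odot> M"
  using glue_edge_fresh[OF assms] by simp

text \<open>That the blocks of a gluing have two elements is not shown by following alternating
  paths, but by gluing on the edges of \<open>M\<close> one after another.\<close>

lemma matching_on_glue:
  assumes "finite X" "matching_on X M" "matching_on Y N"
  shows "matching_on (sym_diff X Y) (M \<odot> N)"
  using assms
proof (induction X M rule: matching_on_induct)
  case empty
  then show ?case by simp
next
  case (insert X M a b)
  have d: "matching_on {a, b} {{a, b}}" using insert by (intro matching_on_doubleton)
  have "insert {a, b} M \<odot> N = {{a, b}} \<odot> (M \<odot> N)"
    unfolding insert_edge_eq_glue[OF insert.hyps(2-5)]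
    by (rule glue_matching_assoc[OF d insert.hyps(2) insert.prems]) (use insert in auto)
  moreover have "matching_on (sym_diff {a, b} (sym_diff X Y)) ({{a, b}} \<odot> (M \<odot> N))"
    using insert by (intro matching_on_glue_edge) auto
  moreover have "sym_diff {a, b} (sym_diff X Y) = sym_diff (insert a (insert b X)) Y"
    using insert.hyps by auto
  ultimately show ?case by simp
qed

text \<open>Together with \<open>{p, q}\<close> the two new edges form a path from \<open>z\<close>
  through \<open>p\<close> and \<open>q\<close> to \<open>w\<close>, which contracts to
  \<open>{z, w}\<close>. Exchanging \<open>z\<close> and \<open>w\<close> gives the other of the two
  insertions into this edge.\<close>

lemma splice:
  assumes J: "matching_on X J" and zw: "{z, w} \<in> J" and pq: "p \<noteq> q" "p \<notin> X" "q \<notin> X"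
  shows "matching_on (insert p (insert q X)) (insert {z, p} (insert {w, q} (J - {{z, w}})))" (is "matching_on _ ?a")
    and "{{p, q}} \<odot> insert {z, p} (insert {w, q} (J - {{z, w}})) = J"
proof -
  have z: "z \<noteq> w" "z \<in> X" "w \<in> X" using matching_on_edge[OF J zw] by auto
  have "matching_on (insert w (insert q (X - {z, w}))) (insert {w, q} (J - {{z, w}}))"
    using pq z by (intro matching_on_insert matching_on_remove[OF J zw]) auto
  then have "matching_on (insert z (insert p (insert w (insert q (X - {z, w}))))) ?a"
    using pq z by (rule_tac matching_on_insert) auto
  moreover have X: "insert z (insert p (insert w (insert q (X - {z, w})))) = insert p (insert q X)"
    using z by auto
  ultimately show a: "matching_on (insert p (insert q X)) ?a" by simp
  have "{{p, q}} \<odot> ?a = insert {z, w} (?a - {{p, z}, {q, w}})"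
    using pq z by (intro glue_edge_join[OF a]) (auto simp: insert_commute)
  moreover have "{w, q} \<notin> J" "{z, p} \<notin> J" using pq matching_on_edge[OF J] by auto
  ultimately show "{{p, q}} \<odot> ?a = J" using zw by (auto simp: insert_commute)
qed

text \<open>If \<open>p\<close> and \<open>q\<close> are not joined to each other in
  \<open>a\<close>, their contraction joins their partners, and these are \<open>z\<close> and
  \<open>w\<close>.\<close>

lemma splice_cases:
  assumes a: "matching_on (insert p (insert q X)) a" and J: "{{p, q}} \<odot> a = J"
    and pq: "p \<noteq> q" "p \<notin> X" "q \<notin> X"
  obtains "a = insert {p, q} J" "{p, q} \<notin> J"
  | z w where "{z, w} \<in> J" "z \<in> X" "w \<in> X" "z \<noteq> w" "a = insert {z, p} (insert {w, q} (J - {{z, w}}))"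
proof -
  obtain p' where p': "{p, p'} \<in> a" "p \<noteq> p'" "p' \<in> insert p (insert q X)"
    using matching_on_partner[OF a, of p] by blast
  obtain q' where q': "{q, q'} \<in> a" "q \<noteq> q'" "q' \<in> insert p (insert q X)"
    using matching_on_partner[OF a, of q] by blast
  show thesis
  proof (cases "p' = q")
    case True
    then have "J = a - {{p, q}}" using glue_edge_mem[OF a] p' J by simp
    then show ?thesis using that(1) p' True by auto
  next
    case False
    have ne: "p' \<noteq> q'" "p \<noteq> q'" using p' q' pq False matching_on_partner_unique[OF a] by (metis insert_commute)+
    have J': "J = insert {p', q'} (a - {{p, p'}, {q, q'}})" using glue_edge_join[OF a p'(1) q'(1) pq(1) False] J by simp
    have "{p', q'} \<notin> a" using matching_on_partner_unique[OF a, of p' p q'] p' ne by (auto simp: insert_commute)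
    then have "a = insert {p', p} (insert {q', q} (J - {{p', q'}}))"
      unfolding J' using p' q' by (auto simp: insert_commute)
    moreover have "{p', q'} \<in> J" unfolding J' by simp
    moreover have "p' \<in> X" "q' \<in> X" using p' q' ne False by auto
    ultimately show ?thesis using that(2) ne by blast
  qed
qed

text \<open>Such an \<open>a\<close> is determined by the partner of \<open>p\<close>, which can be
  any point of \<open>insert q X\<close>: the partner \<open>q\<close> means that \<open>p\<close>
  and \<open>q\<close> are joined, and a partner \<open>z\<close> in \<open>X\<close> selects both
  the edge of \<open>J\<close> at \<open>z\<close> and the order of insertion.\<close>

lemma card_splice:
  assumes J: "matching_on X J" and pq: "p \<noteq> q" "p \<notin> X" "q \<notin> X" and fin: "finite X"
  shows "card {a. matching_on (insert p (insert q X)) a \<and> {{p, q}} \<odot> a = J} = card X + 1"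
proof -
  let ?S = "{a. matching_on (insert p (insert q X)) a \<and> {{p, q}} \<odot> a = J}"
  have fwd: "\<exists>z\<in>insert q X. {p, z} \<in> a" if "a \<in> ?S" for a
    using that matching_on_partner[of "insert p (insert q X)" a p] by blast
  have ex: "\<exists>a\<in>?S. {p, z} \<in> a" if z: "z \<in> insert q X" for z
  proof (cases "z = q")
    case True
    have "insert {p, q} J \<in> ?S"
      using matching_on_insert[OF J pq] glue_edge_mem[OF matching_on_insert[OF J pq]] matching_on_edge[OF J, of p q] pq
      by auto
    then show ?thesis using True by auto
  next
    case False
    then obtain w where w: "{z, w} \<in> J" using matching_on_partner[OF J, of z] z by blast
    show ?thesis using splice[OF J w pq] by (intro bexI[of _ "insert {z, p} (insert {w, q} (J - {{z, w}}))"]) auto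
  qed
  have uniq: "a = b" if a: "a \<in> ?S" "{p, z} \<in> a" and b: "b \<in> ?S" "{p, z} \<in> b" for a b z
  proof -
    \<comment> \<open>The description operator names the partner of \<open>z\<close> in
      \<open>J\<close>, so the right-hand side depends on \<open>z\<close> alone.\<close>
    have form: "c = (if z = q then insert {p, q} J else insert {z, p} (insert {THE w. {z, w} \<in> J, q} (J - {{z, THE w. {z, w} \<in> J}})))"
      if c: "c \<in> ?S" "{p, z} \<in> c" for c
    proof -
      have c1: "matching_on (insert p (insert q X)) c" "{{p, q}} \<odot> c = J" using c by auto
      from c1 pq show ?thesis
      proof (cases rule: splice_cases)
        case 1
        then have "z = q" using matching_on_partner_unique[OF c1(1), of p q z] c by auto
        then show ?thesis using 1 by simp
      next
        case (2 y w)
        then have y: "y = z" using matching_on_partner_unique[OF c1(1), of p y z] c by (auto simp: insert_commute)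
        have "(THE w. {z, w} \<in> J) = w"
          using 2 y matching_on_partner_unique[OF J] by (intro the_equality) auto
        then show ?thesis using 2 y pq by auto
      qed
    qed
    show ?thesis using form[OF a] form[OF b] by simp
  qed
  define f where "f a = (THE z. {p, z} \<in> a)" for a
  have f: "f a = z" if "a \<in> ?S" "{p, z} \<in> a" for a z
    unfolding f_def using that matching_on_partner_unique by (intro the_equality) auto
  have "bij_betw f ?S (insert q X)"
  proof (rule bij_betwI')
    fix a b assume ab: "a \<in> ?S" "b \<in> ?S"
    obtain z y where "z \<in> insert q X" "{p, z} \<in> a" "y \<in> insert q X" "{p, y} \<in> b"
      using fwd[OF ab(1)] fwd[OF ab(2)] by blast
    then show "f a = f b \<longleftrightarrow> a = b"
      using f[OF ab(1)] f[OF ab(2)] uniq[OF ab(1) _ ab(2)] by metis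
  next
    fix a assume a: "a \<in> ?S"
    obtain z where "z \<in> insert q X" "{p, z} \<in> a" using fwd[OF a] by blast
    then show "f a \<in> insert q X" using f[OF a] by simp
  next
    fix z assume "z \<in> insert q X"
    then obtain a where "a \<in> ?S" "{p, z} \<in> a" using ex by blast
    then show "\<exists>a\<in>?S. z = f a" using f by blast
  qed
  then have "card ?S = card (insert q X)" by (rule bij_betw_same_card)
  then show ?thesis using pq fin by simp
qed

section \<open>Counting and lifting along a gluing\<close>

lemma relabel_cong:
  assumes "\<And>v. v \<in> \<Union>M \<Longrightarrow> f v = g v"
  shows "relabel f M = relabel g M"
proof (rule image_cong[OF refl])
  fix B assume "B \<in> M"
  then show "f ` B = g ` B" using assms by (intro image_cong) auto
qed

lemma relabel_comp: "relabel g (relabel f M) = relabel (\<lambda>v. g (f v)) M"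
  by (simp add: image_image)

lemma relabel_id:
  assumes "\<And>v. v \<in> \<Union>M \<Longrightarrow> f v = v"
  shows "relabel f M = M"
  using relabel_cong[of M f "\<lambda>v. v"] assms by simp

lemma glue_edge_rename:
  assumes M: "matching_on X M" and p: "p \<in> X" and q: "q \<notin> X"
  shows "{{p, q}} \<odot> M = relabel (\<lambda>v. if v = p then q else v) M"
proof -
  let ?f = "\<lambda>v. if v = p then q else v"
  obtain p' where p': "{p, p'} \<in> M" "p \<noteq> p'" "p' \<in> X" using matching_on_partner[OF M p] .
  have "p \<notin> B" if "B \<in> M - {{p, p'}}" for B
    using that matching_on_block_unique[OF M _ p'(1)] by blast
  then have "relabel ?f (M - {{p, p'}}) = M - {{p, p'}}" by (intro relabel_id) auto
  moreover have "?f ` {p, p'} = {q, p'}" using p' by auto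
  ultimately have "relabel ?f (insert {p, p'} (M - {{p, p'}})) = insert {q, p'} (M - {{p, p'}})"
    by (simp only: image_insert)
  then show ?thesis using glue_edge_end[OF M p'(1) q] p'(1) by (simp add: insert_absorb)
qed

text \<open>Trading \<open>p\<close> for \<open>q\<close> is undone by trading back. With both ends
  in \<open>X\<close> this can fail, because the first gluing forgets which partner belonged to
  \<open>p\<close>; this loss is what \<open>card_splice\<close> counts.\<close>

lemma glue_edge_twice:
  assumes M: "matching_on X M" and p: "p \<in> X" and q: "q \<notin> X"
  shows "{{p, q}} \<odot> ({{p, q}} \<odot> M) = M"
proof -
  have pq: "p \<noteq> q" using p q by blast
  obtain p' where p': "{p, p'} \<in> M" "p \<noteq> p'" "p' \<in> X" using matching_on_partner[OF M p] .
  let ?N = "{{p, q}} \<odot> M"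
  have N: "?N = insert {q, p'} (M - {{p, p'}})" using glue_edge_end[OF M p'(1) q] .
  have N': "matching_on (sym_diff {p, q} X) ?N" using matching_on_glue_edge[OF M pq] .
  have "{q, p'} \<notin> M" using matching_on_edge[OF M] q by blast
  have "{{q, p}} \<odot> ?N = insert {p, p'} (?N - {{q, p'}})"
    by (rule glue_edge_end[OF N']) (use N p in auto)
  also have "\<dots> = M" unfolding N using \<open>{q, p'} \<notin> M\<close> p' by auto
  finally show ?thesis by (simp add: insert_commute)
qed

lemma matching_on_pairs:
  assumes "inj_on f P" "f ` P \<inter> P = {}"
  shows "matching_on (P \<union> f ` P) ((\<lambda>v. {v, f v}) ` P)"
  unfolding matching_on_def partition_on_def disjoint_def
  using assms by (fastforce simp: inj_on_def card_2_iff)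

text \<open>A bundle of edges from \<open>P\<close> to fresh vertices merely moves the ends in
  \<open>P\<close> along \<open>f\<close>. Products with permutation diagrams are computed in this
  way.\<close>

lemma glue_rename:
  assumes "finite P" "P \<subseteq> X" "inj_on f P" "f ` P \<inter> X = {}" and M: "matching_on X M"
  shows "(\<lambda>v. {v, f v}) ` P \<odot> M = relabel (\<lambda>v. if v \<in> P then f v else v) M"
  using assms(1-4)
proof (induction P)
  case empty
  then show ?case using M by simp
next
  case (insert p P)
  let ?T = "(\<lambda>v. {v, f v}) ` P" and ?g = "\<lambda>v. if v \<in> P then f v else v"
  have T: "matching_on (P \<union> f ` P) ?T" using insert by (intro matching_on_pairs) auto
  have fresh: "p \<noteq> f p" "p \<notin> P \<union> f ` P" "f p \<notin> P \<union> f ` P" using insert.prems insert.hyps by auto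
  have g: "matching_on (?g ` X) (relabel ?g M)"
    using insert.prems M by (intro matching_on_relabel) (auto simp: inj_on_def)
  have "p \<in> X" using insert by blast
  then have "?g p \<in> ?g ` X" by blast
  then have p: "p \<in> ?g ` X" using insert.hyps by simp
  have fp: "f p \<notin> ?g ` X" using insert by auto
  have "insert {p, f p} ?T \<odot> M = ({{p, f p}} \<odot> ?T) \<odot> M"
    by (simp add: insert_edge_eq_glue[OF T fresh])
  also have "\<dots> = {{p, f p}} \<odot> (?T \<odot> M)"
    using fresh insert.prems
    by (intro glue_matching_assoc[OF matching_on_doubleton T M]) auto
  also have "?T \<odot> M = relabel ?g M" using insert by blast
  also have "{{p, f p}} \<odot> relabel ?g M = relabel (\<lambda>v. if v = p then f p else v) (relabel ?g M)"
    by (rule glue_edge_rename[OF g p fp])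
  also have "\<dots> = relabel (\<lambda>v. if v \<in> insert p P then f v else v) M"
  proof -
    have "(if ?g v = p then f p else ?g v) = (if v \<in> insert p P then f v else v)" if "v \<in> X" for v
      using that insert.prems insert.hyps by auto
    then show ?thesis unfolding relabel_comp using matching_on_Union[OF M] by (intro relabel_cong) blast
  qed
  finally show ?case by simp
qed

text \<open>A block that avoids \<open>X\<close> can be split off from \<open>N\<close> and glued on
  last.\<close>

lemma glue_keep:
  assumes X: "matching_on X M" "finite X" and Y: "matching_on Y N" and B: "B \<in> N" "B \<inter> X = {}"
  shows "B \<in> M \<odot> N"
proof -
  obtain a b where ab: "B = {a, b}" "a \<noteq> b" "a \<in> Y" "b \<in> Y" using matching_on_blockE[OF Y B(1)] .
  let ?N = "N - {B}"
  have N: "matching_on (Y - {a, b}) ?N" using matching_on_remove[OF Y] B ab by simp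
  have N': "N = {{a, b}} \<odot> ?N" using glue_edge_fresh[OF N ab(2)] ab B by auto
  have d: "matching_on {a, b} {{a, b}}" using ab by (intro matching_on_doubleton)
  have "M \<odot> N = ({{a, b}} \<odot> ?N) \<odot> M" using N' glue_commute by metis
  also have "\<dots> = {{a, b}} \<odot> (?N \<odot> M)"
    by (rule glue_matching_assoc[OF d N X(1)]) auto
  also have "\<dots> = {{a, b}} \<odot> (M \<odot> ?N)" by (simp add: glue_commute)
  also have "\<dots> = insert {a, b} (M \<odot> ?N)"
    using ab B by (intro glue_edge_fresh[OF matching_on_glue[OF X(2,1) N]]) auto
  finally show ?thesis using ab by simp
qed

lemma glue_insert_edge:
  assumes "matching_on X M" "a \<noteq> b" "a \<notin> X" "b \<notin> X" "matching_on Y N"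
  shows "insert {a, b} M \<odot> N = {{a, b}} \<odot> (M \<odot> N)" "insert {a, b} M \<odot> N = M \<odot> ({{a, b}} \<odot> N)"
proof -
  have d: "matching_on {a, b} {{a, b}}" using assms by (intro matching_on_doubleton)
  show "insert {a, b} M \<odot> N = {{a, b}} \<odot> (M \<odot> N)"
    unfolding insert_edge_eq_glue[OF assms(1-4)]
    by (rule glue_matching_assoc[OF d assms(1,5)]) (use assms in auto)
  have "insert {a, b} M = M \<odot> {{a, b}}"
    using insert_edge_eq_glue[OF assms(1-4)] by (simp add: glue_commute)
  then show "insert {a, b} M \<odot> N = M \<odot> ({{a, b}} \<odot> N)"
    using glue_matching_assoc[OF assms(1) d assms(5)] assms by auto
qed

text \<open>An edge of \<open>s\<close> with one end in \<open>U\<close> only renames a point of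
  \<open>U\<close>. An edge inside \<open>U\<close> contracts two points and contributes a factor
  from \<open>card_splice\<close>: when \<open>i\<close> such arcs have been put back, the matching
  has \<open>card (sym_diff S U) + 2 * i\<close> points. An edge of \<open>s\<close> outside
  \<open>U\<close> would have to occur unchanged in \<open>J\<close> and is excluded. The size of
  \<open>U\<close> is proved along because it determines the next factor.\<close>

lemma card_gluings:
  assumes "finite S" "matching_on S s" "finite U" "\<forall>B\<in>s. B \<inter> U \<noteq> {}"
    "matching_on (sym_diff S U) J"
  shows "card {a. matching_on U a \<and> s \<odot> a = J} =
      (\<Prod>i<card {B\<in>s. B \<subseteq> U}. card (sym_diff S U) + 2 * i + 1) \<and>
    card U = card (sym_diff S U) + 2 * card {B\<in>s. B \<subseteq> U}"
  using assms
proof (induction S s arbitrary: U rule: matching_on_induct)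
  case empty
  have "{a. matching_on U a \<and> {} \<odot> a = J} = {J}" using empty by auto
  then show ?case by simp
next
  case (insert S s a b)
  have s: "matching_on S s" by fact
  have sB: "a \<notin> B" "b \<notin> B" if "B \<in> s" for B using that insert.hyps matching_on_Union by blast+
  have fins: "finite s" using finite_matching_on insert.hyps by blast
  let ?F = "\<lambda>U s. {c. matching_on U c \<and> s \<odot> c = J}"
  have glue: "insert {a, b} s \<odot> c = s \<odot> ({{a, b}} \<odot> c)" if "matching_on U c" for c
    using glue_insert_edge(2)[OF insert.hyps(2-5) that] .
  have one: ?case if pq: "{p, q} = {a, b}" "p \<in> U" "q \<notin> U" for p q
  proof -
    have pS: "p \<notin> S" "q \<notin> S" "p \<noteq> q" using pq insert.hyps by auto
    \<comment> \<open>This is \<open>U\<close> with \<open>p\<close> renamed to \<open>q\<close>;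
      gluing with \<open>{p, q}\<close> is a bijection between the matchings on \<open>U\<close> and
      those on \<open>U1\<close>.\<close>
    define U1 where "U1 = insert q (U - {p})"
    have sd1: "sym_diff {p, q} U = U1" "sym_diff {p, q} U1 = U" using pq pS by (auto simp: U1_def)
    have sd: "sym_diff S U1 = sym_diff (insert a (insert b S)) U"
    proof -
      have "insert a (insert b S) = insert p (insert q S)" using pq(1) by auto
      then show ?thesis using pq pS by (auto simp: U1_def)
    qed
    have arcs: "{B\<in>insert {a, b} s. B \<subseteq> U} = {B\<in>s. B \<subseteq> U1}"
    proof -
      have "\<not> {a, b} \<subseteq> U" using pq by auto
      moreover have "B \<subseteq> U \<longleftrightarrow> B \<subseteq> U1" if "B \<in> s" for B using sB[OF that] pq by (auto simp: U1_def)
      ultimately show ?thesis by auto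
    qed
    have IH: "card (?F U1 s) = (\<Prod>i<card {B\<in>s. B \<subseteq> U1}. card (sym_diff S U1) + 2 * i + 1) \<and>
      card U1 = card (sym_diff S U1) + 2 * card {B\<in>s. B \<subseteq> U1}"
    proof (rule insert.IH)
      show "\<forall>B\<in>s. B \<inter> U1 \<noteq> {}"
      proof
        fix B assume B: "B \<in> s"
        then have "B \<inter> U \<noteq> {}" using insert.prems(2) by blast
        moreover have "p \<in> {a, b}" using pq(1) by blast
        then have "p \<notin> B" using sB[OF B] by auto
        ultimately show "B \<inter> U1 \<noteq> {}" by (auto simp: U1_def)
      qed
    qed (use insert.prems sd in \<open>auto simp: U1_def\<close>)
    have tw: "{{a, b}} \<odot> ({{a, b}} \<odot> c) = c" if "matching_on U c" for c
      using glue_edge_twice[OF that pq(2,3)] unfolding pq(1) .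
    have tw1: "{{a, b}} \<odot> ({{a, b}} \<odot> c) = c" if "matching_on U1 c" for c
    proof -
      have "{{q, p}} \<odot> ({{q, p}} \<odot> c) = c"
        using pq pS by (intro glue_edge_twice[OF that]) (auto simp: U1_def)
      then show ?thesis using pq(1) by (simp add: insert_commute)
    qed
    have m: "matching_on U1 ({{a, b}} \<odot> c)" if "matching_on U c" for c
      using matching_on_glue_edge[OF that pS(3)] unfolding sd1 unfolding pq(1) .
    have m1: "matching_on U ({{a, b}} \<odot> c)" if "matching_on U1 c" for c
      using matching_on_glue_edge[OF that pS(3)] unfolding sd1 unfolding pq(1) .
    have "bij_betw (\<lambda>c. {{a, b}} \<odot> c) (?F U (insert {a, b} s)) (?F U1 s)"
      by (rule bij_betw_byWitness[where f' = "\<lambda>c. {{a, b}} \<odot> c"]) (auto simp: glue tw tw1 m m1)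
    then have "card (?F U (insert {a, b} s)) = card (?F U1 s)" by (rule bij_betw_same_card)
    moreover have "card U1 = card U"
      using pq(2,3) insert.prems(1) card_Suc_Diff1[of U p] by (simp add: U1_def)
    ultimately show ?thesis using IH unfolding arcs sd by simp
  qed
  consider "a \<in> U" "b \<notin> U" | "a \<notin> U" "b \<in> U" | "a \<in> U" "b \<in> U" using insert.prems(2) by auto
  then show ?case
  proof cases
    case 1
    then show ?thesis using one by blast
  next
    case 2
    then show ?thesis using one[of b a] by blast
  next
    case 3
    define U1 where "U1 = U - {a, b}"
    have U: "U = insert a (insert b U1)" using 3 by (auto simp: U1_def)
    have sd: "sym_diff S U1 = sym_diff (insert a (insert b S)) U"
      using 3 insert.hyps by (auto simp: U1_def)
    have "{B\<in>insert {a, b} s. B \<subseteq> U} = insert {a, b} {B\<in>s. B \<subseteq> U1}"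
      using 3 sB by (auto simp: U1_def)
    moreover have "{a, b} \<notin> s" using sB by blast
    ultimately have arcs: "card {B\<in>insert {a, b} s. B \<subseteq> U} = Suc (card {B\<in>s. B \<subseteq> U1})"
      using fins by simp
    have IH: "card (?F U1 s) = (\<Prod>i<card {B\<in>s. B \<subseteq> U1}. card (sym_diff S U1) + 2 * i + 1) \<and>
      card U1 = card (sym_diff S U1) + 2 * card {B\<in>s. B \<subseteq> U1}"
    proof (rule insert.IH)
      show "\<forall>B\<in>s. B \<inter> U1 \<noteq> {}"
      proof
        fix B assume B: "B \<in> s"
        then have "B \<inter> U \<noteq> {}" using insert.prems(2) by blast
        then show "B \<inter> U1 \<noteq> {}" using sB[OF B] by (auto simp: U1_def)
      qed
    qed (use insert.prems sd in \<open>auto simp: U1_def\<close>)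
    let ?G = "\<lambda>d. {c. matching_on U c \<and> {{a, b}} \<odot> c = d}"
    have m: "matching_on U1 ({{a, b}} \<odot> c)" if "matching_on U c" for c
    proof -
      have "sym_diff {a, b} U = U1" using 3 by (auto simp: U1_def)
      then show ?thesis using matching_on_glue_edge[OF that insert.hyps(3)] by (simp only:)
    qed
    have finU: "finite {c. matching_on U c}" "finite {c. matching_on U1 c}"
      using insert.prems by (auto intro!: finite_matchings simp: U1_def)
    \<comment> \<open>The solutions are sorted by the matching \<open>d\<close> that is left after
      contraction of \<open>a\<close> and \<open>b\<close>; each fibre \<open>?G d\<close> has
      \<open>card U1 + 1\<close> elements.\<close>
    have "?F U (insert {a, b} s) = (\<Union>d\<in>?F U1 s. ?G d)"
      by (auto simp: glue m)
    also have "card \<dots> = (\<Sum>d\<in>?F U1 s. card (?G d))"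
      using finU by (intro card_UN_disjoint) (auto intro: finite_subset)
    also have "\<dots> = (\<Sum>d\<in>?F U1 s. card U1 + 1)"
    proof (rule sum.cong[OF refl])
      fix d assume "d \<in> ?F U1 s"
      then show "card (?G d) = card U1 + 1"
        unfolding U using insert.hyps insert.prems by (intro card_splice) (auto simp: U1_def)
    qed
    also have "\<dots> = (\<Prod>i<Suc (card {B\<in>s. B \<subseteq> U1}). card (sym_diff S U1) + 2 * i + 1)"
      using IH by simp
    finally have "card (?F U (insert {a, b} s)) = \<dots>" .
    moreover have "card U = card U1 + 2"
      unfolding U using insert.hyps insert.prems by (simp add: U1_def)
    ultimately show ?thesis using IH unfolding arcs sd by simp
  qed
qed

text \<open>
  \<open>z\<close> is joined to \<open>w\<close> in \<open>insert {z, d} K \<odot> x\<close> along a path starting with the edge \<open>{z, d}\<close>;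
  splicing \<open>{p, q}\<close> into this edge splices it into \<open>{z, w}\<close>.
\<close>

lemma glue_splice:
  assumes K: "matching_on A K" and x: "matching_on Y x" and fin: "finite A"
    and fresh: "z \<notin> A" "d \<notin> A" "p \<notin> A" "q \<notin> A" "z \<notin> Y" "p \<notin> Y" "q \<notin> Y"
    and ne: "z \<noteq> d" "z \<noteq> p" "z \<noteq> q" "d \<noteq> p" "d \<noteq> q" "p \<noteq> q"
    and zw: "{z, w} \<in> insert {z, d} K \<odot> x"
  shows "insert {z, p} (insert {d, q} K) \<odot> x =
    insert {z, p} (insert {w, q} ((insert {z, d} K \<odot> x) - {{z, w}}))"
proof -
  let ?Q = "K \<odot> x" and ?J = "insert {z, d} K \<odot> x"
  have Q: "matching_on (sym_diff A Y) ?Q" using matching_on_glue[OF fin K x] .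
  have J: "?J = {{z, d}} \<odot> ?Q" using glue_insert_edge(1)[OF K ne(1) fresh(1,2) x] .
  have mJ: "matching_on (sym_diff {z, d} (sym_diff A Y)) ?J"
    unfolding J by (rule matching_on_glue_edge[OF Q ne(1)])
  have dq: "matching_on (insert d (insert q A)) (insert {d, q} K)"
    using K ne fresh by (intro matching_on_insert) auto
  have "insert {z, p} (insert {d, q} K) \<odot> x = {{z, p}} \<odot> (insert {d, q} K \<odot> x)"
    using ne fresh by (intro glue_insert_edge(1)[OF dq _ _ _ x]) auto
  also have "insert {d, q} K \<odot> x = {{d, q}} \<odot> ?Q"
    using glue_insert_edge(1)[OF K ne(5) fresh(2,4) x] .
  \<comment> \<open>The detour through \<open>z\<close> reintroduces the edge \<open>{z, d}\<close>
    and so completes \<open>?Q\<close> to \<open>?J\<close>, where the partner of \<open>z\<close>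
    is known to be \<open>w\<close>.\<close>
  also have "{{d, q}} = {{z, q}} \<odot> {{z, d}}"
    using glue_two_edges[of q z d] ne by (simp add: insert_commute)
  also have "({{z, q}} \<odot> {{z, d}}) \<odot> ?Q = {{z, q}} \<odot> ?J"
    unfolding J by (rule glue_matching_assoc[OF matching_on_doubleton[OF ne(3)] matching_on_doubleton[OF ne(1)] Q])
      (use fresh ne in auto)
  also have "\<dots> = insert {q, w} (?J - {{z, w}})"
    by (rule glue_edge_end[OF mJ zw]) (use fresh ne in auto)
  also have "{{z, p}} \<odot> \<dots> = insert {z, p} \<dots>"
  proof (rule glue_edge_fresh)
    have "{{z, q}} \<odot> ?J = insert {q, w} (?J - {{z, w}})"
      by (rule glue_edge_end[OF mJ zw]) (use fresh ne in auto)
    then show "matching_on (sym_diff {z, q} (sym_diff {z, d} (sym_diff A Y))) (insert {q, w} (?J - {{z, w}}))"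
      using matching_on_glue_edge[OF mJ ne(3)] by simp
  qed (use fresh ne in auto)
  finally show ?thesis by (simp add: insert_commute)
qed

text \<open>Here \<open>X0\<close> is the free row of \<open>K\<close>, \<open>L\<close> the free
  row of \<open>x\<close>, and \<open>D\<close> the row that they share. In \<open>u\<close> the
  points \<open>p\<close> and \<open>q\<close> are spliced into the edge \<open>{z, w}\<close> of
  \<open>K \<odot> x\<close>; the proof splices them into an edge of \<open>K\<close> on the path
  behind that edge. From \<open>z\<close> in \<open>X0\<close> the path starts with an edge of
  \<open>K\<close>. If both ends are in \<open>L\<close>, it starts with an edge
  \<open>{z, c}\<close> of \<open>x\<close>, and the second edge is taken.\<close>

lemma splice_lift:
  assumes fin: "finite X0" "finite D" "finite L"
    and disj: "X0 \<inter> D = {}" "X0 \<inter> L = {}" "D \<inter> L = {}"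
    and pq: "p \<noteq> q" "p \<notin> X0 \<union> D \<union> L" "q \<notin> X0 \<union> D \<union> L"
    and K: "matching_on (X0 \<union> D) K" and x: "matching_on (D \<union> L) x"
    and u: "matching_on (insert p (insert q (X0 \<union> L))) u"
    and zw: "{z, w} \<in> K \<odot> x" "z \<in> X0 \<union> L" "w \<in> X0 \<union> L" "z \<noteq> w"
    and u_eq: "u = insert {z, p} (insert {w, q} (K \<odot> x - {{z, w}}))"
    and low: "\<forall>B\<in>x. B \<subseteq> L \<longrightarrow> B \<in> u"
    and z: "z \<in> X0 \<or> z \<in> L \<and> w \<in> L"
  shows "\<exists>K'. matching_on (insert p (insert q (X0 \<union> D))) K' \<and> {{p, q}} \<odot> K' = K \<and> K' \<odot> x = u"
proof -
  have finXD: "finite (X0 \<union> D)" using fin by simp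
  have p: "p \<notin> X0 \<union> D" and q: "q \<notin> X0 \<union> D" using pq by auto
  show ?thesis using z
  proof
    assume z: "z \<in> X0"
    obtain d where d: "{z, d} \<in> K" "z \<noteq> d" "d \<in> X0 \<union> D" using matching_on_partner[OF K] z by blast
    have sp: "matching_on (insert p (insert q (X0 \<union> D))) (insert {z, p} (insert {d, q} (K - {{z, d}})))"
      "{{p, q}} \<odot> insert {z, p} (insert {d, q} (K - {{z, d}})) = K"
      using splice[OF K d(1) pq(1) p q] by auto
    have K0: "insert {z, d} (K - {{z, d}}) = K" using d by auto
    have "insert {z, p} (insert {d, q} (K - {{z, d}})) \<odot> x = insert {z, p} (insert {w, q} ((insert {z, d} (K - {{z, d}}) \<odot> x) - {{z, w}}))"
      by (rule glue_splice[OF matching_on_remove[OF K d(1)] x]) (use zw d pq disj z finXD K0 in auto)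
    then have "insert {z, p} (insert {d, q} (K - {{z, d}})) \<odot> x = u" unfolding K0 u_eq .
    then show ?thesis using sp by blast
  next
    assume z: "z \<in> L \<and> w \<in> L"
    then have zX: "z \<notin> X0 \<union> D" using disj by blast
    obtain c where c: "{z, c} \<in> x" "z \<noteq> c" "c \<in> D \<union> L" using matching_on_partner[OF x] z by blast
    \<comment> \<open>Otherwise \<open>{z, c}\<close> is an arc of \<open>x\<close> inside
      \<open>L\<close> and hence lies in \<open>u\<close>, where \<open>z\<close> is already matched
      with \<open>p\<close>.\<close>
    have "c \<in> D"
    proof (rule ccontr)
      assume "c \<notin> D"
      then have "{z, c} \<in> u" using c z low by auto
      moreover have "{z, p} \<in> u" unfolding u_eq by simp
      ultimately have "c = p" by (rule matching_on_partner_unique[OF u])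
      then show False using c pq by blast
    qed
    then obtain d where d: "{c, d} \<in> K" "c \<noteq> d" "d \<in> X0 \<union> D" using matching_on_partner[OF K] by blast
    let ?K0 = "K - {{c, d}}" and ?x0 = "x - {{z, c}}" and ?Y = "(D \<union> L) - {z, c}"
    let ?K' = "insert {c, p} (insert {d, q} ?K0)"
    have sp: "matching_on (insert p (insert q (X0 \<union> D))) ?K'" "{{p, q}} \<odot> ?K' = K"
      using splice[OF K d(1) pq(1) p q] by auto
    have x0: "matching_on ?Y ?x0" using matching_on_remove[OF x c(1)] .
    \<comment> \<open>The edge \<open>{z, c}\<close> is moved from \<open>x\<close> to the left
      operand. There it turns the edge \<open>{c, d}\<close> of \<open>K\<close> into
      \<open>{z, d}\<close>, so that the path starts at \<open>z\<close> with an edge of the left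
      operand, as in the first case.\<close>
    have swap: "N \<odot> x = ({{z, c}} \<odot> N) \<odot> ?x0" if N: "matching_on Z N" "z \<notin> Z" for N Z
    proof -
      have "x = insert {c, z} ?x0" using c by (auto simp: insert_commute)
      then have "N \<odot> x = insert {c, z} ?x0 \<odot> N" using glue_commute by metis
      also have "\<dots> = ?x0 \<odot> ({{c, z}} \<odot> N)"
        using c by (intro glue_insert_edge(2)[OF x0 _ _ _ N(1)]) auto
      finally show ?thesis by (simp add: glue_commute insert_commute)
    qed
    have "{{z, c}} \<odot> K = insert {z, d} ?K0"
      using glue_edge_end[OF K d(1) zX] by (simp add: insert_commute)
    then have J: "K \<odot> x = insert {z, d} ?K0 \<odot> ?x0" using swap[OF K zX] by simp
    have zp: "z \<noteq> p" "z \<noteq> q" using z pq by auto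
    have "{c, d} \<notin> ?K0" by simp
    moreover have "{c, p} \<notin> insert {d, q} ?K0" 
      using matching_on_edge[OF K, of c p] pq d by (auto simp: doubleton_eq_iff)
    moreover have "{{c, z}} \<odot> ?K' = insert {z, p} (?K' - {{c, p}})"
      by (rule glue_edge_end[OF sp(1)]) (use zX zp in auto)
    ultimately have "{{z, c}} \<odot> ?K' = insert {z, p} (insert {d, q} ?K0)" by (simp add: insert_commute)
    then have "?K' \<odot> x = insert {z, p} (insert {d, q} ?K0) \<odot> ?x0"
      using swap[OF sp(1)] zX zp by simp
    also have "\<dots> = insert {z, p} (insert {w, q} ((insert {z, d} ?K0 \<odot> ?x0) - {{z, w}}))"
      by (rule glue_splice[OF matching_on_remove[OF K d(1)] x0])
        (use zw(1) d pq zp zX finXD in \<open>auto simp: J[symmetric]\<close>)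
    also have "\<dots> = u" unfolding J[symmetric] u_eq ..
    finally show ?thesis using sp by blast
  qed
qed

text \<open>The step of \<open>gluing_lift\<close> for one edge of \<open>s\<close>. With one end in
  \<open>U\<close> the contraction is a renaming, which is undone in \<open>K\<close>. With both
  ends in \<open>U\<close>, either \<open>p\<close> and \<open>q\<close> are joined in
  \<open>u\<close> and can be joined in \<open>K'\<close>, or they are spliced into an edge of
  \<open>K \<odot> x\<close>.\<close>

lemma edge_lift:
  assumes fin: "finite U" "finite D" "finite L"
    and disj: "U \<inter> D = {}" "U \<inter> L = {}" "D \<inter> L = {}"
    and pq: "p \<noteq> q" "{p, q} \<inter> (D \<union> L) = {}" "{p, q} \<inter> U \<noteq> {}"
    and u: "matching_on (U \<union> L) u" and K: "matching_on (sym_diff {p, q} U \<union> D) K"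
    and x: "matching_on (D \<union> L) x"
    and eq: "{{p, q}} \<odot> u = K \<odot> x" and low: "\<forall>B\<in>x. B \<subseteq> L \<longrightarrow> B \<in> u"
  shows "\<exists>K'. matching_on (U \<union> D) K' \<and> {{p, q}} \<odot> K' = K \<and> K' \<odot> x = u"
proof -
  have one: ?thesis if ab: "{p, q} = {a, b}" "a \<in> U" "b \<notin> U" for a b
  proof -
    let ?K' = "{{p, q}} \<odot> K"
    have "matching_on (sym_diff {p, q} (sym_diff {p, q} U \<union> D)) ?K'"
      by (rule matching_on_glue_edge[OF K pq(1)])
    moreover have "sym_diff {p, q} (sym_diff {p, q} U \<union> D) = U \<union> D" using pq by auto
    ultimately have m: "matching_on (U \<union> D) ?K'" by (simp only:)
    have "{{b, a}} \<odot> ({{b, a}} \<odot> K) = K"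
      by (rule glue_edge_twice[OF K]) (use ab pq in auto)
    then have K': "{{p, q}} \<odot> ?K' = K" using ab(1) by (simp add: insert_commute)
    have "?K' \<odot> x = {{p, q}} \<odot> (K \<odot> x)"
      by (rule glue_matching_assoc[OF matching_on_doubleton[OF pq(1)] K x]) (use pq in auto)
    also have "\<dots> = {{p, q}} \<odot> ({{p, q}} \<odot> u)" by (simp only: eq)
    also have "{{a, b}} \<odot> ({{a, b}} \<odot> u) = u"
      by (rule glue_edge_twice[OF u]) (use ab pq in auto)
    then have "{{p, q}} \<odot> ({{p, q}} \<odot> u) = u" by (simp only: ab(1))
    finally show ?thesis using m K' by blast
  qed
  consider "p \<in> U" "q \<notin> U" | "p \<notin> U" "q \<in> U" | "p \<in> U" "q \<in> U" using pq by auto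
  then show ?thesis
  proof cases
    case 1
    then show ?thesis using one by blast
  next
    case 2
    then show ?thesis using one[of q p] by blast
  next
    case 3
    define X0 where "X0 = U - {p, q}"
    have XU: "sym_diff {p, q} U = X0" "insert p (insert q (X0 \<union> L)) = U \<union> L"
      "insert p (insert q (X0 \<union> D)) = U \<union> D" using 3 by (auto simp: X0_def)
    have K0: "matching_on (X0 \<union> D) K" using K unfolding XU .
    have u0: "matching_on (insert p (insert q (X0 \<union> L))) u" unfolding XU by (rule u)
    have q0: "p \<notin> X0 \<union> L" "q \<notin> X0 \<union> L" "p \<notin> X0 \<union> D" "q \<notin> X0 \<union> D"
      "p \<notin> X0 \<union> D \<union> L" "q \<notin> X0 \<union> D \<union> L" using pq by (auto simp: X0_def)
    have prem: "finite X0" "X0 \<inter> D = {}" "X0 \<inter> L = {}" using fin disj by (auto simp: X0_def)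
    from u0 eq pq(1) q0(1,2) show ?thesis
    proof (cases rule: splice_cases)
      case 1
      let ?K' = "insert {p, q} K"
      have m: "matching_on (U \<union> D) ?K'" using matching_on_insert[OF K0 pq(1) q0(3,4)] unfolding XU .
      have "{p, q} \<notin> K" using matching_on_edge[OF K0, of p q] q0 by blast
      then have "{{p, q}} \<odot> ?K' = K" using glue_edge_mem[OF m] by simp
      moreover have "?K' \<odot> x = {{p, q}} \<odot> (K \<odot> x)"
        by (rule glue_insert_edge(1)[OF K0 pq(1) q0(3,4) x])
      moreover have "\<dots> = insert {p, q} (K \<odot> x)"
      proof (rule glue_edge_fresh[OF _ pq(1)])
        have "finite (X0 \<union> D)" using prem fin by simp
        then show "matching_on (sym_diff (X0 \<union> D) (D \<union> L)) (K \<odot> x)" using matching_on_glue K0 x by blast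
      qed (use q0 in auto)
      ultimately show ?thesis using m 1 by auto
    next
      case (2 z w)
      consider "z \<in> X0 \<or> z \<in> L \<and> w \<in> L" | "w \<in> X0" using 2 by auto
      then show ?thesis
      proof cases
        case 1
        show ?thesis
          using splice_lift[OF prem(1) fin(2,3) prem(2,3) disj(3) pq(1) q0(5,6) K0 x u0 2(1-5) low 1]
          unfolding XU .
      next
        \<comment> \<open>Only \<open>w\<close> is known to lie in \<open>X0\<close>; reading the
          path backwards exchanges \<open>z\<close> with \<open>w\<close> and \<open>p\<close> with
          \<open>q\<close>.\<close>
        case 2: 2
        have u1: "matching_on (insert q (insert p (X0 \<union> L))) u" using u0 by (simp add: insert_commute)
        have ueq: "u = insert {w, q} (insert {z, p} (K \<odot> x - {{w, z}}))"
          using \<open>u = insert {z, p} _\<close> by (simp add: insert_commute)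
        have wz: "{w, z} \<in> K \<odot> x" using \<open>{z, w} \<in> K \<odot> x\<close> by (simp add: insert_commute)
        have "\<exists>K'. matching_on (insert q (insert p (X0 \<union> D))) K' \<and> {{q, p}} \<odot> K' = K \<and> K' \<odot> x = u"
          by (rule splice_lift[OF prem(1) fin(2,3) prem(2,3) disj(3) pq(1)[symmetric] q0(6,5) K0 x u1 wz
            \<open>w \<in> X0 \<union> L\<close> \<open>z \<in> X0 \<union> L\<close> \<open>z \<noteq> w\<close>[symmetric] ueq low disjI1[OF 2]])
        then show ?thesis by (simp add: insert_commute XU)
      qed
    qed
  qed
qed

text \<open>Finds one \<open>a\<close> whose gluings on both sides are prescribed. The equation
  \<open>s \<odot> u = K \<odot> x\<close> is necessary by associativity, and the arcs of
  \<open>x\<close> inside \<open>L\<close> must occur in \<open>u\<close> by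
  \<open>glue_keep\<close>; together this suffices. In the induction one edge of \<open>s\<close> is
  contracted in \<open>u\<close>, and the solution \<open>a1\<close> for the remaining edges then
  takes the part of \<open>K\<close> in \<open>edge_lift\<close>.\<close>

lemma gluing_lift:
  assumes "finite S" "matching_on S s" "finite U" "finite D" "finite L"
    and "U \<inter> D = {}" "U \<inter> L = {}" "D \<inter> L = {}" "S \<inter> (D \<union> L) = {}" "\<forall>B\<in>s. B \<inter> U \<noteq> {}"
    and "matching_on (U \<union> L) u" "matching_on (sym_diff S U \<union> D) K" "matching_on (D \<union> L) x"
    and "s \<odot> u = K \<odot> x" "\<forall>B\<in>x. B \<subseteq> L \<longrightarrow> B \<in> u"
  shows "\<exists>a. matching_on (U \<union> D) a \<and> s \<odot> a = K \<and> a \<odot> x = u"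
  using assms
proof (induction S s arbitrary: U u rule: matching_on_induct)
  case empty
  then show ?case by auto
next
  case (insert S s p q)
  define U1 where "U1 = sym_diff {p, q} U"
  have UL: "sym_diff {p, q} (U \<union> L) = U1 \<union> L" using insert.prems(7) by (auto simp: U1_def)
  have sd: "sym_diff S U1 = sym_diff (insert p (insert q S)) U"
    using insert.hyps by (auto simp: U1_def)
  have u1: "matching_on (U1 \<union> L) ({{p, q}} \<odot> u)"
    using matching_on_glue_edge[OF insert.prems(9) insert.hyps(3)] unfolding UL .
  have eq1: "insert {p, q} s \<odot> c = s \<odot> ({{p, q}} \<odot> c)" if "matching_on Z c" for c Z
    using glue_insert_edge(2)[OF insert.hyps(2-5) that] .
  \<comment> \<open>An arc inside \<open>L\<close> avoids \<open>p\<close> and \<open>q\<close> and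
    therefore survives the contraction.\<close>
  have low: "\<forall>B\<in>x. B \<subseteq> L \<longrightarrow> B \<in> {{p, q}} \<odot> u"
  proof clarify
    fix B assume B: "B \<in> x" "B \<subseteq> L"
    then have "B \<in> u" "B \<inter> {p, q} = {}" using insert.prems by auto
    then show "B \<in> {{p, q}} \<odot> u"
      by (intro glue_keep[OF matching_on_doubleton[OF insert.hyps(3)] _ insert.prems(9)]) auto
  qed
  have "\<exists>a. matching_on (U1 \<union> D) a \<and> s \<odot> a = K \<and> a \<odot> x = {{p, q}} \<odot> u"
  proof (rule insert.IH[OF _ _ _ _ _ _ _ _ u1 _ _ _ low])
    show "s \<odot> ({{p, q}} \<odot> u) = K \<odot> x" using insert.prems(12) eq1[OF insert.prems(9)] by simp
    show "\<forall>B\<in>s. B \<inter> U1 \<noteq> {}"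
    proof
      fix B assume B: "B \<in> s"
      then have "B \<subseteq> S" using matching_on_Union[OF insert.hyps(2)] by blast
      then show "B \<inter> U1 \<noteq> {}" using insert.prems(8) insert.hyps B by (auto simp: U1_def)
    qed
    show "matching_on (sym_diff S U1 \<union> D) K" unfolding sd using insert.prems(10) .
  qed (use insert.prems in \<open>auto simp: U1_def\<close>)
  then obtain a1 where a1: "matching_on (U1 \<union> D) a1" "s \<odot> a1 = K" "a1 \<odot> x = {{p, q}} \<odot> u" by blast
  have "\<exists>a. matching_on (U \<union> D) a \<and> {{p, q}} \<odot> a = a1 \<and> a \<odot> x = u"
    using insert.prems insert.hyps a1
    by (intro edge_lift[where L = L]) (auto simp: U1_def)
  then show ?case using a1(2) eq1 by metis
qed

section \<open>Brauer diagrams\<close>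

definition diagrams :: "nat set \<Rightarrow> nat set \<Rightarrow> vertex set set set" where
  "diagrams X Y = {\<alpha>. finite X \<and> finite Y \<and> matching_on (Upper ` X \<union> Lower ` Y) \<alpha>}"

text \<open>Unlike \<open>pprod\<close> this takes no sizes: the outer rows are what is left when
  the middle row drops out of the symmetric difference.\<close>

definition mul :: "vertex set set \<Rightarrow> vertex set set \<Rightarrow> vertex set set"  (infixl "\<bullet>" 70) where
  "\<alpha> \<bullet> \<beta> = relabel lower_to_mid \<alpha> \<odot> relabel upper_to_mid \<beta>"

text \<open>
  Products of several diagrams are glued together on numbered rows of vertices, row \<open>i\<close> being
  \<open>{i} \<times> X\<close>; \<open>layer i j\<close> places a diagram between the rows \<open>i\<close> and \<open>j\<close>. Its value on \<open>Mid\<close> is irrelevant.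
\<close>

definition layer :: "nat \<Rightarrow> nat \<Rightarrow> vertex \<Rightarrow> nat \<times> nat" where
  "layer i j v = (case v of Upper x \<Rightarrow> (i, x) | Mid x \<Rightarrow> (i, x) | Lower x \<Rightarrow> (j, x))"

lemma layer_simps [simp]: "layer i j (Upper x) = (i, x)" "layer i j (Lower x) = (j, x)"
  by (simp_all add: layer_def)

abbreviation at_layers :: "nat \<Rightarrow> nat \<Rightarrow> vertex set set \<Rightarrow> (nat \<times> nat) set set" where
  "at_layers i j \<equiv> relabel (layer i j)"

lemma diagrams_matching: "\<alpha> \<in> diagrams X Y \<Longrightarrow> matching_on (Upper ` X \<union> Lower ` Y) \<alpha>"
  and diagrams_finite: "\<alpha> \<in> diagrams X Y \<Longrightarrow> finite X" "\<alpha> \<in> diagrams X Y \<Longrightarrow> finite Y"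
  by (auto simp: diagrams_def)

lemma diagrams_Union: "\<alpha> \<in> diagrams X Y \<Longrightarrow> \<Union>\<alpha> = Upper ` X \<union> Lower ` Y"
  by (simp add: diagrams_def matching_on_Union)

lemma brauer_eq_diagrams: "brauer m n = diagrams {1..m} {1..n}"
  by (simp add: brauer_def diagrams_def matching_on_def vertices_def)

lemma matching_at_layers:
  assumes "\<alpha> \<in> diagrams X Y" "i \<noteq> j"
  shows "matching_on ({i} \<times> X \<union> {j} \<times> Y) (at_layers i j \<alpha>)"
proof -
  have "matching_on (layer i j ` (Upper ` X \<union> Lower ` Y)) (at_layers i j \<alpha>)"
    using assms by (intro matching_on_relabel[OF diagrams_matching]) (auto simp: inj_on_def)
  moreover have "layer i j ` (Upper ` X \<union> Lower ` Y) = {i} \<times> X \<union> {j} \<times> Y"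
    unfolding image_Un image_image by auto
  ultimately show ?thesis by simp
qed

definition unlayer :: "nat \<Rightarrow> nat \<times> nat \<Rightarrow> vertex" where
  "unlayer i v = (if fst v = i then Upper (snd v) else Lower (snd v))"

lemma unlayer_layer: 
  assumes "\<alpha> \<in> diagrams X Y" "i \<noteq> j"
  shows "relabel (unlayer i) (at_layers i j \<alpha>) = \<alpha>"
  unfolding relabel_comp using assms diagrams_Union[OF assms(1)]
  by (intro relabel_id) (auto simp: unlayer_def)

lemma at_layers_inject:
  assumes "\<alpha> \<in> diagrams X Y" "\<beta> \<in> diagrams Z W" "i \<noteq> j"
  shows "at_layers i j \<alpha> = at_layers i j \<beta> \<longleftrightarrow> \<alpha> = \<beta>"
  using unlayer_layer[OF assms(1,3)] unlayer_layer[OF assms(2,3)] by metis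

lemma at_layers_surj:
  assumes M: "matching_on ({i} \<times> X \<union> {j} \<times> Y) M" and fin: "finite X" "finite Y" and ij: "i \<noteq> j"
  obtains \<alpha> where "\<alpha> \<in> diagrams X Y" "at_layers i j \<alpha> = M"
proof
  have "matching_on (unlayer i ` ({i} \<times> X \<union> {j} \<times> Y)) (relabel (unlayer i) M)"
    using ij by (intro matching_on_relabel[OF M]) (auto simp: inj_on_def unlayer_def)
  moreover have "unlayer i ` ({i} \<times> X \<union> {j} \<times> Y) = Upper ` X \<union> Lower ` Y"
  proof -
    have "unlayer i ` ({i} \<times> X) = Upper ` X" by (force simp: unlayer_def)
    moreover have "unlayer i ` ({j} \<times> Y) = Lower ` Y" using ij by (force simp: unlayer_def)
    ultimately show ?thesis by (simp only: image_Un)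
  qed
  ultimately show "relabel (unlayer i) M \<in> diagrams X Y" using fin by (simp add: diagrams_def)
  show "at_layers i j (relabel (unlayer i) M) = M"
    unfolding relabel_comp using matching_on_Union[OF M] ij
    by (intro relabel_id) (auto simp: unlayer_def)
qed

lemma relabel_mid:
  assumes "\<alpha> \<in> diagrams X Y"
  shows "matching_on (Upper ` X \<union> Mid ` Y) (relabel lower_to_mid \<alpha>)"
    and "matching_on (Mid ` X \<union> Lower ` Y) (relabel upper_to_mid \<alpha>)"
proof -
  have "matching_on (lower_to_mid ` (Upper ` X \<union> Lower ` Y)) (relabel lower_to_mid \<alpha>)"
    by (intro matching_on_relabel[OF diagrams_matching[OF assms]]) (auto simp: inj_on_def)
  then show "matching_on (Upper ` X \<union> Mid ` Y) (relabel lower_to_mid \<alpha>)"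
    by (simp add: image_Un image_image)
  have "matching_on (upper_to_mid ` (Upper ` X \<union> Lower ` Y)) (relabel upper_to_mid \<alpha>)"
    by (intro matching_on_relabel[OF diagrams_matching[OF assms]]) (auto simp: inj_on_def)
  then show "matching_on (Mid ` X \<union> Lower ` Y) (relabel upper_to_mid \<alpha>)"
    by (simp add: image_Un image_image)
qed

lemma mul_closed [intro]:
  assumes "\<alpha> \<in> diagrams X Y" "\<beta> \<in> diagrams Y Z"
  shows "\<alpha> \<bullet> \<beta> \<in> diagrams X Z"
proof -
  have "matching_on (sym_diff (Upper ` X \<union> Mid ` Y) (Mid ` Y \<union> Lower ` Z)) (\<alpha> \<bullet> \<beta>)"
    unfolding mul_def using diagrams_finite[OF assms(1)] diagrams_finite[OF assms(2)] assms
    by (intro matching_on_glue relabel_mid) auto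
  moreover have "sym_diff (Upper ` X \<union> Mid ` Y) (Mid ` Y \<union> Lower ` Z) = Upper ` X \<union> Lower ` Z" by auto
  ultimately have "matching_on (Upper ` X \<union> Lower ` Z) (\<alpha> \<bullet> \<beta>)" by (simp only:)
  then show ?thesis using diagrams_finite[OF assms(1)] diagrams_finite[OF assms(2)] by (simp add: diagrams_def)
qed

lemma pprod_eq_mul:
  assumes "\<alpha> \<in> diagrams {1..m} Y" "\<beta> \<in> diagrams Y {1..k}"
  shows "pprod m k \<alpha> \<beta> = \<alpha> \<bullet> \<beta>"
proof -
  have "sym_diff (Upper ` {1..m} \<union> Mid ` Y) (Mid ` Y \<union> Lower ` {1..k}) = vertices m k"
    unfolding vertices_def by auto
  moreover have "block_graph \<gamma> = same_block \<gamma>" for \<gamma>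
    by (simp add: block_graph_def same_block_def)
  ultimately show ?thesis
    using matching_on_Union[OF relabel_mid(1)[OF assms(1)]] matching_on_Union[OF relabel_mid(2)[OF assms(2)]]
    by (simp add: pprod_def mul_def glue_def components_def product_graph_def)
qed

lemma at_layers_mul:
  assumes \<alpha>: "\<alpha> \<in> diagrams X Y" and \<beta>: "\<beta> \<in> diagrams Y Z" and ne: "i \<noteq> j" "j \<noteq> k" "i \<noteq> k"
  shows "at_layers i k (\<alpha> \<bullet> \<beta>) = at_layers i j \<alpha> \<odot> at_layers j k \<beta>"
proof -
  define g where "g v = (case v of Upper x \<Rightarrow> (i, x) | Mid x \<Rightarrow> (j, x) | Lower x \<Rightarrow> (k, x))" for v
  have g: "inj g" using ne by (auto simp: inj_def g_def split: vertex.splits)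
  have 1: "relabel g (relabel lower_to_mid \<alpha>) = at_layers i j \<alpha>"
    unfolding relabel_comp by (rule relabel_cong) (auto simp: diagrams_Union[OF \<alpha>] g_def)
  have 2: "relabel g (relabel upper_to_mid \<beta>) = at_layers j k \<beta>"
    unfolding relabel_comp by (rule relabel_cong) (auto simp: diagrams_Union[OF \<beta>] g_def)
  have 3: "relabel g (\<alpha> \<bullet> \<beta>) = at_layers i k (\<alpha> \<bullet> \<beta>)"
    by (rule relabel_cong) (auto simp: diagrams_Union[OF mul_closed[OF \<alpha> \<beta>]] g_def)
  have "relabel g (relabel lower_to_mid \<alpha>) \<odot> relabel g (relabel upper_to_mid \<beta>) = relabel g (\<alpha> \<bullet> \<beta>)"
    unfolding mul_def by (rule glue_relabel) (use g in \<open>auto intro: inj_on_subset\<close>)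
  then show ?thesis unfolding 1 2 3 ..
qed

lemma mul_assoc:
  assumes \<alpha>: "\<alpha> \<in> diagrams X Y" and \<beta>: "\<beta> \<in> diagrams Y Z" and \<gamma>: "\<gamma> \<in> diagrams Z W"
  shows "(\<alpha> \<bullet> \<beta>) \<bullet> \<gamma> = \<alpha> \<bullet> (\<beta> \<bullet> \<gamma>)"
proof -
  have "at_layers 0 3 ((\<alpha> \<bullet> \<beta>) \<bullet> \<gamma>) = (at_layers 0 1 \<alpha> \<odot> at_layers 1 2 \<beta>) \<odot> at_layers 2 3 \<gamma>"
    using at_layers_mul[OF mul_closed[OF \<alpha> \<beta>] \<gamma>, of 0 2 3] at_layers_mul[OF \<alpha> \<beta>, of 0 1 2] by simp
  \<comment> \<open>Row 1 belongs to the first two operands only and row 2 to the last two only, so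
    no vertex is common to all three.\<close>
  also have "\<dots> = at_layers 0 1 \<alpha> \<odot> (at_layers 1 2 \<beta> \<odot> at_layers 2 3 \<gamma>)"
    by (rule glue_matching_assoc[OF matching_at_layers[OF \<alpha>] matching_at_layers[OF \<beta>] matching_at_layers[OF \<gamma>]]) auto
  also have "\<dots> = at_layers 0 3 (\<alpha> \<bullet> (\<beta> \<bullet> \<gamma>))"
    using at_layers_mul[OF \<alpha> mul_closed[OF \<beta> \<gamma>], of 0 1 3] at_layers_mul[OF \<beta> \<gamma>, of 1 2 3] by simp
  finally show ?thesis
    using at_layers_inject[OF mul_closed[OF mul_closed[OF \<alpha> \<beta>] \<gamma>] mul_closed[OF \<alpha> mul_closed[OF \<beta> \<gamma>]], of 0 3] by simp
qed

section \<open>Diagrams of bijections\<close>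

definition graph_diagram :: "(nat \<Rightarrow> nat) \<Rightarrow> nat set \<Rightarrow> vertex set set" where
  "graph_diagram f X = (\<lambda>x. {Upper x, Lower (f x)}) ` X"

abbreviation id_diagram :: "nat set \<Rightarrow> vertex set set" where
  "id_diagram \<equiv> graph_diagram (\<lambda>x. x)"

lemma graph_diagram_closed:
  assumes "finite X" "bij_betw f X Y"
  shows "graph_diagram f X \<in> diagrams X Y"
proof -
  have inj: "inj_on f X" and Y: "f ` X = Y" using assms(2) by (auto simp: bij_betw_def)
  let ?g = "\<lambda>v. case v of Upper x \<Rightarrow> Lower (f x) | Mid x \<Rightarrow> Mid x | Lower x \<Rightarrow> Lower x"
  have "matching_on (Upper ` X \<union> ?g ` Upper ` X) ((\<lambda>v. {v, ?g v}) ` Upper ` X)"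
    using inj by (intro matching_on_pairs) (auto simp: inj_on_def)
  moreover have "Upper ` X \<union> ?g ` Upper ` X = Upper ` X \<union> Lower ` Y"
    "(\<lambda>v. {v, ?g v}) ` Upper ` X = graph_diagram f X"
    using Y by (auto simp: graph_diagram_def image_image)
  ultimately show ?thesis using assms Y by (auto simp: diagrams_def)
qed

lemma id_diagram_closed [intro]: "finite X \<Longrightarrow> id_diagram X \<in> diagrams X X"
  by (rule graph_diagram_closed) (auto simp: bij_betw_def)

lemma at_layers_graph_diagram:
  "at_layers i j (graph_diagram f X) = (\<lambda>v. {v, (j, f (snd v))}) ` ({i} \<times> X)"
  by (force simp: graph_diagram_def image_image)

lemma mul_graph_diagram_right:
  assumes \<beta>: "\<beta> \<in> diagrams X Y" and f: "bij_betw f Y Z"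
  shows "\<beta> \<bullet> graph_diagram f Y = relabel (case_vertex Upper Mid (\<lambda>y. Lower (f y))) \<beta>" (is "_ = relabel ?g \<beta>")
proof -
  have fin: "finite X" "finite Y" using diagrams_finite[OF \<beta>] by auto
  have inj: "inj_on f Y" and Z: "f ` Y = Z" using f by (auto simp: bij_betw_def)
  have G: "graph_diagram f Y \<in> diagrams Y Z" using fin f by (intro graph_diagram_closed)
  have "matching_on (?g ` (Upper ` X \<union> Lower ` Y)) (relabel ?g \<beta>)"
    by (rule matching_on_relabel[OF diagrams_matching[OF \<beta>]], rule inj_onI)
      (use inj in \<open>auto dest: inj_onD\<close>)
  moreover have "?g ` (Upper ` X \<union> Lower ` Y) = Upper ` X \<union> Lower ` Z"
    unfolding image_Un image_image Z[symmetric] by simp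
  ultimately have D: "relabel ?g \<beta> \<in> diagrams X Z"
    using fin Z by (auto simp: diagrams_def)
  have "at_layers 0 2 (\<beta> \<bullet> graph_diagram f Y) = at_layers 1 2 (graph_diagram f Y) \<odot> at_layers 0 1 \<beta>"
    using at_layers_mul[OF \<beta> G, of 0 1 2] by (simp add: glue_commute)
  also have "\<dots> = relabel (\<lambda>v. if v \<in> {1} \<times> Y then (2, f (snd v)) else v) (at_layers 0 1 \<beta>)"
    unfolding at_layers_graph_diagram using inj fin
    by (intro glue_rename[OF _ _ _ _ matching_at_layers[OF \<beta>]]) (auto simp: inj_on_def)
  also have "\<dots> = at_layers 0 2 (relabel ?g \<beta>)"
    unfolding relabel_comp by (rule relabel_cong) (auto simp: diagrams_Union[OF \<beta>])
  finally show ?thesis using at_layers_inject[OF mul_closed[OF \<beta> G] D] by simp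
qed

lemma mul_graph_diagram_left:
  assumes \<beta>: "\<beta> \<in> diagrams Y Z" and f: "bij_betw f X Y" and g: "\<And>x. x \<in> X \<Longrightarrow> g (f x) = x"
  shows "graph_diagram f X \<bullet> \<beta> = relabel (case_vertex (\<lambda>y. Upper (g y)) Mid Lower) \<beta>" (is "_ = relabel ?g \<beta>")
proof -
  have inj: "inj_on f X" and Y: "f ` X = Y" using f by (auto simp: bij_betw_def)
  have fin: "finite X" "finite Z" using diagrams_finite[OF \<beta>] f by (auto simp: bij_betw_finite)
  have G: "graph_diagram f X \<in> diagrams X Y" using fin f by (intro graph_diagram_closed)
  have gY: "g ` Y = X" using Y g by force
  have injg: "inj_on g Y" using Y g by (auto simp: inj_on_def)
  have "matching_on (?g ` (Upper ` Y \<union> Lower ` Z)) (relabel ?g \<beta>)"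
    by (rule matching_on_relabel[OF diagrams_matching[OF \<beta>]], rule inj_onI)
      (use injg in \<open>auto dest: inj_onD\<close>)
  moreover have "?g ` (Upper ` Y \<union> Lower ` Z) = Upper ` X \<union> Lower ` Z"
    unfolding image_Un image_image gY[symmetric] by simp
  ultimately have D: "relabel ?g \<beta> \<in> diagrams X Z"
    using fin by (auto simp: diagrams_def)
  have "at_layers 0 1 (graph_diagram f X) = (\<lambda>v. {v, (0, g (snd v))}) ` ({1} \<times> Y)"
  proof -
    have "{1::nat} \<times> Y = (\<lambda>v. (1, f (snd v))) ` ({0::nat} \<times> X)" using Y by force
    then have "(\<lambda>v. {v, (0, g (snd v))}) ` ({1::nat} \<times> Y) =
        (\<lambda>v. {(1, f (snd v)), (0, g (f (snd v)))}) ` ({0::nat} \<times> X)"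
      by (simp only: image_image snd_conv)
    also have "\<dots> = (\<lambda>v. {v, (1, f (snd v))}) ` ({0} \<times> X)"
      by (rule image_cong[OF refl]) (use g in auto)
    finally show ?thesis unfolding at_layers_graph_diagram ..
  qed
  then have "at_layers 0 2 (graph_diagram f X \<bullet> \<beta>) = (\<lambda>v. {v, (0, g (snd v))}) ` ({1} \<times> Y) \<odot> at_layers 1 2 \<beta>"
    using at_layers_mul[OF G \<beta>, of 0 1 2] by simp
  also have "\<dots> = relabel (\<lambda>v. if v \<in> {1} \<times> Y then (0, g (snd v)) else v) (at_layers 1 2 \<beta>)"
    using injg diagrams_finite[OF \<beta>]
    by (intro glue_rename[OF _ _ _ _ matching_at_layers[OF \<beta>]]) (auto simp: inj_on_def)
  also have "\<dots> = at_layers 0 2 (relabel ?g \<beta>)"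
    unfolding relabel_comp by (rule relabel_cong) (auto simp: diagrams_Union[OF \<beta>])
  finally show ?thesis using at_layers_inject[OF mul_closed[OF G \<beta>] D] by simp
qed

lemma mul_id_right [simp]:
  assumes "\<beta> \<in> diagrams X Y"
  shows "\<beta> \<bullet> id_diagram Y = \<beta>"
  unfolding mul_graph_diagram_right[OF assms bij_betw_id[unfolded id_def]]
  by (rule relabel_id) (auto simp: diagrams_Union[OF assms])

lemma mul_id_left [simp]:
  assumes "\<beta> \<in> diagrams X Y"
  shows "id_diagram X \<bullet> \<beta> = \<beta>"
  unfolding mul_graph_diagram_left[OF assms bij_betw_id[unfolded id_def], of "\<lambda>x. x", OF refl]
  by (rule relabel_id) (auto simp: diagrams_Union[OF assms])

section \<open>Cofactors of a diagram: counting and lifting\<close>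

lemma card_at_layers:
  assumes "i \<noteq> j" "finite X" "finite Y"
  shows "card {\<alpha> \<in> diagrams X Y. P (at_layers i j \<alpha>)} = card {M. matching_on ({i} \<times> X \<union> {j} \<times> Y) M \<and> P M}"
proof (rule bij_betw_same_card)
  show "bij_betw (at_layers i j) {\<alpha> \<in> diagrams X Y. P (at_layers i j \<alpha>)}
      {M. matching_on ({i} \<times> X \<union> {j} \<times> Y) M \<and> P M}"
  proof (rule bij_betwI')
    fix M assume "M \<in> {M. matching_on ({i} \<times> X \<union> {j} \<times> Y) M \<and> P M}"
    then show "\<exists>\<alpha>\<in>{\<alpha> \<in> diagrams X Y. P (at_layers i j \<alpha>)}. M = at_layers i j \<alpha>"
      using at_layers_surj[OF _ assms(2,3,1)] by (metis (mono_tags, lifting) mem_Collect_eq)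
  next
    fix \<alpha> \<beta> assume "\<alpha> \<in> {\<alpha> \<in> diagrams X Y. P (at_layers i j \<alpha>)}" "\<beta> \<in> {\<alpha> \<in> diagrams X Y. P (at_layers i j \<alpha>)}"
    then have "\<alpha> \<in> diagrams X Y" "\<beta> \<in> diagrams X Y" by auto
    then show "at_layers i j \<alpha> = at_layers i j \<beta> \<longleftrightarrow> \<alpha> = \<beta>" using assms(1) by (rule at_layers_inject)
  next
    fix \<alpha> assume "\<alpha> \<in> {\<alpha> \<in> diagrams X Y. P (at_layers i j \<alpha>)}"
    then show "at_layers i j \<alpha> \<in> {M. matching_on ({i} \<times> X \<union> {j} \<times> Y) M \<and> P M}"
      using matching_at_layers[of \<alpha> X Y, OF _ assms(1)] by simp
  qed
qed

lemma card_times_layer: "card ({i} \<times> X) = card X"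
  by (simp add: card_cartesian_product)

lemma at_layers_meets_lower:
  assumes "s \<in> diagrams X Y" "\<forall>B\<in>s. B \<inter> range Lower \<noteq> {}" "C \<in> at_layers i j s"
  shows "C \<inter> {j} \<times> Y \<noteq> {}"
proof -
  obtain B where B: "B \<in> s" "C = layer i j ` B" using assms(3) by blast
  then obtain y where y: "Lower y \<in> B" using assms(2) by blast
  then have "Lower y \<in> \<Union>s" using B by blast
  then have "y \<in> Y" unfolding diagrams_Union[OF assms(1)] by blast
  moreover have "(j, y) \<in> C" unfolding B(2) using y by (rule rev_image_eqI) simp
  ultimately show ?thesis by blast
qed

lemma at_layers_meets_upper:
  assumes "s \<in> diagrams X Y" "\<forall>B\<in>s. B \<inter> range Upper \<noteq> {}" "C \<in> at_layers i j s"
  shows "C \<inter> {i} \<times> X \<noteq> {}"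
proof -
  obtain B where B: "B \<in> s" "C = layer i j ` B" using assms(3) by blast
  then obtain y where y: "Upper y \<in> B" using assms(2) by blast
  then have "Upper y \<in> \<Union>s" using B by blast
  then have "y \<in> X" unfolding diagrams_Union[OF assms(1)] by blast
  moreover have "(i, y) \<in> C" unfolding B(2) using y by (rule rev_image_eqI) simp
  ultimately show ?thesis by blast
qed

text \<open>An instance of \<open>card_gluings\<close> on the rows 0, 1 and 2. As \<open>s\<close>
  has no upper arcs, all of \<open>X\<close> is joined to \<open>Y\<close>, and the remaining points
  of \<open>Y\<close> form the \<open>(card Y - card X) div 2\<close> arcs that are
  contracted.\<close>

lemma card_right_cofactors:
  assumes s: "s \<in> diagrams X Y" and low: "\<forall>B\<in>s. B \<inter> range Lower \<noteq> {}" and J: "J \<in> diagrams X Z"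
  shows "card {a \<in> diagrams Y Z. s \<bullet> a = J} = (\<Prod>i<(card Y - card X) div 2. card X + card Z + 2 * i + 1)"
    and "\<exists>k. card Y = card X + 2 * k"
proof -
  have fin: "finite X" "finite Y" "finite Z"
    using diagrams_finite[OF s] diagrams_finite[OF J] by auto
  let ?s = "at_layers 0 1 s" and ?J = "at_layers 0 2 J"
  let ?S = "{0::nat} \<times> X \<union> {1} \<times> Y" and ?U = "{1::nat} \<times> Y \<union> {2} \<times> Z"
  have sd: "sym_diff ?S ?U = {0} \<times> X \<union> {2} \<times> Z" by auto
  have cU: "card ?U = card Y + card Z"
    using fin by (subst card_Un_disjoint) (auto simp: card_times_layer)
  have cS: "card (sym_diff ?S ?U) = card X + card Z"
    unfolding sd using fin by (subst card_Un_disjoint) (auto simp: card_times_layer)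
  have "card {a. matching_on ?U a \<and> ?s \<odot> a = ?J} =
      (\<Prod>i<card {B\<in>?s. B \<subseteq> ?U}. card (sym_diff ?S ?U) + 2 * i + 1) \<and>
    card ?U = card (sym_diff ?S ?U) + 2 * card {B\<in>?s. B \<subseteq> ?U}"
  proof (rule card_gluings)
    show "matching_on ?S ?s" using s by (intro matching_at_layers) auto
    show "matching_on (sym_diff ?S ?U) ?J" unfolding sd using J by (intro matching_at_layers) auto
    show "\<forall>B\<in>?s. B \<inter> ?U \<noteq> {}"
    proof
      fix B assume "B \<in> ?s"
      then have "B \<inter> {1} \<times> Y \<noteq> {}" by (rule at_layers_meets_lower[OF s low])
      then show "B \<inter> ?U \<noteq> {}" by blast
    qed
  qed (use fin in auto)
  then have *: "card {a. matching_on ?U a \<and> ?s \<odot> a = ?J} =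
      (\<Prod>i<card {B\<in>?s. B \<subseteq> ?U}. card X + card Z + 2 * i + 1)"
    "card Y = card X + 2 * card {B\<in>?s. B \<subseteq> ?U}" unfolding cS cU by auto
  then show "\<exists>k. card Y = card X + 2 * k" by blast
  from * have "card {a. matching_on ?U a \<and> ?s \<odot> a = ?J} = (\<Prod>i<(card Y - card X) div 2. card X + card Z + 2 * i + 1)"
    by simp
  moreover have "card {a. matching_on ?U a \<and> ?s \<odot> a = ?J} = card {a \<in> diagrams Y Z. ?s \<odot> at_layers 1 2 a = ?J}"
    using card_at_layers[of 1 2 Y Z "\<lambda>a. ?s \<odot> a = ?J"] fin by simp
  moreover have "?s \<odot> at_layers 1 2 a = ?J \<longleftrightarrow> s \<bullet> a = J" if "a \<in> diagrams Y Z" for a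
    using at_layers_mul[OF s that, of 0 1 2] at_layers_inject[OF mul_closed[OF s that] J, of 0 2] by simp
  then have "{a \<in> diagrams Y Z. ?s \<odot> at_layers 1 2 a = ?J} = {a \<in> diagrams Y Z. s \<bullet> a = J}"
    by (intro Collect_cong conj_cong refl) simp
  ultimately show "card {a \<in> diagrams Y Z. s \<bullet> a = J} = (\<Prod>i<(card Y - card X) div 2. card X + card Z + 2 * i + 1)" by simp
qed

lemma card_left_cofactors:
  assumes s: "s \<in> diagrams Y Z" and up: "\<forall>B\<in>s. B \<inter> range Upper \<noteq> {}" and J: "J \<in> diagrams X Z"
  shows "card {b \<in> diagrams X Y. b \<bullet> s = J} = (\<Prod>i<(card Y - card Z) div 2. card X + card Z + 2 * i + 1)"
    and "\<exists>k. card Y = card Z + 2 * k"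
proof -
  have fin: "finite X" "finite Y" "finite Z"
    using diagrams_finite[OF s] diagrams_finite[OF J] by auto
  let ?s = "at_layers 1 2 s" and ?J = "at_layers 0 2 J"
  let ?S = "{1::nat} \<times> Y \<union> {2} \<times> Z" and ?U = "{0::nat} \<times> X \<union> {1} \<times> Y"
  have sd: "sym_diff ?S ?U = {0} \<times> X \<union> {2} \<times> Z" by auto
  have cU: "card ?U = card X + card Y"
    using fin by (subst card_Un_disjoint) (auto simp: card_times_layer)
  have cS: "card (sym_diff ?S ?U) = card X + card Z"
    unfolding sd using fin by (subst card_Un_disjoint) (auto simp: card_times_layer)
  have "card {a. matching_on ?U a \<and> ?s \<odot> a = ?J} =
      (\<Prod>i<card {B\<in>?s. B \<subseteq> ?U}. card (sym_diff ?S ?U) + 2 * i + 1) \<and>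
    card ?U = card (sym_diff ?S ?U) + 2 * card {B\<in>?s. B \<subseteq> ?U}"
  proof (rule card_gluings)
    show "matching_on ?S ?s" using s by (intro matching_at_layers) auto
    show "matching_on (sym_diff ?S ?U) ?J" unfolding sd using J by (intro matching_at_layers) auto
    show "\<forall>B\<in>?s. B \<inter> ?U \<noteq> {}"
    proof
      fix B assume "B \<in> ?s"
      then have "B \<inter> {1} \<times> Y \<noteq> {}" by (rule at_layers_meets_upper[OF s up])
      then show "B \<inter> ?U \<noteq> {}" by blast
    qed
  qed (use fin in auto)
  then have *: "card {a. matching_on ?U a \<and> ?s \<odot> a = ?J} =
      (\<Prod>i<card {B\<in>?s. B \<subseteq> ?U}. card X + card Z + 2 * i + 1)"
    "card Y = card Z + 2 * card {B\<in>?s. B \<subseteq> ?U}" unfolding cS cU by auto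
  then show "\<exists>k. card Y = card Z + 2 * k" by blast
  from * have "card {a. matching_on ?U a \<and> ?s \<odot> a = ?J} = (\<Prod>i<(card Y - card Z) div 2. card X + card Z + 2 * i + 1)"
    by simp
  moreover have "card {a. matching_on ?U a \<and> ?s \<odot> a = ?J} = card {a \<in> diagrams X Y. ?s \<odot> at_layers 0 1 a = ?J}"
    using card_at_layers[of 0 1 X Y "\<lambda>a. ?s \<odot> a = ?J"] fin by simp
  moreover have "?s \<odot> at_layers 0 1 a = ?J \<longleftrightarrow> a \<bullet> s = J" if "a \<in> diagrams X Y" for a
    using at_layers_mul[OF that s, of 0 1 2] at_layers_inject[OF mul_closed[OF that s] J, of 0 2]
    by (simp add: glue_commute)
  then have "{a \<in> diagrams X Y. ?s \<odot> at_layers 0 1 a = ?J} = {a \<in> diagrams X Y. a \<bullet> s = J}"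
    by (intro Collect_cong conj_cong refl) simp
  ultimately show "card {b \<in> diagrams X Y. b \<bullet> s = J} = (\<Prod>i<(card Y - card Z) div 2. card X + card Z + 2 * i + 1)" by simp
qed

lemma layer_block_subset:
  assumes "i \<noteq> j"
  shows "layer i j ` B \<subseteq> {j} \<times> Y \<Longrightarrow> B \<subseteq> Upper ` X \<union> Lower ` Y \<Longrightarrow> B \<subseteq> range Lower"
    and "layer i j ` B \<subseteq> {i} \<times> X \<Longrightarrow> B \<subseteq> Upper ` X \<union> Lower ` Y \<Longrightarrow> B \<subseteq> range Upper"
  using assms by force+

lemma layer_lower_block: "B \<subseteq> range Lower \<Longrightarrow> layer i j ` B = layer k j ` B"
  by (rule image_cong) auto

lemma layer_upper_block: "B \<subseteq> range Upper \<Longrightarrow> layer i j ` B = layer i k ` B"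
  by (rule image_cong) auto

lemma mem_at_layers:
  assumes "\<alpha> \<in> diagrams X Y" "B \<subseteq> range Upper \<union> range Lower" "i \<noteq> j"
  shows "layer i j ` B \<in> at_layers i j \<alpha> \<longleftrightarrow> B \<in> \<alpha>"
proof
  assume "layer i j ` B \<in> at_layers i j \<alpha>"
  then obtain C where C: "C \<in> \<alpha>" "layer i j ` B = layer i j ` C" by auto
  have "C \<subseteq> Upper ` X \<union> Lower ` Y" using C(1) diagrams_Union[OF assms(1)] by blast
  then have "C \<subseteq> range Upper \<union> range Lower" by blast
  moreover have "inj_on (layer i j) (range Upper \<union> range Lower)" using assms(3) by (auto simp: inj_on_def)
  ultimately have "B = C" using C(2) assms(2) inj_on_image_eq_iff by metis
  then show "B \<in> \<alpha>" using C by simp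
qed auto

text \<open>This makes the condition on arcs in \<open>right_cofactor_lift\<close> a necessary one.
  The mirror image below also shows that a left factor of a permutation diagram has no upper
  arc.\<close>

lemma mul_keeps_lower:
  assumes \<alpha>: "\<alpha> \<in> diagrams X Y" and \<beta>: "\<beta> \<in> diagrams Y Z" and B: "B \<in> \<beta>" "B \<subseteq> range Lower"
  shows "B \<in> \<alpha> \<bullet> \<beta>"
proof -
  have "layer 1 2 ` B \<in> at_layers 0 1 \<alpha> \<odot> at_layers 1 2 \<beta>"
    using diagrams_finite[OF \<alpha>] B
    by (intro glue_keep[OF matching_at_layers[OF \<alpha>] _ matching_at_layers[OF \<beta>]]) auto
  then have "layer 0 2 ` B \<in> at_layers 0 2 (\<alpha> \<bullet> \<beta>)"
    using at_layers_mul[OF \<alpha> \<beta>, of 0 1 2] layer_lower_block[OF B(2), of 1 2 0] by simp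
  then show ?thesis using mem_at_layers[OF mul_closed[OF \<alpha> \<beta>], of B 0 2] B(2) by auto
qed

lemma mul_keeps_upper:
  assumes \<alpha>: "\<alpha> \<in> diagrams X Y" and \<beta>: "\<beta> \<in> diagrams Y Z" and B: "B \<in> \<alpha>" "B \<subseteq> range Upper"
  shows "B \<in> \<alpha> \<bullet> \<beta>"
proof -
  have "layer 0 1 ` B \<in> at_layers 1 2 \<beta> \<odot> at_layers 0 1 \<alpha>"
    using diagrams_finite[OF \<beta>] B
    by (intro glue_keep[OF matching_at_layers[OF \<beta>] _ matching_at_layers[OF \<alpha>]]) auto
  then have "layer 0 2 ` B \<in> at_layers 0 2 (\<alpha> \<bullet> \<beta>)"
    using at_layers_mul[OF \<alpha> \<beta>, of 0 1 2] layer_upper_block[OF B(2), of 0 1 2] by (simp add: glue_commute)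
  then show ?thesis using mem_at_layers[OF mul_closed[OF \<alpha> \<beta>], of B 0 2] B(2) by auto
qed

text \<open>An instance of \<open>gluing_lift\<close> with \<open>s\<close> between the rows 0 and
  1, the unknown \<open>a\<close> between 1 and 2, and \<open>x\<close> between 2 and 3;
  \<open>K\<close> spans the first two of these layers and \<open>u\<close> the last two.\<close>

lemma right_cofactor_lift:
  assumes s: "s \<in> diagrams X Y" and low: "\<forall>B\<in>s. B \<inter> range Lower \<noteq> {}"
    and u: "u \<in> diagrams Y Z" and K: "K \<in> diagrams X W" and x: "x \<in> diagrams W Z"
    and eq: "s \<bullet> u = K \<bullet> x" and arcs: "\<forall>B\<in>x. B \<subseteq> range Lower \<longrightarrow> B \<in> u"
  shows "\<exists>a \<in> diagrams Y W. s \<bullet> a = K \<and> a \<bullet> x = u"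
proof -
  have fin: "finite X" "finite Y" "finite Z" "finite W"
    using diagrams_finite[OF s] diagrams_finite[OF x] by auto
  let ?S = "{0::nat} \<times> X \<union> {1} \<times> Y" and ?U = "{1::nat} \<times> Y" and ?D = "{2::nat} \<times> W" and ?L = "{3::nat} \<times> Z"
  have sd: "sym_diff ?S ?U \<union> ?D = {0} \<times> X \<union> {2} \<times> W" by auto
  have "\<exists>a. matching_on (?U \<union> ?D) a \<and> at_layers 0 1 s \<odot> a = at_layers 0 2 K \<and>
      a \<odot> at_layers 2 3 x = at_layers 1 3 u"
  proof (rule gluing_lift[where S = ?S and L = ?L])
    show "matching_on ?S (at_layers 0 1 s)" using s by (intro matching_at_layers) auto
    show "\<forall>B\<in>at_layers 0 1 s. B \<inter> ?U \<noteq> {}"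
    proof
      fix B assume "B \<in> at_layers 0 1 s"
      then have "B \<inter> {1} \<times> Y \<noteq> {}" by (rule at_layers_meets_lower[OF s low])
      then show "B \<inter> ?U \<noteq> {}" by blast
    qed
    show "matching_on (?U \<union> ?L) (at_layers 1 3 u)" using u by (intro matching_at_layers) auto
    show "matching_on (sym_diff ?S ?U \<union> ?D) (at_layers 0 2 K)"
      unfolding sd using K by (intro matching_at_layers) auto
    show "matching_on (?D \<union> ?L) (at_layers 2 3 x)" using x by (intro matching_at_layers) auto
    show "at_layers 0 1 s \<odot> at_layers 1 3 u = at_layers 0 2 K \<odot> at_layers 2 3 x"
      using at_layers_mul[OF s u, of 0 1 3] at_layers_mul[OF K x, of 0 2 3] eq by simp
    show "\<forall>B\<in>at_layers 2 3 x. B \<subseteq> ?L \<longrightarrow> B \<in> at_layers 1 3 u"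
    proof (intro ballI impI)
      fix C assume "C \<in> at_layers 2 3 x" "C \<subseteq> ?L"
      then obtain B where B: "B \<in> x" "C = layer 2 3 ` B" by blast
      have "B \<subseteq> Upper ` W \<union> Lower ` Z" using B(1) diagrams_Union[OF x] by blast
      then have BL: "B \<subseteq> range Lower" using layer_block_subset(1)[of 2 3 B Z W] B \<open>C \<subseteq> ?L\<close> by simp
      then show "C \<in> at_layers 1 3 u"
        unfolding B(2) layer_lower_block[OF BL, of 2 3 1] using arcs B(1) by blast
    qed
  qed (use fin in auto)
  then obtain a' where a': "matching_on (?U \<union> ?D) a'" "at_layers 0 1 s \<odot> a' = at_layers 0 2 K"
      "a' \<odot> at_layers 2 3 x = at_layers 1 3 u" by (elim exE conjE) (rule that; assumption)
  obtain a where a: "a \<in> diagrams Y W" "at_layers 1 2 a = a'"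
    using at_layers_surj[OF a'(1) fin(2,4)] by auto
  have "s \<bullet> a = K"
    using a'(2) at_layers_mul[OF s a(1), of 0 1 2] at_layers_inject[OF mul_closed[OF s a(1)] K, of 0 2] a(2) by simp
  moreover have "a \<bullet> x = u"
    using a'(3) at_layers_mul[OF a(1) x, of 1 2 3] at_layers_inject[OF mul_closed[OF a(1) x] u, of 1 3] a(2) by simp
  ultimately show ?thesis using a(1) by blast
qed

lemma left_cofactor_lift:
  assumes s: "s \<in> diagrams Y Z" and up: "\<forall>B\<in>s. B \<inter> range Upper \<noteq> {}"
    and u: "u \<in> diagrams X Y" and K: "K \<in> diagrams W Z" and x: "x \<in> diagrams X W"
    and eq: "u \<bullet> s = x \<bullet> K" and arcs: "\<forall>B\<in>x. B \<subseteq> range Upper \<longrightarrow> B \<in> u"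
  shows "\<exists>b \<in> diagrams W Y. b \<bullet> s = K \<and> x \<bullet> b = u"
proof -
  have fin: "finite X" "finite Y" "finite Z" "finite W"
    using diagrams_finite[OF s] diagrams_finite[OF x] by auto
  let ?S = "{2::nat} \<times> Y \<union> {3} \<times> Z" and ?U = "{2::nat} \<times> Y" and ?D = "{1::nat} \<times> W" and ?L = "{0::nat} \<times> X"
  have sd: "sym_diff ?S ?U \<union> ?D = {1} \<times> W \<union> {3} \<times> Z" by auto
  have "\<exists>b. matching_on (?U \<union> ?D) b \<and> at_layers 2 3 s \<odot> b = at_layers 1 3 K \<and>
      b \<odot> at_layers 0 1 x = at_layers 0 2 u"
  proof (rule gluing_lift[where S = ?S and L = ?L])
    show "matching_on ?S (at_layers 2 3 s)" using s by (intro matching_at_layers) auto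
    show "\<forall>B\<in>at_layers 2 3 s. B \<inter> ?U \<noteq> {}"
    proof
      fix B assume "B \<in> at_layers 2 3 s"
      then have "B \<inter> {2} \<times> Y \<noteq> {}" by (rule at_layers_meets_upper[OF s up])
      then show "B \<inter> ?U \<noteq> {}" by blast
    qed
    have "matching_on (?L \<union> ?U) (at_layers 0 2 u)" using u by (intro matching_at_layers) auto
    then show "matching_on (?U \<union> ?L) (at_layers 0 2 u)" by (simp only: Un_commute)
    show "matching_on (sym_diff ?S ?U \<union> ?D) (at_layers 1 3 K)"
      unfolding sd using K by (intro matching_at_layers) auto
    have "matching_on (?L \<union> ?D) (at_layers 0 1 x)" using x by (intro matching_at_layers) auto
    then show "matching_on (?D \<union> ?L) (at_layers 0 1 x)" by (simp only: Un_commute)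
    show "at_layers 2 3 s \<odot> at_layers 0 2 u = at_layers 1 3 K \<odot> at_layers 0 1 x"
      using at_layers_mul[OF u s, of 0 2 3] at_layers_mul[OF x K, of 0 1 3] eq by (simp add: glue_commute)
    show "\<forall>B\<in>at_layers 0 1 x. B \<subseteq> ?L \<longrightarrow> B \<in> at_layers 0 2 u"
    proof (intro ballI impI)
      fix C assume "C \<in> at_layers 0 1 x" "C \<subseteq> ?L"
      then obtain B where B: "B \<in> x" "C = layer 0 1 ` B" by blast
      have "B \<subseteq> Upper ` X \<union> Lower ` W" using B(1) diagrams_Union[OF x] by blast
      then have BU: "B \<subseteq> range Upper" using layer_block_subset(2)[of 0 1 B X W] B \<open>C \<subseteq> ?L\<close> by simp
      then show "C \<in> at_layers 0 2 u"
        unfolding B(2) layer_upper_block[OF BU, of 0 1 2] using arcs B(1) by blast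
    qed
  qed (use fin in auto)
  then obtain b' where b': "matching_on (?U \<union> ?D) b'" "at_layers 2 3 s \<odot> b' = at_layers 1 3 K"
      "b' \<odot> at_layers 0 1 x = at_layers 0 2 u" by (elim exE conjE) (rule that; assumption)
  have "matching_on (?D \<union> ?U) b'" using b'(1) by (simp only: Un_commute)
  then obtain b where b: "b \<in> diagrams W Y" "at_layers 1 2 b = b'"
    using at_layers_surj[of 1 W 2 Y b'] fin by auto
  have "b \<bullet> s = K"
    using b'(2) at_layers_mul[OF b(1) s, of 1 2 3] at_layers_inject[OF mul_closed[OF b(1) s] K, of 1 3] b(2)
    by (simp add: glue_commute)
  moreover have "x \<bullet> b = u"
    using b'(3) at_layers_mul[OF x b(1), of 0 1 2] at_layers_inject[OF mul_closed[OF x b(1)] u, of 0 2] b(2)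
    by (simp add: glue_commute)
  ultimately show ?thesis using b(1) by blast
qed

section \<open>Regularity and generators of the Brauer monoid\<close>

lemma glue_Un_Un:
  assumes M: "matching_on X1 M1" "matching_on X2 M2" and N: "matching_on Y1 N1" "matching_on Y2 N2"
    and fin: "finite X1" "finite X2" "finite Y1" "finite Y2" and disj: "(X1 \<union> Y1) \<inter> (X2 \<union> Y2) = {}"
  shows "(M1 \<union> M2) \<odot> (N1 \<union> N2) = (M1 \<odot> N1) \<union> (M2 \<odot> N2)"
proof -
  have NN: "matching_on (sym_diff Y1 Y2) (N1 \<odot> N2)" using matching_on_glue[OF fin(3) N] .
  have NM: "matching_on (sym_diff Y2 X2) (N2 \<odot> M2)" using matching_on_glue[OF fin(4) N(2) M(2)] .
  have MN: "matching_on (sym_diff X1 Y1) (M1 \<odot> N1)" using matching_on_glue[OF fin(1) M(1) N(1)] .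
  have "(M1 \<union> M2) \<odot> (N1 \<union> N2) = (M1 \<odot> M2) \<odot> (N1 \<odot> N2)"
  proof -
    have "X1 \<inter> X2 = {}" "Y1 \<inter> Y2 = {}" using disj by auto
    then show ?thesis using glue_matching_disjoint[OF M] glue_matching_disjoint[OF N] by simp
  qed
  also have "\<dots> = M1 \<odot> (M2 \<odot> (N1 \<odot> N2))"
    by (rule glue_matching_assoc[OF M NN]) (use disj in blast)
  also have "M2 \<odot> (N1 \<odot> N2) = (N1 \<odot> N2) \<odot> M2" by (rule glue_commute)
  also have "\<dots> = N1 \<odot> (N2 \<odot> M2)"
    by (rule glue_matching_assoc[OF N M(2)]) (use disj in blast)
  also have "M1 \<odot> (N1 \<odot> (N2 \<odot> M2)) = (M1 \<odot> N1) \<odot> (N2 \<odot> M2)"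
    by (rule glue_matching_assoc[OF M(1) N(1) NM, symmetric]) (use disj in blast)
  also have "\<dots> = (M1 \<odot> N1) \<union> (N2 \<odot> M2)"
    by (rule glue_matching_disjoint[OF MN NM]) (use disj in blast)
  finally show ?thesis by (simp add: glue_commute)
qed

lemma layer_inj_on: "i \<noteq> j \<Longrightarrow> inj_on (layer i j) (range Upper \<union> range Lower)"
  by (auto simp: inj_on_def)

text \<open>The case of a single block. Two of the three copies of an arc coincide and cancel, while
  the three copies of a transversal form a path.\<close>

lemma glue_flip_layers_edge:
  assumes "a \<noteq> b" "a \<in> range Upper \<union> range Lower" "b \<in> range Upper \<union> range Lower"
  shows "({{layer 0 1 a, layer 0 1 b}} \<odot> {{layer 2 1 a, layer 2 1 b}}) \<odot> {{layer 2 3 a, layer 2 3 b}}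
    = {{layer 0 3 a, layer 0 3 b}}"
proof -
  have m: "matching_on {u, v} {{u, v}}" if "u \<noteq> v" for u v :: "nat \<times> nat"
    using that by (rule matching_on_doubleton)
  have UU: ?thesis if "a = Upper x" "b = Upper y" for x y
  proof -
    have "{{(0, x), (0, y)}} \<odot> {{(2, x), (2, y)}} \<odot> {{(2, x), (2, y)}} =
        {{(0, x), (0, y)}} \<odot> ({{(2::nat, x), (2, y)}} \<odot> {{(2, x), (2, y)}})"
      by (rule glue_matching_assoc[OF m m m]) (use that assms in auto)
    moreover have "matching_on {(0::nat, x), (0, y)} {{(0, x), (0, y)}}" by (rule m) (use that assms in auto)
    ultimately show ?thesis using that by (simp add: glue_self)
  qed
  have LL: ?thesis if "a = Lower x" "b = Lower y" for x y
  proof -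
    have "matching_on {(3::nat, x), (3, y)} {{(3, x), (3, y)}}" by (rule m) (use that assms in auto)
    then show ?thesis using that by (simp add: glue_self)
  qed
  have UL: "({{(0, x), (1, y)}} \<odot> {{(2, x), (1, y)}}) \<odot> {{(2, x), (3, y)}} = {{(0::nat, x), (3, y :: nat)}}" for x y
    using glue_two_edges[of "(0::nat, x)" "(1, y)" "(2, x)"] glue_two_edges[of "(0::nat, x)" "(2, x)" "(3, y)"]
    by (simp add: insert_commute)
  show ?thesis using assms(2,3) UU LL UL by (auto simp: insert_commute)
qed

text \<open>Copies of different blocks stay disjoint in all layers, so by \<open>glue_Un_Un\<close>
  the blocks can be treated one at a time.\<close>

lemma glue_flip_layers:
  assumes "finite V" "matching_on V x" "V \<subseteq> range Upper \<union> range Lower"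
  shows "(at_layers 0 1 x \<odot> at_layers 2 1 x) \<odot> at_layers 2 3 x = at_layers 0 3 x"
  using assms
proof (induction V x rule: matching_on_induct)
  case empty
  then show ?case by (simp add: glue_self)
next
  case (insert V x a b)
  let ?W = "range Upper \<union> range Lower"
  have V: "V \<subseteq> ?W" "a \<in> ?W" "b \<in> ?W" using insert.prems by auto
  have x: "matching_on (layer i j ` V) (at_layers i j x)" if "i \<noteq> j" for i j
    using layer_inj_on[OF that] V(1) by (intro matching_on_relabel[OF insert.hyps(2)]) (rule inj_on_subset)
  have ab: "matching_on {layer i j a, layer i j b} {{layer i j a, layer i j b}}" if "i \<noteq> j" for i j
    using layer_inj_on[OF that] V insert.hyps(3) by (intro matching_on_doubleton) (auto dest: inj_onD)
  have ins: "at_layers i j (insert {a, b} x) = {{layer i j a, layer i j b}} \<union> at_layers i j x" for i j by simp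
  \<comment> \<open>Two vertices of the same kind with the same image are equal;
    \<open>i \<noteq> l\<close> and \<open>k \<noteq> j\<close> prevent an upper vertex from meeting
    a lower one.\<close>
  have out: "layer i j c \<notin> layer k l ` V" if c: "c \<in> ?W" "c \<notin> V" and "i \<noteq> l" "k \<noteq> j" for i j k l c
  proof
    assume "layer i j c \<in> layer k l ` V"
    then obtain v where v: "v \<in> V" "layer i j c = layer k l v" by blast
    then have "v \<in> ?W" using V(1) by blast
    then have "c = v" using v(2) c(1) that(3,4) by auto
    then show False using v(1) c(2) by simp
  qed
  have o2: "({layer 0 1 a, layer 0 1 b} \<union> {layer 2 1 a, layer 2 1 b} \<union> {layer 2 3 a, layer 2 3 b}) \<inter>
      (layer 0 1 ` V \<union> layer 2 1 ` V \<union> layer 2 3 ` V) = {}"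
    using out[OF V(2) insert.hyps(4)] out[OF V(3) insert.hyps(5)] by simp
  then have o: "({layer 0 1 a, layer 0 1 b} \<union> {layer 2 1 a, layer 2 1 b}) \<inter> (layer 0 1 ` V \<union> layer 2 1 ` V) = {}"
    by blast
  have "at_layers 0 1 (insert {a, b} x) \<odot> at_layers 2 1 (insert {a, b} x) =
      {{layer 0 1 a, layer 0 1 b}} \<odot> {{layer 2 1 a, layer 2 1 b}} \<union> at_layers 0 1 x \<odot> at_layers 2 1 x"
    unfolding ins using insert.hyps(1) o by (intro glue_Un_Un[OF ab x ab x]) auto
  also have "\<dots> \<odot> at_layers 2 3 (insert {a, b} x) =
    {{layer 0 1 a, layer 0 1 b}} \<odot> {{layer 2 1 a, layer 2 1 b}} \<odot> {{layer 2 3 a, layer 2 3 b}} \<union>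
      at_layers 0 1 x \<odot> at_layers 2 1 x \<odot> at_layers 2 3 x"
    unfolding ins
  proof (rule glue_Un_Un)
    show "matching_on (sym_diff {layer 0 1 a, layer 0 1 b} {layer 2 1 a, layer 2 1 b})
        ({{layer 0 1 a, layer 0 1 b}} \<odot> {{layer 2 1 a, layer 2 1 b}})"
      by (rule matching_on_glue[OF _ ab ab]) simp_all
    show "matching_on (sym_diff (layer 0 1 ` V) (layer 2 1 ` V)) (at_layers 0 1 x \<odot> at_layers 2 1 x)"
      by (rule matching_on_glue[OF _ x x]) (use insert.hyps(1) in simp_all)
    show "matching_on {layer 2 3 a, layer 2 3 b} {{layer 2 3 a, layer 2 3 b}}" by (rule ab) simp
    show "matching_on (layer 2 3 ` V) (at_layers 2 3 x)" by (rule x) simp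
    show "(sym_diff {layer 0 1 a, layer 0 1 b} {layer 2 1 a, layer 2 1 b} \<union> {layer 2 3 a, layer 2 3 b}) \<inter>
        (sym_diff (layer 0 1 ` V) (layer 2 1 ` V) \<union> layer 2 3 ` V) = {}"
      using o2 by blast
  qed (use insert.hyps(1) in simp_all)
  also have "\<dots> = at_layers 0 3 (insert {a, b} x)"
    using glue_flip_layers_edge[OF insert.hyps(3) V(2,3)] insert.IH[OF V(1)] by (simp add: ins)
  finally show ?case .
qed

definition flip :: "vertex set set \<Rightarrow> vertex set set" where
  "flip = relabel (case_vertex Lower Mid Upper)"

lemma flip_closed:
  assumes "x \<in> diagrams X Y"
  shows "flip x \<in> diagrams Y X"
proof -
  let ?f = "case_vertex Lower Mid Upper"
  have "matching_on (?f ` (Upper ` X \<union> Lower ` Y)) (flip x)"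
    unfolding flip_def
    by (rule matching_on_relabel[OF diagrams_matching[OF assms]], rule inj_onI) auto
  moreover have "?f ` (Upper ` X \<union> Lower ` Y) = Upper ` Y \<union> Lower ` X"
    unfolding image_Un image_image by auto
  ultimately show ?thesis using diagrams_finite[OF assms] by (simp add: diagrams_def)
qed

lemma at_layers_flip:
  assumes "x \<in> diagrams X Y"
  shows "at_layers i j (flip x) = at_layers j i x"
  unfolding flip_def relabel_comp by (rule relabel_cong) (auto simp: diagrams_Union[OF assms])

lemma mul_flip_mul:
  assumes x: "x \<in> diagrams X Y"
  shows "(x \<bullet> flip x) \<bullet> x = x"
proof -
  have "at_layers 0 3 ((x \<bullet> flip x) \<bullet> x) = (at_layers 0 1 x \<odot> at_layers 2 1 x) \<odot> at_layers 2 3 x"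
    using at_layers_mul[OF mul_closed[OF x flip_closed[OF x]] x, of 0 2 3]
      at_layers_mul[OF x flip_closed[OF x], of 0 1 2] at_layers_flip[OF x] by simp
  also have "\<dots> = at_layers 0 3 x"
    by (rule glue_flip_layers[OF _ diagrams_matching[OF x]]) (use diagrams_finite[OF x] in auto)
  finally show ?thesis
    using at_layers_inject[OF mul_closed[OF mul_closed[OF x flip_closed[OF x]] x] x, of 0 3] by simp
qed

section \<open>Permutation diagrams and arcs\<close>

lemma matching_on_subset_eq:
  assumes M: "matching_on X M" and N: "matching_on X N" and sub: "M \<subseteq> N"
  shows "M = N"
proof
  show "N \<subseteq> M"
  proof
    fix B assume B: "B \<in> N"
    obtain a b where ab: "B = {a, b}" "a \<noteq> b" "a \<in> X" by (rule matching_on_blockE[OF N B])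
    then obtain C where C: "C \<in> M" "a \<in> C" using matching_on_Union[OF M] by blast
    then have "C = B" using matching_on_block_unique[OF N] sub B ab by blast
    then show "B \<in> M" using C by simp
  qed
qed fact

text \<open>Diagrams are multiplied from top to bottom, so the left factor acts first.\<close>

lemma graph_diagram_mul:
  assumes "finite X" "bij_betw f X Y" "bij_betw g Y Z"
  shows "graph_diagram f X \<bullet> graph_diagram g Y = graph_diagram (g \<circ> f) X"
  unfolding mul_graph_diagram_right[OF graph_diagram_closed[OF assms(1,2)] assms(3)]
  by (simp add: graph_diagram_def image_image)

lemma permutation_diagram_closed: "finite R \<Longrightarrow> p permutes R \<Longrightarrow> graph_diagram p R \<in> diagrams R R"
  by (intro graph_diagram_closed permutes_imp_bij)

text \<open>Without upper arcs every upper point is joined to a lower one, injectively and hence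
  bijectively on the finite set \<open>R\<close>. These edges already form a perfect matching and
  thus are all of \<open>x\<close>.\<close>

lemma permutation_diagram_iff:
  assumes x: "x \<in> diagrams R R"
  shows "(\<exists>p. p permutes R \<and> x = graph_diagram p R) \<longleftrightarrow> (\<forall>B\<in>x. \<not> B \<subseteq> range Upper)"
proof
  assume "\<exists>p. p permutes R \<and> x = graph_diagram p R"
  then show "\<forall>B\<in>x. \<not> B \<subseteq> range Upper" by (auto simp: graph_diagram_def)
next
  assume *: "\<forall>B\<in>x. \<not> B \<subseteq> range Upper"
  have xm: "matching_on (Upper ` R \<union> Lower ` R) x" and fin: "finite R"
    using diagrams_matching[OF x] diagrams_finite[OF x] by auto
  have "\<exists>j\<in>R. {Upper i, Lower j} \<in> x" if "i \<in> R" for i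
  proof -
    have "Upper i \<in> Upper ` R \<union> Lower ` R" using that by simp
    then obtain v where v: "{Upper i, v} \<in> x" "v \<in> Upper ` R \<union> Lower ` R" by (rule matching_on_partner[OF xm])
    have "v \<notin> range Upper" using * v(1) by auto
    then show ?thesis using v by auto
  qed
  then obtain f where f: "\<And>i. i \<in> R \<Longrightarrow> f i \<in> R" "\<And>i. i \<in> R \<Longrightarrow> {Upper i, Lower (f i)} \<in> x" by metis
  have inj: "inj_on f R"
  proof (rule inj_onI)
    fix i j assume "i \<in> R" "j \<in> R" "f i = f j"
    then have "{Lower (f i), Upper i} \<in> x" "{Lower (f i), Upper j} \<in> x" using f(2) by (metis insert_commute)+
    then show "i = j" using matching_on_partner_unique[OF xm] by blast
  qed
  define p where "p i = (if i \<in> R then f i else i)" for i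
  have "f ` R = R" using f(1) by (intro endo_inj_surj[OF fin _ inj]) auto
  then have "bij_betw p R R" using inj by (simp add: bij_betw_def inj_on_def p_def)
  then have p: "p permutes R" by (rule bij_imp_permutes) (simp add: p_def)
  have "graph_diagram p R \<subseteq> x" using f(2) by (auto simp: graph_diagram_def p_def)
  then have "graph_diagram p R = x"
    using matching_on_subset_eq[OF diagrams_matching[OF permutation_diagram_closed[OF fin p]] xm] by blast
  then show "\<exists>p. p permutes R \<and> x = graph_diagram p R" using p by blast
qed

text \<open>If \<open>x\<close> had no lower arc, \<open>flip x\<close> would have no upper one and
  would be a permutation diagram; then \<open>x\<close> could not have an upper arc either.\<close>

lemma upper_arc_imp_lower_arc:
  assumes x: "x \<in> diagrams R R" and B: "B \<in> x" "B \<subseteq> range Upper"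
  shows "\<exists>C\<in>x. C \<subseteq> range Lower"
proof (rule ccontr)
  assume *: "\<not> (\<exists>C\<in>x. C \<subseteq> range Lower)"
  let ?f = "case_vertex Lower Mid Upper"
  have "\<not> ?f ` C \<subseteq> range Upper" if C: "C \<in> x" for C
  proof
    assume sub: "?f ` C \<subseteq> range Upper"
    have "C \<subseteq> range Lower"
    proof
      fix v assume "v \<in> C"
      then have "?f v \<in> range Upper" using sub by blast
      then show "v \<in> range Lower" by (cases v) auto
    qed
    then show False using * C by blast
  qed
  then have "\<forall>B\<in>flip x. \<not> B \<subseteq> range Upper" by (auto simp: flip_def)
  then obtain p where "flip x = graph_diagram p R" using permutation_diagram_iff[OF flip_closed[OF x]] by blast
  moreover have "?f ` B \<in> flip x" using B by (simp add: flip_def)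
  ultimately obtain i where "Upper i \<in> ?f ` B" by (auto simp: graph_diagram_def)
  then show False using B(2) by auto
qed

text \<open>For distinct \<open>i\<close> and \<open>j\<close> in \<open>R\<close> this is a diagram
  of rank \<open>card R - 2\<close>; for neighbouring points it is a generator of the Temperley-Lieb
  monoid.\<close>

definition hook :: "nat set \<Rightarrow> nat \<Rightarrow> nat \<Rightarrow> vertex set set" where
  "hook R i j = insert {Upper i, Upper j} (insert {Lower i, Lower j} (id_diagram (R - {i, j})))"

lemma hook_closed:
  assumes "finite R" "i \<in> R" "j \<in> R" "i \<noteq> j"
  shows "hook R i j \<in> diagrams R R"
proof -
  let ?Q = "R - {i, j}"
  have Q: "matching_on (Upper ` ?Q \<union> Lower ` ?Q) (id_diagram ?Q)"
    using assms by (intro diagrams_matching id_diagram_closed) auto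
  have L: "matching_on (insert (Lower i) (insert (Lower j) (Upper ` ?Q \<union> Lower ` ?Q))) (insert {Lower i, Lower j} (id_diagram ?Q))"
    using assms by (intro matching_on_insert[OF Q]) auto
  have "matching_on (insert (Upper i) (insert (Upper j) (insert (Lower i) (insert (Lower j) (Upper ` ?Q \<union> Lower ` ?Q))))) (hook R i j)"
    unfolding hook_def using assms by (intro matching_on_insert[OF L]) auto
  moreover have "insert (Upper i) (insert (Upper j) (insert (Lower i) (insert (Lower j) (Upper ` ?Q \<union> Lower ` ?Q)))) = Upper ` R \<union> Lower ` R"
    using assms by auto
  ultimately show ?thesis using assms by (simp add: diagrams_def)
qed

text \<open>In \<open>y\<close> an upper and a lower arc of \<open>x\<close> are replaced by two
  transversals. The lower arc of the hook joins them again to the lower arc, and the upper arc of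
  the hook is the one that was removed. As \<open>y\<close> has fewer upper arcs, this drives the
  induction in \<open>diagrams_generated\<close>.\<close>

lemma hook_factor:
  assumes x: "x \<in> diagrams R R" and up: "{Upper i, Upper j} \<in> x" and low: "{Lower k, Lower l} \<in> x"
  defines "y \<equiv> insert {Upper i, Lower k} (insert {Upper j, Lower l} (x - {{Upper i, Upper j}, {Lower k, Lower l}}))"
  shows "y \<in> diagrams R R" and "hook R i j \<bullet> y = x"
proof -
  have xm: "matching_on (Upper ` R \<union> Lower ` R) x" and fin: "finite R"
    using diagrams_matching[OF x] diagrams_finite[OF x] by auto
  have ij: "i \<in> R" "j \<in> R" "i \<noteq> j" using matching_on_edge[OF xm up] by auto
  have kl: "k \<in> R" "l \<in> R" "k \<noteq> l" using matching_on_edge[OF xm low] by auto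
  let ?x0 = "x - {{Upper i, Upper j}, {Lower k, Lower l}}"
  let ?X0 = "Upper ` (R - {i, j}) \<union> Lower ` (R - {k, l})"
  have "matching_on ((Upper ` R \<union> Lower ` R) - \<Union>{{Upper i, Upper j}, {Lower k, Lower l}}) ?x0"
    by (rule matching_on_Diff[OF xm]) (use up low in auto)
  moreover have "(Upper ` R \<union> Lower ` R) - \<Union>{{Upper i, Upper j}, {Lower k, Lower l}} = ?X0" by auto
  ultimately have x0: "matching_on ?X0 ?x0" by (simp only:)
  have y1: "matching_on (insert (Upper j) (insert (Lower l) ?X0)) (insert {Upper j, Lower l} ?x0)"
    using ij kl by (intro matching_on_insert[OF x0]) auto
  have "matching_on (insert (Upper i) (insert (Lower k) (insert (Upper j) (insert (Lower l) ?X0)))) y"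
    unfolding y_def using ij kl by (intro matching_on_insert[OF y1]) auto
  moreover have "insert (Upper i) (insert (Lower k) (insert (Upper j) (insert (Lower l) ?X0))) = Upper ` R \<union> Lower ` R"
    using ij kl by auto
  ultimately show y: "y \<in> diagrams R R" using fin by (simp add: diagrams_def)
  let ?Q = "R - {i, j}"
  let ?D = "{0::nat} \<times> ?Q \<union> {1} \<times> ?Q"
  have Q: "id_diagram ?Q \<in> diagrams ?Q ?Q" using fin by (intro id_diagram_closed) auto
  have D: "matching_on ?D (at_layers 0 1 (id_diagram ?Q))" using Q by (intro matching_at_layers) auto
  have D1: "matching_on (insert (1, i) (insert (1, j) ?D)) (insert {(1, i), (1, j)} (at_layers 0 1 (id_diagram ?Q)))"
    using ij by (intro matching_on_insert[OF D]) auto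
  have ym: "matching_on ({1} \<times> R \<union> {2} \<times> R) (at_layers 1 2 y)" using y by (intro matching_at_layers) auto
  have "at_layers 0 2 (hook R i j \<bullet> y) = at_layers 0 1 (hook R i j) \<odot> at_layers 1 2 y"
    by (rule at_layers_mul[OF hook_closed[OF fin ij] y]) auto
  also have "at_layers 0 1 (hook R i j) = insert {(0, i), (0, j)} (insert {(1, i), (1, j)} (at_layers 0 1 (id_diagram ?Q)))"
    by (simp add: hook_def)
  \<comment> \<open>The hook is taken apart: its upper arc stays outside, its lower arc acts on
    \<open>y\<close>, and the rest is an identity on \<open>?Q\<close>.\<close>
  also have "\<dots> \<odot> at_layers 1 2 y = {{(0, i), (0, j)}} \<odot> (insert {(1, i), (1, j)} (at_layers 0 1 (id_diagram ?Q)) \<odot> at_layers 1 2 y)"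
    using ij by (intro glue_insert_edge(1)[OF D1 _ _ _ ym]) auto
  also have "insert {(1, i), (1, j)} (at_layers 0 1 (id_diagram ?Q)) \<odot> at_layers 1 2 y =
      at_layers 0 1 (id_diagram ?Q) \<odot> ({{(1, i), (1, j)}} \<odot> at_layers 1 2 y)"
    using ij by (intro glue_insert_edge(2)[OF D _ _ _ ym]) auto
  also have "{{(1, i), (1, j)}} \<odot> at_layers 1 2 y = at_layers 1 2 (insert {Lower k, Lower l} ?x0)"
  proof -
    have yy: "at_layers 1 2 y = insert {(1, i), (2, k)} (insert {(1, j), (2, l)} (at_layers 1 2 ?x0))"
      by (simp add: y_def)
    have "{{(1, i), (1, j)}} \<odot> at_layers 1 2 y =
        insert {(2, k), (2, l)} (at_layers 1 2 y - {{(1, i), (2, k)}, {(1, j), (2, l)}})"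
    proof (rule glue_edge_join[OF ym])
      show "{(1, i), (2, k)} \<in> at_layers 1 2 y" "{(1, j), (2, l)} \<in> at_layers 1 2 y"
        unfolding yy by blast+
    qed (use ij in auto)
    also have "at_layers 1 2 y - {{(1, i), (2, k)}, {(1, j), (2, l)}} = at_layers 1 2 ?x0"
    proof -
      have "(1, i) \<notin> \<Union>(at_layers 1 2 ?x0)" "(1, j) \<notin> \<Union>(at_layers 1 2 ?x0)"
        unfolding image_Union[symmetric] matching_on_Union[OF x0] by auto
      then show ?thesis unfolding yy by blast
    qed
    finally show ?thesis by simp
  qed
  also have "at_layers 0 1 (id_diagram ?Q) \<odot> at_layers 1 2 (insert {Lower k, Lower l} ?x0) =
      at_layers 0 2 (insert {Lower k, Lower l} ?x0)"
  proof -
    have "matching_on (insert (Lower k) (insert (Lower l) ?X0)) (insert {Lower k, Lower l} ?x0)"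
      using kl by (intro matching_on_insert[OF x0]) auto
    moreover have "insert (Lower k) (insert (Lower l) ?X0) = Upper ` ?Q \<union> Lower ` R" using kl by auto
    ultimately have z: "insert {Lower k, Lower l} ?x0 \<in> diagrams ?Q R" using fin by (simp add: diagrams_def)
    then show ?thesis using at_layers_mul[OF Q z, of 0 1 2] by simp
  qed
  also have "{{(0, i), (0, j)}} \<odot> at_layers 0 2 (insert {Lower k, Lower l} ?x0) =
      insert {(0, i), (0, j)} (at_layers 0 2 (insert {Lower k, Lower l} ?x0))"
  proof -
    have "matching_on (insert (Lower k) (insert (Lower l) ?X0)) (insert {Lower k, Lower l} ?x0)"
      using kl by (intro matching_on_insert[OF x0]) auto
    moreover have "insert (Lower k) (insert (Lower l) ?X0) = Upper ` ?Q \<union> Lower ` R" using kl by auto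
    ultimately have z: "insert {Lower k, Lower l} ?x0 \<in> diagrams ?Q R" using fin by (simp add: diagrams_def)
    show ?thesis using ij by (intro glue_edge_fresh[OF matching_at_layers[OF z]]) auto
  qed
  also have "\<dots> = at_layers 0 2 x"
  proof -
    have "x = insert {Upper i, Upper j} (insert {Lower k, Lower l} ?x0)" using up low by auto
    then have "at_layers 0 2 x = at_layers 0 2 (insert {Upper i, Upper j} (insert {Lower k, Lower l} ?x0))" by (rule arg_cong)
    then show ?thesis by simp
  qed
  finally show "hook R i j \<bullet> y = x"
    using at_layers_inject[OF mul_closed[OF hook_closed[OF fin ij] y] x, of 0 2] by simp
qed

text \<open>Hooks are conjugate under permutations, so one of them suffices as a generator.\<close>

lemma hook_conjugate:
  assumes fin: "finite R" and p: "p permutes R" and ij: "i \<in> R" "j \<in> R" "i \<noteq> j"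
  shows "graph_diagram p R \<bullet> hook R (p i) (p j) \<bullet> graph_diagram (inv p) R = hook R i j"
proof -
  have pij: "p i \<in> R" "p j \<in> R" "p i \<noteq> p j"
    using ij permutes_in_image[OF p] permutes_inj[OF p] by (auto dest: injD)
  have h: "hook R (p i) (p j) \<in> diagrams R R" using hook_closed[OF fin pij] .
  have ip: "inv p (p x) = x" for x using permutes_inverses(2)[OF p] .
  have 1: "graph_diagram p R \<bullet> hook R (p i) (p j) =
      relabel (case_vertex (\<lambda>y. Upper (inv p y)) Mid Lower) (hook R (p i) (p j))"
    by (rule mul_graph_diagram_left[OF h permutes_imp_bij[OF p] ip])
  have g: "graph_diagram p R \<bullet> hook R (p i) (p j) \<in> diagrams R R"
    using mul_closed[OF permutation_diagram_closed[OF fin p] h] .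
  have 2: "graph_diagram p R \<bullet> hook R (p i) (p j) \<bullet> graph_diagram (inv p) R =
      relabel (case_vertex Upper Mid (\<lambda>y. Lower (inv p y))) (graph_diagram p R \<bullet> hook R (p i) (p j))"
    by (rule mul_graph_diagram_right[OF g permutes_imp_bij[OF permutes_inv[OF p]]])
  have Q: "R - {p i, p j} = p ` (R - {i, j})"
    using permutes_image[OF p] permutes_inj[OF p] by (auto dest: injD)
  show ?thesis unfolding 2 unfolding 1 unfolding hook_def Q
    by (simp add: graph_diagram_def image_image ip)
qed

lemma generated_closed:
  assumes "A \<subseteq> T" "\<And>x y. x \<in> T \<Longrightarrow> y \<in> T \<Longrightarrow> f x y \<in> T"
  shows "generated f A \<subseteq> T"
proof
  fix x assume "x \<in> generated f A"
  then show "x \<in> T" by induction (use assms in auto)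
qed

text \<open>The star of transpositions at \<open>c\<close> yields all others, because the
  transposition of \<open>a\<close> and \<open>b\<close> is the conjugate of the one of
  \<open>c\<close> and \<open>b\<close> by the one of \<open>c\<close> and \<open>a\<close>.\<close>

lemma permutation_diagrams_generated:
  assumes fin: "finite R" and c: "c \<in> R" and p: "p permutes R"
  shows "graph_diagram p R \<in> generated (\<bullet>) ((\<lambda>j. graph_diagram (transpose c j) R) ` R)" (is "_ \<in> ?G")
proof -
  have comp: "graph_diagram (g \<circ> f) R \<in> ?G" if "f permutes R" "g permutes R" "graph_diagram f R \<in> ?G" "graph_diagram g R \<in> ?G" for f g
    using generated.mult[OF that(3,4)] graph_diagram_mul[OF fin permutes_imp_bij[OF that(1)] permutes_imp_bij[OF that(2)]]
    by simp
  have star: "graph_diagram (transpose c j) R \<in> ?G" if "j \<in> R" for j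
    using that by (intro generated.base) auto
  \<comment> \<open>\<open>transpose c c\<close> is the identity, so the star contains it.\<close>
  have idG: "graph_diagram id R \<in> ?G" using star[OF c] by (simp add: id_def)
  have tr: "graph_diagram (transpose a b) R \<in> ?G" if "a \<in> R" "b \<in> R" for a b
  proof (cases "a = b \<or> a = c \<or> b = c")
    case True
    then show ?thesis using star that idG by (auto simp: transpose_commute id_def)
  next
    case False
    have ca: "transpose c a permutes R" "transpose c b permutes R"
      using c that by (auto intro: permutes_swap_id)
    have "transpose a b = transpose c a \<circ> (transpose c b \<circ> transpose c a)"
      using False by (auto simp: fun_eq_iff transpose_def)
    moreover have "graph_diagram (transpose c a \<circ> (transpose c b \<circ> transpose c a)) R \<in> ?G"
      using ca star that by (intro comp permutes_compose) auto
    ultimately show ?thesis by simp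
  qed
  from p fin show ?thesis
  proof (induction rule: permutes_induct)
    case id
    show ?case by (rule idG)
  next
    case (swap a b p)
    show ?case
    proof (rule comp)
      show "p permutes R" "graph_diagram p R \<in> ?G" by fact+
      show "transpose a b permutes R" using swap.hyps by (auto intro: permutes_swap_id)
      show "graph_diagram (transpose a b) R \<in> ?G" using swap.hyps by (intro tr)
    qed
  qed
qed

lemma permutation_mapping_pair:
  assumes "i \<in> R" "j \<in> R" "i \<noteq> j" "a \<in> R" "b \<in> R" "a \<noteq> b"
  obtains p where "p permutes R" "p i = a" "p j = b"
proof -
  \<comment> \<open>First \<open>i\<close> is moved to \<open>a\<close>, then the image of
    \<open>j\<close> to \<open>b\<close>; both differ from \<open>a\<close>, which therefore stays
    in place.\<close>
  let ?t = "transpose i a"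
  have "transpose (?t j) b \<circ> ?t permutes R"
    using assms by (intro permutes_compose permutes_swap_id) (auto simp: transpose_def)
  moreover have "(transpose (?t j) b \<circ> ?t) i = a" using assms by (auto simp: transpose_def)
  moreover have "(transpose (?t j) b \<circ> ?t) j = b" by simp
  ultimately show thesis using that by blast
qed

text \<open>Induction on the number of upper arcs: with none, \<open>x\<close> is a permutation
  diagram; otherwise \<open>hook_factor\<close> splits off a hook, and this is conjugate to
  \<open>hook R a b\<close>.\<close>

lemma diagrams_generated:
  assumes fin: "finite R" and ab: "a \<in> R" "b \<in> R" "a \<noteq> b"
    and perm: "\<And>p. p permutes R \<Longrightarrow> graph_diagram p R \<in> generated (\<bullet>) G"
    and h: "hook R a b \<in> generated (\<bullet>) G" and x: "x \<in> diagrams R R"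
  shows "x \<in> generated (\<bullet>) G"
  using x
proof (induction "card {B\<in>x. B \<subseteq> range Upper}" arbitrary: x rule: less_induct)
  case less
  have xm: "matching_on (Upper ` R \<union> Lower ` R) x" using less.prems by (rule diagrams_matching)
  show ?case
  proof (cases "\<forall>B\<in>x. \<not> B \<subseteq> range Upper")
    case True
    then show ?thesis using permutation_diagram_iff[OF less.prems] perm by blast
  next
    case False
    then obtain B where B: "B \<in> x" "B \<subseteq> range Upper" by blast
    then obtain C where C: "C \<in> x" "C \<subseteq> range Lower" using upper_arc_imp_lower_arc[OF less.prems] by blast
    obtain u v where "B = {u, v}" "u \<noteq> v" "u \<in> Upper ` R \<union> Lower ` R" "v \<in> Upper ` R \<union> Lower ` R"
      by (rule matching_on_blockE[OF xm B(1)])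
    then obtain i j where ij: "B = {Upper i, Upper j}" "i \<in> R" "j \<in> R" "i \<noteq> j" using B(2) by auto
    obtain u v where "C = {u, v}" "u \<noteq> v" "u \<in> Upper ` R \<union> Lower ` R" "v \<in> Upper ` R \<union> Lower ` R"
      by (rule matching_on_blockE[OF xm C(1)])
    then obtain k l where kl: "C = {Lower k, Lower l}" using C(2) by auto
    define y where "y = insert {Upper i, Lower k} (insert {Upper j, Lower l} (x - {{Upper i, Upper j}, {Lower k, Lower l}}))"
    have y: "y \<in> diagrams R R" "hook R i j \<bullet> y = x"
      using hook_factor[OF less.prems, of i j k l] B C ij kl by (simp_all add: y_def)
    have "{B\<in>y. B \<subseteq> range Upper} \<subseteq> {B\<in>x. B \<subseteq> range Upper} - {B}"
      unfolding y_def ij(1) by auto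
    also have "\<dots> \<subset> {B\<in>x. B \<subseteq> range Upper}" using B by blast
    finally have "card {B\<in>y. B \<subseteq> range Upper} < card {B\<in>x. B \<subseteq> range Upper}"
      using finite_matching_on[OF xm] fin by (intro psubset_card_mono) auto
    then have yG: "y \<in> generated (\<bullet>) G" using y(1) by (rule less.hyps)
    obtain p where p: "p permutes R" "p i = a" "p j = b" by (rule permutation_mapping_pair[OF ij(2-4) ab])
    have "graph_diagram p R \<bullet> hook R (p i) (p j) \<bullet> graph_diagram (inv p) R \<in> generated (\<bullet>) G"
      unfolding p(2,3) by (intro generated.mult h perm p(1) permutes_inv)
    then have "hook R i j \<in> generated (\<bullet>) G" unfolding hook_conjugate[OF fin p(1) ij(2-4)] .
    then show ?thesis using generated.mult[OF _ yG, of "hook R i j"] y(2) by simp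
  qed
qed

section \<open>Ranks of rectangular extensions\<close>

lemma semigroup_rank_eqI:
  assumes "A \<subseteq> T" "finite A" "card A = k" "generated f A = T"
    and "\<And>B. B \<subseteq> T \<Longrightarrow> finite B \<Longrightarrow> generated f B = T \<Longrightarrow> k \<le> card B"
  shows "semigroup_rank T f = k"
  unfolding semigroup_rank_def using assms by (intro Least_equality) blast+

text \<open>An abstract form of the triples \<open>a\<close>, \<open>x\<close>, \<open>b\<close>:
  the outer entries multiply as in a rectangular band, the middle ones in \<open>M\<close>. The map
  \<open>\<phi>\<close> need not be injective; a left entry is recoverable only over the group of
  units \<open>U\<close>, whose complement is a right ideal by \<open>U_left\<close>. The axioms
  treat \<open>A\<close> and \<open>B\<close> differently because the lower bound on generators
  counts left entries.\<close>

locale rectangular_extension =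
  fixes T :: "'t set" and f :: "'t \<Rightarrow> 't \<Rightarrow> 't"
    and M :: "'m set" and times :: "'m \<Rightarrow> 'm \<Rightarrow> 'm"  (infixl "\<cdot>" 70) and e :: 'm and U :: "'m set"
    and A :: "'a set" and B :: "'b set" and \<phi> :: "'a \<Rightarrow> 'm \<Rightarrow> 'b \<Rightarrow> 't"
  assumes T_eq: "T = {\<phi> a x b | a x b. a \<in> A \<and> x \<in> M \<and> b \<in> B}"
    and f_\<phi>: "a \<in> A \<Longrightarrow> x \<in> M \<Longrightarrow> b \<in> B \<Longrightarrow> a' \<in> A \<Longrightarrow> y \<in> M \<Longrightarrow> b' \<in> B \<Longrightarrow>
      f (\<phi> a x b) (\<phi> a' y b') = \<phi> a (x \<cdot> y) b'"
    and \<phi>_middle: "a \<in> A \<Longrightarrow> x \<in> M \<Longrightarrow> b \<in> B \<Longrightarrow> a' \<in> A \<Longrightarrow> y \<in> M \<Longrightarrow> b' \<in> B \<Longrightarrow>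
      \<phi> a x b = \<phi> a' y b' \<Longrightarrow> x = y"
    and \<phi>_left: "a \<in> A \<Longrightarrow> x \<in> U \<Longrightarrow> b \<in> B \<Longrightarrow> a' \<in> A \<Longrightarrow> b' \<in> B \<Longrightarrow>
      \<phi> a x b = \<phi> a' x b' \<Longrightarrow> a = a'"
    and closed: "x \<in> M \<Longrightarrow> y \<in> M \<Longrightarrow> x \<cdot> y \<in> M"
    and assoc: "x \<in> M \<Longrightarrow> y \<in> M \<Longrightarrow> z \<in> M \<Longrightarrow> (x \<cdot> y) \<cdot> z = x \<cdot> (y \<cdot> z)"
    and unit: "x \<in> M \<Longrightarrow> e \<cdot> x = x" "x \<in> M \<Longrightarrow> x \<cdot> e = x"
    and U: "U \<subseteq> M" "e \<in> U" "x \<in> U \<Longrightarrow> y \<in> U \<Longrightarrow> x \<cdot> y \<in> U"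
    and U_inverse: "x \<in> U \<Longrightarrow> \<exists>y\<in>U. x \<cdot> y = e \<and> y \<cdot> x = e"
    and U_left: "x \<in> M \<Longrightarrow> y \<in> M \<Longrightarrow> x \<cdot> y \<in> U \<Longrightarrow> x \<in> U"
begin

lemma TE:
  assumes "t \<in> T"
  obtains a x b where "t = \<phi> a x b" "a \<in> A" "x \<in> M" "b \<in> B"
  using assms unfolding T_eq by blast

lemma TI: "a \<in> A \<Longrightarrow> x \<in> M \<Longrightarrow> b \<in> B \<Longrightarrow> \<phi> a x b \<in> T"
  unfolding T_eq by blast

text \<open>A product has the left entry of its first factor, and by \<open>U_left\<close> its
  middle entry is in \<open>U\<close> only if that of the first factor is. So each left entry needs
  a generator of its own with middle entry in \<open>U\<close>. These alone never leave
  \<open>U\<close>, which costs one more generator if \<open>U\<close> is proper.\<close>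

lemma generators_lower_bound:
  assumes G: "G \<subseteq> T" "finite G" and gen: "generated f G = T" and A: "A \<noteq> {}" and B: "B \<noteq> {}"
  shows "card A + (if U = M then 0 else 1) \<le> card G"
proof -
  obtain b0 where b0: "b0 \<in> B" using B by blast
  define V where "V = {g \<in> G. \<exists>a\<in>A. \<exists>x\<in>U. \<exists>b\<in>B. g = \<phi> a x b}"
  \<comment> \<open>The witnesses \<open>x'\<close> and \<open>b'\<close> belong to the first
    generator in a word for \<open>t\<close>.\<close>
  have first: "\<exists>a\<in>A. \<exists>x\<in>M. \<exists>b\<in>B. \<exists>x'\<in>M. \<exists>b'\<in>B. t = \<phi> a x b \<and> \<phi> a x' b' \<in> G \<and> (x \<in> U \<longrightarrow> x' \<in> U)"
    if "t \<in> generated f G" for t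
    using that
  proof induction
    case (base t)
    then obtain a x b where "t = \<phi> a x b" "a \<in> A" "x \<in> M" "b \<in> B" using G(1) TE by blast
    then show ?case using base by blast
  next
    case (mult s t)
    from mult.IH(1) obtain a x b x' b' where s: "a \<in> A" "x \<in> M" "b \<in> B" "x' \<in> M" "b' \<in> B"
      "s = \<phi> a x b" "\<phi> a x' b' \<in> G" "x \<in> U \<longrightarrow> x' \<in> U" by (elim bexE conjE)
    from mult.IH(2) obtain c y d where t: "c \<in> A" "y \<in> M" "d \<in> B" "t = \<phi> c y d" by (elim bexE conjE)
    have "f s t = \<phi> a (x \<cdot> y) d" using s t f_\<phi> by simp
    moreover have "x \<cdot> y \<in> U \<longrightarrow> x' \<in> U" using s(8) U_left[OF s(2) t(2)] by blast
    ultimately show ?case using s t closed by blast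
  qed
  have "\<exists>g\<in>V. \<exists>x\<in>U. \<exists>b\<in>B. g = \<phi> a x b" if a: "a \<in> A" for a
  proof -
    have "\<phi> a e b0 \<in> generated f G" unfolding gen using a b0 U by (intro TI) auto
    from first[OF this] obtain c x b x' b' where c: "c \<in> A" "x \<in> M" "b \<in> B" "x' \<in> M" "b' \<in> B"
      "\<phi> a e b0 = \<phi> c x b" "\<phi> c x' b' \<in> G" "x \<in> U \<longrightarrow> x' \<in> U" by (elim bexE conjE)
    \<comment> \<open>The middle entry is determined by the element, and over the unit so is the
      left entry.\<close>
    have x: "x = e" using \<phi>_middle[OF a _ b0 c(1,2,3,6)] U by auto
    then have "c = a" using \<phi>_left[OF a _ b0 c(1,3)] c(6) U by auto
    moreover have "x' \<in> U" using c(8) x U by simp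
    ultimately show ?thesis unfolding V_def using c(1,5,7) by blast
  qed
  then obtain g where g: "\<And>a. a \<in> A \<Longrightarrow> g a \<in> V" "\<And>a. a \<in> A \<Longrightarrow> \<exists>x\<in>U. \<exists>b\<in>B. g a = \<phi> a x b" by metis
  have "inj_on g A"
  proof (rule inj_onI)
    fix a c assume ac: "a \<in> A" "c \<in> A" "g a = g c"
    then obtain x b y d where "x \<in> U" "b \<in> B" "y \<in> U" "d \<in> B" "\<phi> a x b = \<phi> c y d" using g(2) by metis
    then show "a = c" using \<phi>_middle[of a x b c y d] \<phi>_left[of a x b c d] ac U(1) by blast
  qed
  moreover have "g ` A \<subseteq> V" using g(1) by blast
  moreover have VG: "V \<subseteq> G" "finite V" using G(2) by (auto simp: V_def)
  ultimately have AV: "card A \<le> card V" by (metis card_inj_on_le)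
  show ?thesis
  proof (cases "U = M")
    case True
    then show ?thesis using AV card_mono[OF G(2) VG(1)] by simp
  next
    case False
    then obtain h where h: "h \<in> M" "h \<notin> U" using U(1) by blast
    have "V \<noteq> G"
    proof
      assume V: "V = G"
      have all: "\<exists>a\<in>A. \<exists>x\<in>U. \<exists>b\<in>B. t = \<phi> a x b" if "t \<in> generated f G" for t
        using that
      proof induction
        case (base t)
        then show ?case using V unfolding V_def by blast
      next
        case (mult s t)
        then obtain a x b c y d where "a \<in> A" "x \<in> U" "b \<in> B" "s = \<phi> a x b"
          "c \<in> A" "y \<in> U" "d \<in> B" "t = \<phi> c y d" by (elim bexE)
        moreover from this have "f s t = \<phi> a (x \<cdot> y) d" using f_\<phi> U(1) by blast
        ultimately show ?case using U(3) by blast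
      qed
      obtain a0 where a0: "a0 \<in> A" using A by blast
      have "\<phi> a0 h b0 \<in> generated f G" unfolding gen using TI a0 h b0 by blast
      then obtain a x b where a: "a \<in> A" "x \<in> U" "b \<in> B" "\<phi> a0 h b0 = \<phi> a x b" using all by blast
      have "h = x" by (rule \<phi>_middle[OF a0 h(1) b0 a(1) _ a(3,4)]) (use a(2) U(1) in blast)
      then show False using a(2) h(2) by simp
    qed
    then have "card V < card G" using VG G(2) by (intro psubset_card_mono) auto
    then show ?thesis using AV False by simp
  qed
qed

text \<open>The three entries of the generators can be chosen independently: the left ones run
  through \<open>A\<close>, the right ones through \<open>B\<close> by means of
  \<open>\<beta>\<close>, and the middle ones, given by \<open>\<xi>\<close> and \<open>W\<close>,
  generate \<open>M\<close>.\<close>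

lemma semigroup_rank_eq:
  assumes A: "finite A" "A \<noteq> {}" and \<xi>: "\<xi> ` A \<subseteq> U" and \<beta>: "\<beta> ` A = B"
    and W: "W \<subseteq> M" "finite W" "card W = (if U = M then 0 else 1)"
    and M: "M \<subseteq> generated (\<cdot>) (\<xi> ` A \<union> W)"
  shows "semigroup_rank T f = card A + (if U = M then 0 else 1)"
proof -
  obtain a0 where a0: "a0 \<in> A" using A by blast
  then have B: "\<beta> a0 \<in> B" "B \<noteq> {}" using \<beta> by blast+
  have \<beta>B: "\<beta> a \<in> B" if "a \<in> A" for a using that \<beta> by blast
  have \<xi>U: "\<xi> a \<in> U" "\<xi> a \<in> M" if "a \<in> A" for a using that \<xi> U(1) by blast+
  define G where "G = (\<lambda>a. \<phi> a (\<xi> a) (\<beta> a)) ` A \<union> (\<lambda>w. \<phi> a0 w (\<beta> a0)) ` W"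
  have GT: "G \<subseteq> T" unfolding G_def using TI a0 B(1) W(1) \<beta>B \<xi>U by auto
  have fin: "finite G" unfolding G_def using A W by simp
  \<comment> \<open>Members of \<open>G\<close> might coincide, so only an upper bound is immediate;
    the general lower bound turns it into an equality.\<close>
  have "card G \<le> card ((\<lambda>a. \<phi> a (\<xi> a) (\<beta> a)) ` A) + card ((\<lambda>w. \<phi> a0 w (\<beta> a0)) ` W)"
    unfolding G_def by (rule card_Un_le)
  also have "\<dots> \<le> card A + card W" using A W by (intro add_mono card_image_le)
  finally have le: "card G \<le> card A + (if U = M then 0 else 1)" using W by simp
  \<comment> \<open>A word in the middle entries is the middle entry of the corresponding product of
    generators. The outer entries are left open here and are adjusted in \<open>all\<close>.\<close>
  have word: "\<exists>a\<in>A. \<exists>b\<in>B. \<phi> a w b \<in> generated f G \<and> w \<in> M" if "w \<in> generated (\<cdot>) (\<xi> ` A \<union> W)" for w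
    using that
  proof induction
    case (base w)
    then consider a where "a \<in> A" "w = \<xi> a" | "w \<in> W" by blast
    then show ?case
    proof cases
      case 1
      then have "\<phi> a w (\<beta> a) \<in> generated f G" by (intro generated.base) (simp add: G_def)
      then show ?thesis using 1 \<beta>B \<xi>U by blast
    next
      case 2
      then have "\<phi> a0 w (\<beta> a0) \<in> generated f G" by (intro generated.base) (simp add: G_def)
      then show ?thesis using 2 a0 B(1) W(1) by blast
    qed
  next
    case (mult v w)
    from mult.IH obtain a b c d where "a \<in> A" "b \<in> B" "\<phi> a v b \<in> generated f G" "v \<in> M"
      "c \<in> A" "d \<in> B" "\<phi> c w d \<in> generated f G" "w \<in> M" by (elim bexE conjE)
    then show ?case using generated.mult[of "\<phi> a v b" f G "\<phi> c w d"] f_\<phi> closed by metis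
  qed
  have all: "\<phi> a x b \<in> generated f G" if a: "a \<in> A" and x: "x \<in> M" and b: "b \<in> B" for a x b
  proof -
    obtain c where c: "c \<in> A" "\<beta> c = b" using b \<beta> by blast
    obtain y where y: "y \<in> U" "\<xi> a \<cdot> y = e" using U_inverse \<xi>U(1)[OF a] by blast
    obtain z where z: "z \<in> U" "z \<cdot> \<xi> c = e" using U_inverse \<xi>U(1)[OF c(1)] by blast
    have yz: "y \<in> M" "z \<in> M" using y z U(1) by auto
    \<comment> \<open>The generator for \<open>a\<close> on the left and one with right entry
      \<open>b\<close> on the right set the outer entries; \<open>y\<close> and \<open>z\<close>
      cancel the middle entries that they bring along.\<close>
    let ?w = "y \<cdot> x \<cdot> z"
    have wM: "y \<cdot> x \<in> M" "?w \<in> M" using closed yz x by blast+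
    then obtain a' b' where w: "a' \<in> A" "b' \<in> B" "\<phi> a' ?w b' \<in> generated f G" using word M by blast
    have ga: "\<phi> a (\<xi> a) (\<beta> a) \<in> generated f G" "\<phi> c (\<xi> c) b \<in> generated f G"
      using a c by (auto intro!: generated.base simp: G_def)
    have "f (f (\<phi> a (\<xi> a) (\<beta> a)) (\<phi> a' ?w b')) (\<phi> c (\<xi> c) b) \<in> generated f G"
      using ga w(3) by (intro generated.mult)
    also have "f (f (\<phi> a (\<xi> a) (\<beta> a)) (\<phi> a' ?w b')) (\<phi> c (\<xi> c) b) = \<phi> a (\<xi> a \<cdot> ?w \<cdot> \<xi> c) b"
      using f_\<phi> closed a c w wM \<xi>U \<beta>B b by simp
    also have "\<xi> a \<cdot> ?w \<cdot> \<xi> c = (\<xi> a \<cdot> (y \<cdot> x)) \<cdot> (z \<cdot> \<xi> c)"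
      using assoc closed wM yz \<xi>U[OF a] \<xi>U[OF c(1)] by simp
    also have "\<dots> = (\<xi> a \<cdot> y) \<cdot> x"
      unfolding z(2) using assoc[OF \<xi>U(2)[OF a] yz(1) x] unit closed \<xi>U(2)[OF a] wM by simp
    also have "\<dots> = x" unfolding y(2) using unit x by simp
    finally show ?thesis .
  qed
  have gen: "generated f G = T"
  proof
    have "f s t \<in> T" if "s \<in> T" "t \<in> T" for s t
      using that f_\<phi> closed by (elim TE) (auto intro: TI)
    then show "generated f G \<subseteq> T" using GT generated_closed by metis
    show "T \<subseteq> generated f G" using all unfolding T_eq by blast
  qed
  show ?thesis
  proof (rule semigroup_rank_eqI[OF GT fin _ gen])
    show "card G = card A + (if U = M then 0 else 1)"
      using le generators_lower_bound[OF GT fin gen A(2) B(2)] by simp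
  qed (rule generators_lower_bound[OF _ _ _ A(2) B(2)])
qed

end

section \<open>Sandwich semigroups\<close>

lemma double_factorial_add_2:
  assumes "k \<ge> -1"
  shows "double_factorial (k + 2) = (k + 2) * double_factorial k"
proof -
  have "{i\<in>{1..k + 2}. even (k + 2 - i)} = insert (k + 2) {i\<in>{1..k}. even (k - i)}" (is "?L = insert _ ?R")
  proof (intro set_eqI iffI)
    fix i assume "i \<in> ?L"
    moreover from this have "i \<noteq> k + 1" by auto
    ultimately show "i \<in> insert (k + 2) ?R" by auto
  qed (use assms in auto)
  moreover have "k + 2 \<notin> ?R" by simp
  moreover have "finite ?R" by (rule finite_subset[of _ "{1..k}"]) auto
  ultimately show ?thesis by (simp add: double_factorial_def)
qed

lemma double_factorial_pos: "double_factorial k > 0"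
  unfolding double_factorial_def by (rule prod_pos) auto

text \<open>For \<open>m = r + 2 * k\<close> one has \<open>m + r = 2 * r + 2 * k\<close>, and the
  quotient leaves the \<open>k\<close> odd numbers from \<open>2 * r + 1\<close> on.\<close>

lemma double_factorial_quotient:
  "real_of_int (double_factorial (int (2 * r + 2 * k) - 1)) / real_of_int (double_factorial (2 * int r - 1))
    = real (\<Prod>i<k. r + r + 2 * i + 1)"
proof (induction k)
  case 0
  have "double_factorial (2 * int r - 1) \<noteq> 0" using double_factorial_pos[of "2 * int r - 1"] by simp
  then show ?case by simp
next
  case (Suc k)
  have "int (2 * r + 2 * Suc k) - 1 = (int (2 * r + 2 * k) - 1) + 2" by simp
  then have "double_factorial (int (2 * r + 2 * Suc k) - 1) =
      (int (2 * r + 2 * k) + 1) * double_factorial (int (2 * r + 2 * k) - 1)"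
    using double_factorial_add_2[of "int (2 * r + 2 * k) - 1"] by (simp add: algebra_simps)
  then have "real_of_int (double_factorial (int (2 * r + 2 * Suc k) - 1)) / real_of_int (double_factorial (2 * int r - 1)) =
      real (2 * r + 2 * k + 1) *
      (real_of_int (double_factorial (int (2 * r + 2 * k) - 1)) / real_of_int (double_factorial (2 * int r - 1)))"
    by simp
  also have "\<dots> = real (\<Prod>i<Suc k. r + r + 2 * i + 1)"
    unfolding Suc.IH by (simp add: algebra_simps)
  finally show ?case .
qed

section \<open>Factoring a diagram through its transversals\<close>

lemma card_transversals:
  assumes s: "s \<in> diagrams X Y"
  shows "card {B\<in>s. B \<inter> range Upper \<noteq> {} \<and> B \<inter> range Lower \<noteq> {}} =
    card {j\<in>Y. \<forall>B\<in>s. Lower j \<in> B \<longrightarrow> \<not> B \<subseteq> range Lower}"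
proof (rule bij_betw_same_card[symmetric])
  let ?R = "{j\<in>Y. \<forall>B\<in>s. Lower j \<in> B \<longrightarrow> \<not> B \<subseteq> range Lower}"
  let ?T = "{B\<in>s. B \<inter> range Upper \<noteq> {} \<and> B \<inter> range Lower \<noteq> {}}"
  have sm: "matching_on (Upper ` X \<union> Lower ` Y) s" using s by (rule diagrams_matching)
  have TR: "\<exists>i j. B = {Upper i, Lower j} \<and> j \<in> ?R" if B: "B \<in> ?T" for B
  proof -
    have Bs: "B \<in> s" using B by simp
    obtain u v where uv: "B = {u, v}" "u \<noteq> v" "u \<in> Upper ` X \<union> Lower ` Y" "v \<in> Upper ` X \<union> Lower ` Y"
      by (rule matching_on_blockE[OF sm Bs])
    then obtain i j where ij: "B = {Upper i, Lower j}" "j \<in> Y" using B by auto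
    have "\<not> C \<subseteq> range Lower" if "C \<in> s" "Lower j \<in> C" for C
      using matching_on_block_unique[OF sm Bs that(1), of "Lower j"] that(2) ij(1) by auto
    then show ?thesis using ij by blast
  qed
  have RT: "\<exists>i. {Upper i, Lower j} \<in> s" if j: "j \<in> ?R" for j
  proof -
    have "Lower j \<in> Upper ` X \<union> Lower ` Y" using j by simp
    then obtain v where v: "{Lower j, v} \<in> s" "v \<in> Upper ` X \<union> Lower ` Y" by (rule matching_on_partner[OF sm])
    have "\<forall>B\<in>s. Lower j \<in> B \<longrightarrow> \<not> B \<subseteq> range Lower" using j by simp
    from bspec[OF this v(1)] have "v \<notin> range Lower" by simp
    then obtain i where "v = Upper i" using v(2) by auto
    then show ?thesis using v(1) by (auto simp: insert_commute)
  qed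
  define g where "g j = (SOME i. {Upper i, Lower j} \<in> s)" for j
  have g: "{Upper (g j), Lower j} \<in> s" if "j \<in> ?R" for j
    unfolding g_def using RT[OF that] by (rule someI_ex)
  show "bij_betw (\<lambda>j. {Upper (g j), Lower j}) ?R ?T"
  proof (rule bij_betwI')
    show "({Upper (g j), Lower j} = {Upper (g k), Lower k}) = (j = k)" for j k
      by (auto simp: doubleton_eq_iff)
    show "{Upper (g j), Lower j} \<in> ?T" if "j \<in> ?R" for j using g[OF that] by auto
    fix B assume B: "B \<in> ?T"
    then obtain i j where ij: "B = {Upper i, Lower j}" "j \<in> ?R" using TR by blast
    have "{Upper (g j), Lower j} = B"
      using g[OF ij(2)] B ij(1) by (intro matching_on_block_unique[OF sm, of _ _ "Lower j"]) auto
    then show "\<exists>j\<in>?R. B = {Upper (g j), Lower j}" using ij(2) by blast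
  qed
qed

text \<open>The set \<open>R\<close> consists of the lower ends of the transversals. Cutting the
  lower arcs off \<open>s\<close> leaves \<open>s1\<close>, and \<open>s2\<close> puts them back
  below an identity on \<open>R\<close>.\<close>

lemma diagram_factorization:
  assumes s: "s \<in> diagrams X Y"
  obtains R s1 s2 where "R \<subseteq> Y" "card R = prank s" "s1 \<in> diagrams X R" "s2 \<in> diagrams R Y" "s1 \<bullet> s2 = s"
    "\<forall>B\<in>s1. B \<inter> range Upper \<noteq> {}" "\<forall>B\<in>s2. B \<inter> range Lower \<noteq> {}"
proof -
  have sm: "matching_on (Upper ` X \<union> Lower ` Y) s" and fin: "finite X" "finite Y"
    using diagrams_matching[OF s] diagrams_finite[OF s] by auto
  define R where "R = {j\<in>Y. \<forall>B\<in>s. Lower j \<in> B \<longrightarrow> \<not> B \<subseteq> range Lower}"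
  define L where "L = {B\<in>s. B \<subseteq> range Lower}"
  have Ls: "L \<subseteq> s" by (auto simp: L_def)
  have UL: "\<Union>L = Lower ` (Y - R)"
  proof
    show "\<Union>L \<subseteq> Lower ` (Y - R)"
    proof
      fix v assume "v \<in> \<Union>L"
      then obtain B where B: "B \<in> s" "B \<subseteq> range Lower" "v \<in> B" by (auto simp: L_def)
      then have "v \<in> Upper ` X \<union> Lower ` Y" using matching_on_Union[OF sm] by blast
      then obtain j where "v = Lower j" "j \<in> Y" using B by auto
      then show "v \<in> Lower ` (Y - R)" using B by (auto simp: R_def)
    qed
    show "Lower ` (Y - R) \<subseteq> \<Union>L" by (auto simp: R_def L_def)
  qed
  have R: "R \<subseteq> Y" "finite R" using fin by (auto simp: R_def)
  have L: "matching_on (Lower ` (Y - R)) L" using matching_on_subset[OF sm Ls] unfolding UL .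
  let ?s1 = "s - L" and ?s2 = "id_diagram R \<union> L"
  have "matching_on (Upper ` X \<union> Lower ` Y - \<Union>L) ?s1" by (rule matching_on_Diff[OF sm Ls])
  moreover have "Upper ` X \<union> Lower ` Y - \<Union>L = Upper ` X \<union> Lower ` R" unfolding UL using R by auto
  ultimately have s1: "?s1 \<in> diagrams X R" using fin R by (simp add: diagrams_def)
  have idR: "id_diagram R \<in> diagrams R R" using R by auto
  have "matching_on ((Upper ` R \<union> Lower ` R) \<union> Lower ` (Y - R)) ?s2"
    by (rule matching_on_Un[OF diagrams_matching[OF idR] L]) auto
  moreover have "(Upper ` R \<union> Lower ` R) \<union> Lower ` (Y - R) = Upper ` R \<union> Lower ` Y" using R by auto
  ultimately have s2: "?s2 \<in> diagrams R Y" using fin R by (simp add: diagrams_def)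
  have "matching_on (layer 1 2 ` Lower ` (Y - R)) (at_layers 1 2 L)"
    by (rule matching_on_relabel[OF L]) (auto simp: inj_on_def)
  moreover have "layer 1 2 ` Lower ` (Y - R) = {2} \<times> (Y - R)" by (auto simp: image_image)
  ultimately have L2: "matching_on ({2} \<times> (Y - R)) (at_layers 1 2 L)" by simp
  have m1: "matching_on ({0} \<times> X \<union> {1} \<times> R) (at_layers 0 1 ?s1)" using s1 by (intro matching_at_layers) auto
  have m2: "matching_on ({1} \<times> R \<union> {2} \<times> R) (at_layers 1 2 (id_diagram R))" using idR by (intro matching_at_layers) auto
  have m3: "matching_on ({0} \<times> X \<union> {2} \<times> R) (at_layers 0 2 ?s1)" using s1 by (intro matching_at_layers) auto
  have "at_layers 0 2 (?s1 \<bullet> ?s2) = at_layers 0 1 ?s1 \<odot> at_layers 1 2 ?s2"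
    by (rule at_layers_mul[OF s1 s2]) auto
  \<comment> \<open>The two parts of \<open>?s2\<close> are disjoint and so act one after the other:
    the identity moves row 1 to row 2, and then the lower arcs are added.\<close>
  also have "at_layers 1 2 ?s2 = at_layers 1 2 (id_diagram R) \<odot> at_layers 1 2 L"
    unfolding image_Un by (rule glue_matching_disjoint[OF m2 L2, symmetric]) auto
  also have "at_layers 0 1 ?s1 \<odot> \<dots> = at_layers 0 1 ?s1 \<odot> at_layers 1 2 (id_diagram R) \<odot> at_layers 1 2 L"
    by (rule glue_matching_assoc[OF m1 m2 L2, symmetric]) auto
  also have "at_layers 0 1 ?s1 \<odot> at_layers 1 2 (id_diagram R) = at_layers 0 2 (?s1 \<bullet> id_diagram R)"
    by (rule at_layers_mul[OF s1 idR, symmetric]) auto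
  also have "?s1 \<bullet> id_diagram R = ?s1" using s1 by simp
  also have "at_layers 0 2 ?s1 \<odot> at_layers 1 2 L = at_layers 0 2 ?s1 \<union> at_layers 1 2 L"
    by (rule glue_matching_disjoint[OF m3 L2]) auto
  also have "at_layers 1 2 L = at_layers 0 2 L" by (rule relabel_cong) (auto simp: UL)
  also have "at_layers 0 2 ?s1 \<union> at_layers 0 2 L = at_layers 0 2 s"
    unfolding image_Un[symmetric] using Ls by (simp add: Un_absorb2)
  finally have "?s1 \<bullet> ?s2 = s" using at_layers_inject[OF mul_closed[OF s1 s2] s, of 0 2] by simp
  moreover have "\<forall>B\<in>?s1. B \<inter> range Upper \<noteq> {}"
  proof
    fix B assume B: "B \<in> ?s1"
    then have "B \<subseteq> Upper ` X \<union> Lower ` Y" using matching_on_Union[OF sm] by blast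
    moreover obtain v where "v \<in> B" "v \<notin> range Lower" using B by (auto simp: L_def)
    ultimately have "v \<in> Upper ` X" by blast
    then show "B \<inter> range Upper \<noteq> {}" using \<open>v \<in> B\<close> by blast
  qed
  moreover have "\<forall>B\<in>?s2. B \<inter> range Lower \<noteq> {}"
  proof
    fix B assume "B \<in> ?s2"
    then show "B \<inter> range Lower \<noteq> {}"
    proof
      assume "B \<in> id_diagram R"
      then show ?thesis by (auto simp: graph_diagram_def)
    next
      assume B: "B \<in> L"
      then have "B \<noteq> {}" using matching_on_blockE[OF L B] by blast
      then show ?thesis using B by (auto simp: L_def)
    qed
  qed
  moreover have "card R = prank s" unfolding prank_def card_transversals[OF s] R_def ..
  ultimately show thesis using R(1) s1 s2 by (intro that)
qed

lemma surj_image_exists: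
  assumes "finite A" "finite S" "S \<noteq> {}" "card S \<le> card A"
  shows "\<exists>f. f ` A = S"
  using inj_on_iff_surj[OF assms(3), of A] card_le_inj[OF assms(2,1,4)] by blast

section \<open>Regular elements as triples\<close>

locale sandwich_factorization =
  fixes m n :: nat and \<sigma> \<sigma>1 \<sigma>2 :: "vertex set set" and R :: "nat set"
  assumes \<sigma>1: "\<sigma>1 \<in> diagrams {1..n} R" and \<sigma>2: "\<sigma>2 \<in> diagrams R {1..m}" and \<sigma>: "\<sigma>1 \<bullet> \<sigma>2 = \<sigma>"
    and upper: "\<forall>B\<in>\<sigma>1. B \<inter> range Upper \<noteq> {}" and lower: "\<forall>B\<in>\<sigma>2. B \<inter> range Lower \<noteq> {}"
begin

abbreviation "star \<equiv> sandwich m n \<sigma>"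

definition A where "A = {a \<in> diagrams {1..m} R. \<sigma>2 \<bullet> a = id_diagram R}"

definition B where "B = {b \<in> diagrams R {1..n}. b \<bullet> \<sigma>1 = id_diagram R}"

definition \<phi> where "\<phi> a x b = a \<bullet> x \<bullet> b"

lemma finite_R: "finite R" using diagrams_finite[OF \<sigma>1] by simp

lemma id_R: "id_diagram R \<in> diagrams R R" using finite_R by blast

lemma AD: "a \<in> A \<Longrightarrow> a \<in> diagrams {1..m} R" "a \<in> A \<Longrightarrow> \<sigma>2 \<bullet> a = id_diagram R" by (auto simp: A_def)

lemma BD: "b \<in> B \<Longrightarrow> b \<in> diagrams R {1..n}" "b \<in> B \<Longrightarrow> b \<bullet> \<sigma>1 = id_diagram R" by (auto simp: B_def)

text \<open>The factorization splits the sandwich element: the left operand sees only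
  \<open>\<sigma>1\<close>, the right one only \<open>\<sigma>2\<close>.\<close>

lemma star_eq:
  assumes \<alpha>: "\<alpha> \<in> diagrams {1..m} {1..n}" and \<beta>: "\<beta> \<in> diagrams {1..m} {1..n}"
  shows "star \<alpha> \<beta> = (\<alpha> \<bullet> \<sigma>1) \<bullet> (\<sigma>2 \<bullet> \<beta>)"
proof -
  have s: "\<sigma> \<in> diagrams {1..n} {1..m}" using mul_closed[OF \<sigma>1 \<sigma>2] unfolding \<sigma> .
  have "star \<alpha> \<beta> = (\<alpha> \<bullet> (\<sigma>1 \<bullet> \<sigma>2)) \<bullet> \<beta>"
    unfolding sandwich_def pprod_eq_mul[OF \<alpha> s] pprod_eq_mul[OF mul_closed[OF \<alpha> s] \<beta>] \<sigma> ..
  also have "\<dots> = ((\<alpha> \<bullet> \<sigma>1) \<bullet> \<sigma>2) \<bullet> \<beta>" unfolding mul_assoc[OF \<alpha> \<sigma>1 \<sigma>2] ..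
  also have "\<dots> = (\<alpha> \<bullet> \<sigma>1) \<bullet> (\<sigma>2 \<bullet> \<beta>)" by (rule mul_assoc[OF mul_closed[OF \<alpha> \<sigma>1] \<sigma>2 \<beta>])
  finally show ?thesis .
qed

lemma \<phi>_closed:
  assumes "a \<in> A" "x \<in> diagrams R R" "b \<in> B"
  shows "\<phi> a x b \<in> diagrams {1..m} {1..n}"
  unfolding \<phi>_def using mul_closed[OF mul_closed[OF AD(1)[OF assms(1)] assms(2)] BD(1)[OF assms(3)]] .

lemma \<phi>_\<sigma>1:
  assumes "a \<in> A" "x \<in> diagrams R R" "b \<in> B"
  shows "\<phi> a x b \<bullet> \<sigma>1 = a \<bullet> x"
proof -
  have ax: "a \<bullet> x \<in> diagrams {1..m} R" using mul_closed[OF AD(1) assms(2)] assms(1) .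
  have "\<phi> a x b \<bullet> \<sigma>1 = (a \<bullet> x) \<bullet> (b \<bullet> \<sigma>1)"
    unfolding \<phi>_def by (rule mul_assoc[OF ax BD(1)[OF assms(3)] \<sigma>1])
  then show ?thesis using BD(2)[OF assms(3)] ax by simp
qed

lemma \<sigma>2_mul:
  assumes "a \<in> A" "x \<in> diagrams R R"
  shows "\<sigma>2 \<bullet> (a \<bullet> x) = x"
  using mul_assoc[OF \<sigma>2 AD(1)[OF assms(1)] assms(2)] AD(2)[OF assms(1)] assms(2) by simp

lemma \<sigma>2_\<phi>:
  assumes "a \<in> A" "x \<in> diagrams R R" "b \<in> B"
  shows "\<sigma>2 \<bullet> \<phi> a x b = x \<bullet> b"
  unfolding \<phi>_def
  using mul_assoc[OF \<sigma>2 mul_closed[OF AD(1)[OF assms(1)] assms(2)] BD(1)[OF assms(3)]] \<sigma>2_mul[OF assms(1,2)] by simp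

text \<open>The inner entries \<open>b\<close> and \<open>c\<close> cancel against
  \<open>\<sigma>1\<close> and \<open>\<sigma>2\<close>.\<close>

lemma star_\<phi>:
  assumes a: "a \<in> A" and x: "x \<in> diagrams R R" and b: "b \<in> B"
    and c: "c \<in> A" and y: "y \<in> diagrams R R" and d: "d \<in> B"
  shows "star (\<phi> a x b) (\<phi> c y d) = \<phi> a (x \<bullet> y) d"
proof -
  have "star (\<phi> a x b) (\<phi> c y d) = (a \<bullet> x) \<bullet> (y \<bullet> d)"
    unfolding star_eq[OF \<phi>_closed[OF a x b] \<phi>_closed[OF c y d]] \<phi>_\<sigma>1[OF a x b] \<sigma>2_\<phi>[OF c y d] ..
  also have "\<dots> = ((a \<bullet> x) \<bullet> y) \<bullet> d"
    by (rule mul_assoc[OF mul_closed[OF AD(1)[OF a] x] y BD(1)[OF d], symmetric])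
  also have "(a \<bullet> x) \<bullet> y = a \<bullet> (x \<bullet> y)" by (rule mul_assoc[OF AD(1)[OF a] x y])
  finally show ?thesis unfolding \<phi>_def .
qed

text \<open>For a triple, \<open>\<phi> a (flip x) b\<close> witnesses regularity. Conversely, a
  regular \<open>\<alpha>\<close> equals \<open>u \<bullet> z \<bullet> v\<close> with
  \<open>u = \<alpha> \<bullet> \<sigma>1\<close> and
  \<open>v = \<sigma>2 \<bullet> \<alpha>\<close>. Multiplying this by \<open>\<sigma>1\<close>
  shows that \<open>x = \<sigma>2 \<bullet> u\<close> is a right factor of \<open>u\<close>, so
  \<open>u\<close> contains the lower arcs of \<open>x\<close> and lifts to
  \<open>a \<bullet> x\<close>; dually \<open>v\<close> lifts to
  \<open>x \<bullet> b\<close>.\<close>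

lemma regular_eq:
  "regular_elements (brauer m n) star = {\<phi> a x b | a x b. a \<in> A \<and> x \<in> diagrams R R \<and> b \<in> B}"
proof (intro set_eqI iffI)
  fix \<alpha> assume "\<alpha> \<in> {\<phi> a x b | a x b. a \<in> A \<and> x \<in> diagrams R R \<and> b \<in> B}"
  then obtain a x b where \<alpha>: "\<alpha> = \<phi> a x b" and a: "a \<in> A" and x: "x \<in> diagrams R R" and b: "b \<in> B" by blast
  have fx: "flip x \<in> diagrams R R" using flip_closed[OF x] .
  have "star (star \<alpha> (\<phi> a (flip x) b)) \<alpha> = \<phi> a (x \<bullet> flip x \<bullet> x) b"
    unfolding \<alpha> star_\<phi>[OF a x b a fx b] by (rule star_\<phi>[OF a mul_closed[OF x fx] b a x b])
  also have "\<dots> = \<alpha>" unfolding mul_flip_mul[OF x] \<alpha> ..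
  finally show "\<alpha> \<in> regular_elements (brauer m n) star"
    unfolding regular_elements_def brauer_eq_diagrams using \<phi>_closed[OF a x b] \<phi>_closed[OF a fx b] \<alpha> by auto
next
  fix \<alpha> assume "\<alpha> \<in> regular_elements (brauer m n) star"
  then obtain \<beta> where \<alpha>: "\<alpha> \<in> diagrams {1..m} {1..n}" and \<beta>: "\<beta> \<in> diagrams {1..m} {1..n}"
    and reg: "star (star \<alpha> \<beta>) \<alpha> = \<alpha>"
    unfolding regular_elements_def brauer_eq_diagrams by blast
  define u where "u = \<alpha> \<bullet> \<sigma>1"
  define v where "v = \<sigma>2 \<bullet> \<alpha>"
  define z where "z = \<sigma>2 \<bullet> \<beta> \<bullet> \<sigma>1"
  define x where "x = \<sigma>2 \<bullet> u"
  have u: "u \<in> diagrams {1..m} R" unfolding u_def by (rule mul_closed[OF \<alpha> \<sigma>1])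
  have v: "v \<in> diagrams R {1..n}" unfolding v_def by (rule mul_closed[OF \<sigma>2 \<alpha>])
  have \<sigma>2\<beta>: "\<sigma>2 \<bullet> \<beta> \<in> diagrams R {1..n}" by (rule mul_closed[OF \<sigma>2 \<beta>])
  have z: "z \<in> diagrams R R" unfolding z_def by (rule mul_closed[OF \<sigma>2\<beta> \<sigma>1])
  have x: "x \<in> diagrams R R" unfolding x_def by (rule mul_closed[OF \<sigma>2 u])
  have uz: "u \<bullet> z \<in> diagrams {1..m} R" by (rule mul_closed[OF u z])
  have x': "x = v \<bullet> \<sigma>1" unfolding x_def u_def v_def by (rule mul_assoc[OF \<sigma>2 \<alpha> \<sigma>1, symmetric])
  have "star \<alpha> \<beta> = u \<bullet> (\<sigma>2 \<bullet> \<beta>)" unfolding u_def by (rule star_eq[OF \<alpha> \<beta>])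
  then have "\<alpha> = (u \<bullet> (\<sigma>2 \<bullet> \<beta>)) \<bullet> \<sigma>1 \<bullet> v"
    using star_eq[OF mul_closed[OF u \<sigma>2\<beta>] \<alpha>] reg v_def by simp
  also have "(u \<bullet> (\<sigma>2 \<bullet> \<beta>)) \<bullet> \<sigma>1 = u \<bullet> z" unfolding z_def by (rule mul_assoc[OF u \<sigma>2\<beta> \<sigma>1])
  finally have \<alpha>_eq: "\<alpha> = u \<bullet> z \<bullet> v" .
  have u_eq: "u = u \<bullet> z \<bullet> x"
    using mul_assoc[OF uz v \<sigma>1] \<alpha>_eq unfolding u_def[symmetric] x' by (metis u_def)
  have v_eq: "v = x \<bullet> (z \<bullet> v)"
  proof -
    have "v = \<sigma>2 \<bullet> (u \<bullet> z \<bullet> v)" using \<alpha>_eq v_def by simp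
    also have "\<dots> = \<sigma>2 \<bullet> (u \<bullet> z) \<bullet> v" by (rule mul_assoc[OF \<sigma>2 uz v, symmetric])
    also have "\<sigma>2 \<bullet> (u \<bullet> z) = x \<bullet> z" unfolding x_def by (rule mul_assoc[OF \<sigma>2 u z, symmetric])
    also have "x \<bullet> z \<bullet> v = x \<bullet> (z \<bullet> v)" by (rule mul_assoc[OF x z v])
    finally show ?thesis .
  qed
  have "\<forall>C\<in>x. C \<subseteq> range Lower \<longrightarrow> C \<in> u"
    using mul_keeps_lower[OF uz x] unfolding u_eq[symmetric] by blast
  moreover have "\<sigma>2 \<bullet> u = id_diagram R \<bullet> x" using x x_def by simp
  ultimately obtain a where a: "a \<in> diagrams {1..m} R" "\<sigma>2 \<bullet> a = id_diagram R" "a \<bullet> x = u"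
    using right_cofactor_lift[OF \<sigma>2 lower u id_R x] by blast
  have "\<forall>C\<in>x. C \<subseteq> range Upper \<longrightarrow> C \<in> v"
    using mul_keeps_upper[OF x mul_closed[OF z v]] unfolding v_eq[symmetric] by blast
  moreover have "v \<bullet> \<sigma>1 = x \<bullet> id_diagram R" using x x' by simp
  ultimately obtain b where b: "b \<in> diagrams R {1..n}" "b \<bullet> \<sigma>1 = id_diagram R" "x \<bullet> b = v"
    using left_cofactor_lift[OF \<sigma>1 upper v id_R x] by blast
  have xz: "x \<bullet> z \<in> diagrams R R" by (rule mul_closed[OF x z])
  have "\<alpha> = (a \<bullet> x) \<bullet> z \<bullet> (x \<bullet> b)" using \<alpha>_eq a(3) b(3) by simp
  also have "\<dots> = (a \<bullet> x) \<bullet> z \<bullet> x \<bullet> b"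
    by (rule mul_assoc[OF mul_closed[OF mul_closed[OF a(1) x] z] x b(1), symmetric])
  also have "(a \<bullet> x) \<bullet> z = a \<bullet> (x \<bullet> z)" by (rule mul_assoc[OF a(1) x z])
  also have "a \<bullet> (x \<bullet> z) \<bullet> x = a \<bullet> (x \<bullet> z \<bullet> x)" by (rule mul_assoc[OF a(1) xz x])
  finally have "\<alpha> = \<phi> a (x \<bullet> z \<bullet> x) b" unfolding \<phi>_def .
  then show "\<alpha> \<in> {\<phi> a x b | a x b. a \<in> A \<and> x \<in> diagrams R R \<and> b \<in> B}"
    using a b mul_closed[OF xz x] by (auto simp: A_def B_def)
qed

definition U where "U = {graph_diagram p R | p. p permutes R}"

lemma U_iff: "x \<in> U \<longleftrightarrow> x \<in> diagrams R R \<and> (\<forall>C\<in>x. \<not> C \<subseteq> range Upper)"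
proof
  assume "x \<in> U"
  then have p: "\<exists>p. p permutes R \<and> x = graph_diagram p R" by (auto simp: U_def)
  then have x: "x \<in> diagrams R R" using permutation_diagram_closed[OF finite_R] by auto
  then show "x \<in> diagrams R R \<and> (\<forall>C\<in>x. \<not> C \<subseteq> range Upper)" using p permutation_diagram_iff[OF x] by simp
next
  assume "x \<in> diagrams R R \<and> (\<forall>C\<in>x. \<not> C \<subseteq> range Upper)"
  then have "\<exists>p. p permutes R \<and> x = graph_diagram p R" using permutation_diagram_iff[of x R] by simp
  then show "x \<in> U" by (auto simp: U_def)
qed

lemma graph_mul:
  assumes "p permutes R" "q permutes R"
  shows "graph_diagram p R \<bullet> graph_diagram q R = graph_diagram (q \<circ> p) R"
  by (rule graph_diagram_mul[OF finite_R permutes_imp_bij[OF assms(1)] permutes_imp_bij[OF assms(2)]])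

lemma U_inverse: "x \<in> U \<Longrightarrow> \<exists>y\<in>U. x \<bullet> y = id_diagram R \<and> y \<bullet> x = id_diagram R"
proof -
  assume "x \<in> U"
  then obtain p where p: "p permutes R" "x = graph_diagram p R" by (auto simp: U_def)
  have "graph_diagram (inv p) R \<in> U" using permutes_inv[OF p(1)] by (auto simp: U_def)
  moreover have "x \<bullet> graph_diagram (inv p) R = id_diagram R" "graph_diagram (inv p) R \<bullet> x = id_diagram R"
    unfolding p(2) graph_mul[OF p(1) permutes_inv[OF p(1)]] graph_mul[OF permutes_inv[OF p(1)] p(1)]
    using permutes_inv_o[OF p(1)] by (simp_all add: id_def)
  ultimately show ?thesis by blast
qed

text \<open>The middle entry is recovered as
  \<open>\<sigma>2 \<bullet> (\<phi> a x b \<bullet> \<sigma>1)\<close>.\<close>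

lemma \<phi>_middle:
  assumes "a \<in> A" "x \<in> diagrams R R" "b \<in> B" "c \<in> A" "y \<in> diagrams R R" "d \<in> B" "\<phi> a x b = \<phi> c y d"
  shows "x = y"
  using \<phi>_\<sigma>1[OF assms(1-3)] \<phi>_\<sigma>1[OF assms(4-6)] \<sigma>2_mul[OF assms(1,2)] \<sigma>2_mul[OF assms(4,5)] assms(7) by simp

text \<open>Multiplication by \<open>\<sigma>1\<close> removes the right entry, and then an inverse
  of \<open>x\<close> removes the middle one.\<close>

lemma \<phi>_left:
  assumes "a \<in> A" "x \<in> U" "b \<in> B" "c \<in> A" "d \<in> B" "\<phi> a x b = \<phi> c x d"
  shows "a = c"
proof -
  have x: "x \<in> diagrams R R" using assms(2) by (simp add: U_iff)
  obtain y where y: "y \<in> diagrams R R" "x \<bullet> y = id_diagram R" using U_inverse[OF assms(2)] by (auto simp: U_iff)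
  have "a \<bullet> x = c \<bullet> x" using \<phi>_\<sigma>1[OF assms(1) x assms(3)] \<phi>_\<sigma>1[OF assms(4) x assms(5)] assms(6) by simp
  then have "a \<bullet> (x \<bullet> y) = c \<bullet> (x \<bullet> y)"
    using mul_assoc[OF AD(1)[OF assms(1)] x y(1)] mul_assoc[OF AD(1)[OF assms(4)] x y(1)] by simp
  then show "a = c" using y(2) AD(1)[OF assms(1)] AD(1)[OF assms(4)] by simp
qed

lemma U_submonoid: "U \<subseteq> diagrams R R" "id_diagram R \<in> U" "x \<in> U \<Longrightarrow> y \<in> U \<Longrightarrow> x \<bullet> y \<in> U"
proof -
  show "U \<subseteq> diagrams R R" by (auto simp: U_iff)
  show "id_diagram R \<in> U" unfolding U_def using permutes_id[of R] by (auto simp: id_def)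
  show "x \<bullet> y \<in> U" if "x \<in> U" "y \<in> U"
    using that graph_mul permutes_compose unfolding U_def by blast
qed

text \<open>An upper arc of \<open>x\<close> would survive in \<open>x \<bullet> y\<close>, whereas
  members of \<open>U\<close> have none.\<close>

lemma U_left: "x \<in> diagrams R R \<Longrightarrow> y \<in> diagrams R R \<Longrightarrow> x \<bullet> y \<in> U \<Longrightarrow> x \<in> U"
  using mul_keeps_upper[of x R R y R] by (auto simp: U_iff)

sublocale rectangular_extension "regular_elements (brauer m n) star" star "diagrams R R" "(\<bullet>)" "id_diagram R" U A B \<phi>
proof (unfold_locales, goal_cases)
  case 1
  show ?case by (rule regular_eq)
next
  case 2
  then show ?case by (rule star_\<phi>)
next
  case 3
  then show ?case by (rule \<phi>_middle)
next
  case 4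
  then show ?case by (rule \<phi>_left)
next
  case 5
  then show ?case by (rule mul_closed)
next
  case 6
  then show ?case by (rule mul_assoc)
next
  case 7
  then show ?case by (rule mul_id_left)
next
  case 8
  then show ?case by (rule mul_id_right)
next
  case 9
  show ?case by (rule U_submonoid)
next
  case 10
  show ?case by (rule U_submonoid)
next
  case 11
  then show ?case by (rule U_submonoid)
next
  case 12
  then show ?case by (rule U_inverse)
next
  case 13
  then show ?case by (rule U_left)
qed

section \<open>Cardinalities and the rank\<close>

lemma card_A:
  "card A = (\<Prod>i<(m - card R) div 2. card R + card R + 2 * i + 1)" "\<exists>k. m = card R + 2 * k"
  using card_right_cofactors(1)[OF \<sigma>2 lower id_R] card_right_cofactors(2)[OF \<sigma>2 lower id_R]
  unfolding A_def card_atLeastAtMost diff_Suc_1 by simp_all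

lemma card_B:
  "card B = (\<Prod>i<(n - card R) div 2. card R + card R + 2 * i + 1)" "\<exists>k. n = card R + 2 * k"
  using card_left_cofactors(1)[OF \<sigma>1 upper id_R] card_left_cofactors(2)[OF \<sigma>1 upper id_R]
  unfolding B_def card_atLeastAtMost diff_Suc_1 by simp_all

text \<open>The case distinction at \<open>r = 2\<close> arises here: two points allow a hook, and
  fewer leave no room for an arc within a row.\<close>

lemma U_eq_iff: "U = diagrams R R \<longleftrightarrow> card R < 2"
proof
  assume eq: "U = diagrams R R"
  show "card R < 2"
  proof (rule ccontr)
    assume "\<not> card R < 2"
    then obtain S where "S \<subseteq> R" "card S = 2" by (meson not_less obtain_subset_with_card_n)
    then obtain a b where ab: "a \<in> R" "b \<in> R" "a \<noteq> b" by (auto simp: card_2_iff)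
    have "hook R a b \<in> U" unfolding eq by (rule hook_closed[OF finite_R ab])
    then have "\<not> {Upper a, Upper b} \<subseteq> range Upper" by (auto simp: U_iff hook_def)
    then show False by simp
  qed
next
  assume R: "card R < 2"
  have "x \<in> U" if x: "x \<in> diagrams R R" for x
  proof -
    have "\<not> C \<subseteq> range Upper" if C: "C \<in> x" for C
    proof
      assume sub: "C \<subseteq> range Upper"
      obtain u v where uv: "C = {u, v}" "u \<noteq> v" "u \<in> Upper ` R \<union> Lower ` R" "v \<in> Upper ` R \<union> Lower ` R"
        by (rule matching_on_blockE[OF diagrams_matching[OF x] C])
      then obtain i j where "i \<in> R" "j \<in> R" "i \<noteq> j" using sub by auto
      then have "card {i, j} \<le> card R" by (intro card_mono finite_R) auto
      moreover have "card {i, j} = 2" using \<open>i \<noteq> j\<close> by simp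
      ultimately show False using R by simp
    qed
    then show ?thesis using x by (simp add: U_iff)
  qed
  then show "U = diagrams R R" by (auto simp: U_iff)
qed

lemma rank_eq:
  assumes mn: "n \<le> m" "\<not> (card R = m \<and> m = n)"
  shows "semigroup_rank (regular_elements (brauer m n) star) star = card A + (if card R \<ge> 2 then 1 else 0)"
proof -
  obtain k where k: "m = card R + 2 * k" using card_A(2) by blast
  obtain l where l: "n = card R + 2 * l" using card_B(2) by blast
  \<comment> \<open>If \<open>k = 0\<close>, then \<open>card R = m\<close>, and
    \<open>n \<le> m\<close> forces \<open>l = 0\<close> and \<open>n = m\<close>, the excluded
    case.\<close>
  have lk: "l \<le> k" "k \<ge> 1" using mn k l by auto
  let ?f = "\<lambda>i. card R + card R + 2 * i + 1"
  have cA: "card A = (\<Prod>i<k. ?f i)" using card_A(1) k by simp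
  have cB: "card B = (\<Prod>i<l. ?f i)" using card_B(1) l by simp
  have Apos: "card A > 0" unfolding cA by (rule prod_pos) simp
  have Bpos: "card B > 0" unfolding cB by (rule prod_pos) simp
  have "card B dvd card A" unfolding cA cB by (rule prod_dvd_prod_subset) (use lk in auto)
  then have BA: "card B \<le> card A" using Apos by (rule dvd_imp_le)
  \<comment> \<open>The factor for \<open>i = 0\<close> is \<open>2 * card R + 1\<close>; it occurs
    because \<open>k \<ge> 1\<close>.\<close>
  have "prod ?f {0} dvd card A" unfolding cA by (rule prod_dvd_prod_subset) (use lk in auto)
  then have RA: "2 * card R + 1 \<le> card A" using dvd_imp_le[OF _ Apos] by fastforce
  have A: "finite A" "A \<noteq> {}" and B: "finite B" "B \<noteq> {}"
    using Apos Bpos by (auto simp: card_gt_0_iff)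
  obtain \<beta> where \<beta>: "\<beta> ` A = B" using surj_image_exists[OF A(1) B BA] by blast
  \<comment> \<open>For empty \<open>R\<close> the star would be empty, but the image of
    \<open>A\<close> under \<open>\<xi>\<close> cannot be; the identity, here the empty diagram,
    takes its place.\<close>
  define S where "S = (if R = {} then {id_diagram R}
    else (\<lambda>j. graph_diagram (transpose (SOME c. c \<in> R) j) R) ` R)"
  have c: "(SOME c. c \<in> R) \<in> R" if "R \<noteq> {}" using that by (simp add: some_in_eq)
  have S: "finite S" "S \<noteq> {}" using finite_R by (auto simp: S_def)
  have SU: "S \<subseteq> U"
    unfolding S_def U_def using c permutes_id[of R] by (auto simp: id_def intro: permutes_swap_id)
  \<comment> \<open>The summand 1 accounts for the case of empty \<open>R\<close>.\<close>
  have "card S \<le> card R + 1"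
    unfolding S_def using card_image_le[OF finite_R, of "\<lambda>j. graph_diagram (transpose (SOME c. c \<in> R) j) R"] by auto
  then have "card S \<le> card A" using RA by simp
  then obtain \<xi> where \<xi>: "\<xi> ` A = S" using surj_image_exists[OF A(1) S] by blast
  have perm: "graph_diagram p R \<in> generated (\<bullet>) (S \<union> W)" if p: "p permutes R" for p W
  proof (cases "R = {}")
    case True
    then have "graph_diagram p R \<in> S" by (simp add: S_def graph_diagram_def)
    then show ?thesis by (intro generated.base) simp
  next
    case False
    have "generated (\<bullet>) S \<subseteq> generated (\<bullet>) (S \<union> W)"
      by (rule generated_closed) (auto intro: generated.intros)
    then show ?thesis using permutation_diagrams_generated[OF finite_R c[OF False] p] False by (auto simp: S_def)
  qed
  have "\<exists>W. W \<subseteq> diagrams R R \<and> finite W \<and> card W = (if U = diagrams R R then 0 else 1) \<and>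
    diagrams R R \<subseteq> generated (\<bullet>) (\<xi> ` A \<union> W)"
  proof (cases "U = diagrams R R")
    case True
    have "diagrams R R \<subseteq> generated (\<bullet>) (S \<union> {})"
      unfolding True[symmetric] U_def using perm by blast
    then show ?thesis using True \<xi> by (intro exI[of _ "{}"]) auto
  next
    case False
    then have "2 \<le> card R" using U_eq_iff by simp
    then obtain Q where "Q \<subseteq> R" "card Q = 2" by (meson obtain_subset_with_card_n)
    then obtain a b where ab: "a \<in> R" "b \<in> R" "a \<noteq> b" by (auto simp: card_2_iff)
    have "diagrams R R \<subseteq> generated (\<bullet>) (S \<union> {hook R a b})"
      by (rule subsetI, rule diagrams_generated[OF finite_R ab perm]) (auto intro: generated.base)
    then show ?thesis using False \<xi> hook_closed[OF finite_R ab] by (intro exI[of _ "{hook R a b}"]) auto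
  qed
  then obtain W where W: "W \<subseteq> diagrams R R" "finite W" "card W = (if U = diagrams R R then 0 else 1)"
    "diagrams R R \<subseteq> generated (\<bullet>) (\<xi> ` A \<union> W)" by blast
  have "semigroup_rank (regular_elements (brauer m n) star) star = card A + (if U = diagrams R R then 0 else 1)"
    by (rule semigroup_rank_eq[OF A _ \<beta> W]) (use \<xi> SU in simp)
  then show ?thesis using U_eq_iff by auto
qed

end

theorem theorem6p29:
  fixes m n r :: nat and \<sigma> :: "vertex set set"
  assumes "m mod 2 = n mod 2"
    and "\<sigma> \<in> brauer n m"
    and "r = prank \<sigma>"
    and "m \<ge> n"
    and "\<not> (r = m \<and> m = n)"
  shows "real (semigroup_rank (regular_elements (brauer m n) (sandwich m n \<sigma>)) (sandwich m n \<sigma>))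
    = real_of_int (double_factorial (int m + int r - 1)) / real_of_int (double_factorial (2 * int r - 1))
      + (if r \<ge> 2 then 1 else 0)"
proof -
  have "\<sigma> \<in> diagrams {1..n} {1..m}" using assms(2) by (simp add: brauer_eq_diagrams)
  then obtain R \<sigma>1 \<sigma>2 where R: "card R = r" and fac: "\<sigma>1 \<in> diagrams {1..n} R" "\<sigma>2 \<in> diagrams R {1..m}"
    "\<sigma>1 \<bullet> \<sigma>2 = \<sigma>" "\<forall>B\<in>\<sigma>1. B \<inter> range Upper \<noteq> {}" "\<forall>B\<in>\<sigma>2. B \<inter> range Lower \<noteq> {}"
    using assms(3) by (auto elim: diagram_factorization)
  interpret sandwich_factorization m n \<sigma> \<sigma>1 \<sigma>2 R
    using fac by unfold_locales
  obtain k where k: "m = r + 2 * k" using card_A(2) R by blast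
  have cA: "card A = (\<Prod>i<k. r + r + 2 * i + 1)" using card_A(1) k R by simp
  have "int m + int r - 1 = int (2 * r + 2 * k) - 1" using k by simp
  then have "real_of_int (double_factorial (int m + int r - 1)) / real_of_int (double_factorial (2 * int r - 1)) = real (card A)"
    unfolding cA by (simp only: double_factorial_quotient)
  moreover have "semigroup_rank (regular_elements (brauer m n) (sandwich m n \<sigma>)) (sandwich m n \<sigma>) =
      card A + (if r \<ge> 2 then 1 else 0)"
    using rank_eq assms(4,5) R by auto
  ultimately show ?thesis by simp
qed

end
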